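(* Let $\alpha,\beta\in(0,1)$, $m\ge1$ an integer, $T>0$. Let $\xi\in\mathcal B$ be such that $\xi^m\in L^2([0,T]\times[0,1])$ and $\mathcal E^{\alpha,\beta}_{m,\kappa,c}(\xi)\le M_0<\infty$ for some $\kappa>0$, $c>0$ and $M_0>0$. Then there exists $\partial_u\xi^m\in L^2_{\kappa,\xi}([0,T]\times[0,1])$ such that for all $H\in C^{0,1}([0,T]\times[0,1])$ $$\mathcal T^{\alpha,\beta}_{\xi,m}(H)=-\langle\langle\partial_u\xi^m,H\rangle\rangle^{\alpha,\beta}_{\kappa,\xi},$$ and $\xi^m\in L^2(0,T;\mathcal H^1)$. Moreover, $$\mathcal E^{\alpha,\beta}_{m,\kappa,c}(\xi)=\frac1{4c}\langle\langle\partial_u\xi^m,\partial_u\xi^m\rangle\rangle^{\alpha,\beta}_{\kappa,\xi},$$ and, for almost every $s\in(0,T]$, $$\partial_u(\xi_s)^m(0)\,P^\alpha_m(\xi_s(0))=\kappa\big((\xi_s)^m(0)-\alpha^m\big)\quad\text{and}\quad \partial_u(\xi_s)^m(1)\,P^\beta_m(\xi_s(1))=\kappa\big(\beta^m-(\xi_s)^m(1)\big).$$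
   Context: $\langle\cdot,\cdot\rangle$ is the inner product of $L^2([0,1])$, with norm $\|\cdot\|_2$, and $\langle\langle G,H\rangle\rangle:=\int_0^T\langle G_s,H_s\rangle\,ds$. $\mathcal H^1$ is the set of locally summable $\varphi:(0,1)\to\mathbb R$ with a weak derivative $\partial_u\varphi\in L^2([0,1])$, with $\|\varphi\|_{\mathcal H^1}^2=\|\varphi\|_2^2+\|\partial_u\varphi\|_2^2$; $\varphi\in\mathcal H^1$ is extended to $[0,1]$ by $\varphi(0):=\varphi(0^+)$, $\varphi(1):=\varphi(1^-)$, and $(\xi_s)^m(0)$, $(\xi_s)^m(1)$ denote these boundary values of $(\xi_s)^m\in\mathcal H^1$. $L^2(0,T;\mathcal H^1)$ is the set of measurable $\zeta:[0,T]\to\mathcal H^1$ with $\int_0^T\|\zeta_t\|_{\mathcal H^1}^2dt<\infty$. $C^{0,1}([0,T]\times[0,1])$: functions continuous in time and once continuously differentiable in space. For $\gamma\in\{\alpha,\beta\}$ and $r\ge0$, $P^\gamma_m(r)=\sum_{i=0}^{m-1}\gamma^{m-1-i}r^i$. $\mathcal B$ is the set of measurable $\xi:[0,T]\times[0,1]\to[0,\infty)$ such that $s\mapsto\xi_s(0)$ and $s\mapsto\xi_s(1)$ are measurable and bounded. For $\xi\in\mathcal B$ and $\kappa>0$, $L^2_{\kappa,\xi}([0,T]\times[0,1])$ is the Hilbert space of measurable $H:[0,T]\times[0,1]\to\mathbb R$ with $\langle\langle H,H\rangle\rangle^{\alpha,\beta}_{\kappa,\xi}<\infty$, where $$\langle\langle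 G,H\rangle\rangle^{\alpha,\beta}_{\kappa,\xi}=\langle\langle G,H\rangle\rangle+\int_0^T\Big\{\frac{P^\alpha_m(\xi_s(0))}{\kappa}G_s(0)H_s(0)+\frac{P^\beta_m(\xi_s(1))}{\kappa}G_s(1)H_s(1)\Big\}ds$$ (i.e. the $L^2$ space for Lebesgue measure on $[0,1]$ plus Dirac masses at $0$ and $1$ with weights $P^\alpha_m(\xi_s(0))/\kappa$ and $P^\beta_m(\xi_s(1))/\kappa$, integrated over $s\in[0,T]$; the values of its elements at $u=0,1$ are thus defined for almost every $s$). For $\xi^m\in L^2([0,T]\times[0,1])$ and $H\in C^{0,1}([0,T]\times[0,1])$, $$\mathcal T^{\alpha,\beta}_{\xi,m}(H)=\langle\langle\xi^m,\partial_uH\rangle\rangle+\int_0^T\{\alpha^mH_s(0)-\beta^mH_s(1)\}ds,$$ and for $c>0$ $$\mathcal E^{\alpha,\beta}_{m,\kappa,c}(\xi)=\sup_{H\in C^{0,1}([0,T]\times[0,1])}\big\{\mathcal T^{\alpha,\beta}_{\xi,m}(H)-c\,\langle\langle H,H\rangle\rangle^{\alpha,\beta}_{\kappa,\xi}\big\}.$$ $\partial_u(\xi_s)^m(0)$ and $\partial_u(\xi_s)^m(1)$ are the values at $u=0$ and $u=1$ of the element $\partial_u\xi^m$ of $L^2_{\kappa,\xi}([0,T]\times[0,1])$ in the claim. *)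

theory Defs
  imports "HOL-Analysis.Analysis"
begin

text \<open>
  Throughout, a function on \<open>[0,T] \<times> [0,1]\<close> is a curried function \<open>G s u\<close> of time \<open>s\<close> and space \<open>u\<close>;
  only its values on \<open>[0,T] \<times> [0,1]\<close> matter.  ``Measurable'' means Lebesgue measurable.  Elements of
  \<open>L\<^sup>2\<close> spaces and of \<open>\<H>\<^sup>1\<close> are represented by functions, to be read up to equality almost everywhere.
\<close>

definition sq_integrable :: "'a measure \<Rightarrow> ('a \<Rightarrow> real) \<Rightarrow> bool" where
  "sq_integrable M f \<longleftrightarrow> f \<in> borel_measurable M \<and> integrable M (\<lambda>x. (f x)\<^sup>2)"

abbreviation cylinder :: "real \<Rightarrow> (real \<times> real) set" where
  "cylinder T \<equiv> {0..T} \<times> {0..1}"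


subsection \<open>The space \<open>\<H>\<^sup>1\<close>\<close>

definition test_function :: "(real \<Rightarrow> real) \<Rightarrow> bool" where
  "test_function \<eta> \<longleftrightarrow>
     (\<forall>k. (deriv ^^ k) \<eta> differentiable_on UNIV) \<and> closure {x. \<eta> x \<noteq> 0} \<subseteq> {0<..<1}"

definition locally_summable :: "(real \<Rightarrow> real) \<Rightarrow> bool" where
  "locally_summable \<phi> \<longleftrightarrow>
     (\<forall>K. compact K \<and> K \<subseteq> {0<..<1} \<longrightarrow> integrable (lebesgue_on K) \<phi>)"

definition is_weak_derivative :: "(real \<Rightarrow> real) \<Rightarrow> (real \<Rightarrow> real) \<Rightarrow> bool" where
  "is_weak_derivative \<phi> \<psi> \<longleftrightarrow> locally_summable \<phi> \<and> locally_summable \<psi> \<and>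
     (\<forall>\<eta>. test_function \<eta> \<longrightarrow>
        (LINT u|lebesgue_on {0<..<1}. \<phi> u * deriv \<eta> u) = - (LINT u|lebesgue_on {0<..<1}. \<psi> u * \<eta> u))"

definition H1 :: "(real \<Rightarrow> real) set" where
  "H1 = {\<phi>. locally_summable \<phi> \<and>
            (\<exists>\<psi>. is_weak_derivative \<phi> \<psi> \<and> sq_integrable (lebesgue_on {0<..<1}) \<psi>)}"

text \<open>The choice is immaterial: weak derivatives are unique up to null sets.\<close>

definition weak_derivative :: "(real \<Rightarrow> real) \<Rightarrow> real \<Rightarrow> real" where
  "weak_derivative \<phi> = (SOME \<psi>. is_weak_derivative \<phi> \<psi>)"

definition H1_norm :: "(real \<Rightarrow> real) \<Rightarrow> real" where
  "H1_norm \<phi> = sqrt ((LINT u|lebesgue_on {0<..<1}. (\<phi> u)\<^sup>2)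
                    + (LINT u|lebesgue_on {0<..<1}. (weak_derivative \<phi> u)\<^sup>2))"

text \<open>
  On representatives \<open>H1_norm\<close> is only a seminorm; its open sets are unions of classes, so they
  are exactly the open sets of the normed space of classes.
\<close>

definition H1_open :: "(real \<Rightarrow> real) set \<Rightarrow> bool" where
  "H1_open U \<longleftrightarrow> U \<subseteq> H1 \<and>
     (\<forall>\<phi>\<in>U. \<exists>e>0. \<forall>\<psi>\<in>H1. H1_norm (\<lambda>u. \<psi> u - \<phi> u) < e \<longrightarrow> \<psi> \<in> U)"

definition H1_borel :: "(real \<Rightarrow> real) measure" where
  "H1_borel = sigma H1 {U. H1_open U}"

text \<open>
  The values \<open>\<phi>(0\<^sup>+)\<close> and \<open>\<phi>(1\<^sup>-)\<close> of \<open>\<phi> \<in> \<H>\<^sup>1\<close> are the limits of its continuous representative.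
\<close>

definition H1_at_0 :: "(real \<Rightarrow> real) \<Rightarrow> real" where
  "H1_at_0 \<phi> = (THE l. \<exists>f. continuous_on {0<..<1} f \<and>
     (AE u in lebesgue_on {0<..<1}. f u = \<phi> u) \<and> (f \<longlongrightarrow> l) (at_right 0))"

definition H1_at_1 :: "(real \<Rightarrow> real) \<Rightarrow> real" where
  "H1_at_1 \<phi> = (THE l. \<exists>f. continuous_on {0<..<1} f \<and>
     (AE u in lebesgue_on {0<..<1}. f u = \<phi> u) \<and> (f \<longlongrightarrow> l) (at_left 1))"

definition L2_H1 :: "real \<Rightarrow> (real \<Rightarrow> real \<Rightarrow> real) set" where
  "L2_H1 T = {\<zeta>. \<zeta> \<in> measurable (lebesgue_on {0..T}) H1_borel \<and>
                 integrable (lebesgue_on {0..T}) (\<lambda>t. (H1_norm (\<zeta> t))\<^sup>2)}"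

text \<open>
  Membership of a function on \<open>[0,T] \<times> [0,1]\<close> in \<open>L\<^sup>2(0,T;\<H>\<^sup>1)\<close>.  Its sections need to lie in \<open>\<H>\<^sup>1\<close>
  only for almost every time, since it is identified with an element of \<open>L\<^sup>2(0,T;\<H>\<^sup>1)\<close> up to null sets.
\<close>

definition in_L2_H1 :: "real \<Rightarrow> (real \<Rightarrow> real \<Rightarrow> real) \<Rightarrow> bool" where
  "in_L2_H1 T F \<longleftrightarrow> (\<exists>\<zeta>\<in>L2_H1 T. AE s in lebesgue_on {0..T}.
     AE u in lebesgue_on {0<..<1}. F s u = \<zeta> s u)"


subsection \<open>The energy functional\<close>

definition space_deriv :: "(real \<Rightarrow> real \<Rightarrow> real) \<Rightarrow> real \<Rightarrow> real \<Rightarrow> real" where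
  "space_deriv H s u = vector_derivative (H s) (at u within {0..1})"

definition C01 :: "real \<Rightarrow> (real \<Rightarrow> real \<Rightarrow> real) set" where
  "C01 T = {H. continuous_on (cylinder T) (\<lambda>(s, u). H s u) \<and>
               (\<forall>s\<in>{0..T}. H s differentiable_on {0..1}) \<and>
               continuous_on (cylinder T) (\<lambda>(s, u). space_deriv H s u)}"

definition P :: "real \<Rightarrow> nat \<Rightarrow> real \<Rightarrow> real" where
  "P \<gamma> m r = (\<Sum>i<m. \<gamma> ^ (m - 1 - i) * r ^ i)"

definition \<B> :: "real \<Rightarrow> (real \<Rightarrow> real \<Rightarrow> real) set" where
  "\<B> T = {\<xi>. (\<lambda>(s, u). \<xi> s u) \<in> borel_measurable (lebesgue_on (cylinder T)) \<and>
             (\<forall>s\<in>{0..T}. \<forall>u\<in>{0..1}. \<xi> s u \<ge> 0) \<and>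
             (\<forall>u\<in>{0, 1}. (\<lambda>s. \<xi> s u) \<in> borel_measurable (lebesgue_on {0..T}) \<and>
                         bounded ((\<lambda>s. \<xi> s u) ` {0..T}))}"

definition inner_L2 :: "real \<Rightarrow> (real \<Rightarrow> real \<Rightarrow> real) \<Rightarrow> (real \<Rightarrow> real \<Rightarrow> real) \<Rightarrow> real" where
  "inner_L2 T G H = (LINT s|lebesgue_on {0..T}. LINT u|lebesgue_on {0..1}. G s u * H s u)"

definition boundary_density ::
  "real \<Rightarrow> real \<Rightarrow> nat \<Rightarrow> real \<Rightarrow> (real \<Rightarrow> real \<Rightarrow> real) \<Rightarrow>
   (real \<Rightarrow> real \<Rightarrow> real) \<Rightarrow> (real \<Rightarrow> real \<Rightarrow> real) \<Rightarrow> real \<Rightarrow> real" where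
  "boundary_density \<alpha> \<beta> m \<kappa> \<xi> G H s =
     P \<alpha> m (\<xi> s 0) / \<kappa> * G s 0 * H s 0 + P \<beta> m (\<xi> s 1) / \<kappa> * G s 1 * H s 1"

definition inner_L2_bd ::
  "real \<Rightarrow> real \<Rightarrow> nat \<Rightarrow> real \<Rightarrow> real \<Rightarrow> (real \<Rightarrow> real \<Rightarrow> real) \<Rightarrow>
   (real \<Rightarrow> real \<Rightarrow> real) \<Rightarrow> (real \<Rightarrow> real \<Rightarrow> real) \<Rightarrow> real" where
  "inner_L2_bd \<alpha> \<beta> m \<kappa> T \<xi> G H =
     inner_L2 T G H + (LINT s|lebesgue_on {0..T}. boundary_density \<alpha> \<beta> m \<kappa> \<xi> G H s)"

text \<open>
  Measurability is with respect to Lebesgue measure plus the weighted masses on the lines \<open>u = 0\<close>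
  and \<open>u = 1\<close>: these lines are null for planar Lebesgue measure, so measurability of the traces is
  a separate condition.
\<close>

definition L2_bd ::
  "real \<Rightarrow> real \<Rightarrow> nat \<Rightarrow> real \<Rightarrow> real \<Rightarrow> (real \<Rightarrow> real \<Rightarrow> real) \<Rightarrow> (real \<Rightarrow> real \<Rightarrow> real) set" where
  "L2_bd \<alpha> \<beta> m \<kappa> T \<xi> = {H.
     sq_integrable (lebesgue_on (cylinder T)) (\<lambda>(s, u). H s u) \<and>
     (\<lambda>s. H s 0) \<in> borel_measurable (lebesgue_on {0..T}) \<and>
     (\<lambda>s. H s 1) \<in> borel_measurable (lebesgue_on {0..T}) \<and>
     integrable (lebesgue_on {0..T}) (boundary_density \<alpha> \<beta> m \<kappa> \<xi> H H)}"

definition \<T> ::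
  "real \<Rightarrow> real \<Rightarrow> nat \<Rightarrow> real \<Rightarrow> (real \<Rightarrow> real \<Rightarrow> real) \<Rightarrow> (real \<Rightarrow> real \<Rightarrow> real) \<Rightarrow> real" where
  "\<T> \<alpha> \<beta> m T \<xi> H = inner_L2 T (\<lambda>s u. \<xi> s u ^ m) (space_deriv H)
     + (LINT s|lebesgue_on {0..T}. \<alpha> ^ m * H s 0 - \<beta> ^ m * H s 1)"

definition \<E> ::
  "real \<Rightarrow> real \<Rightarrow> nat \<Rightarrow> real \<Rightarrow> real \<Rightarrow> real \<Rightarrow> (real \<Rightarrow> real \<Rightarrow> real) \<Rightarrow> ereal" where
  "\<E> \<alpha> \<beta> m \<kappa> c T \<xi> =
     (SUP H\<in>C01 T. ereal (\<T> \<alpha> \<beta> m T \<xi> H - c * inner_L2_bd \<alpha> \<beta> m \<kappa> T \<xi> H H))"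

end

theory Submission
  imports Defs
begin

text \<open>
  Write \<open>J(H) = \<T>(H) - c \<langle>\<langle>H,H\<rangle>\<rangle>\<close>, with the weighted product that includes the two boundary terms.  This
  is a concave quadratic functional, bounded above on the linear space \<open>C01 T\<close>.  By the parallelogram
  identity a maximizing sequence is Cauchy for the weighted norm, hence converges to some \<open>G\<close>, whose
  values on the two boundary lines are the limits of the boundary values of the sequence.  The first
  variation of \<open>J\<close> along the sequence gives \<open>\<T>(H) = 2c \<langle>\<langle>G,H\<rangle>\<rangle>\<close> for every \<open>H\<close>, and the limit of \<open>J\<close>
  along it gives \<open>sup J = c \<langle>\<langle>G,G\<rangle>\<rangle>\<close>.  With \<open>D = -2c G\<close> this reads \<open>\<T>(H) = -\<langle>\<langle>D,H\<rangle>\<rangle>\<close> and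
  \<open>sup J = \<langle>\<langle>D,D\<rangle>\<rangle> / (4c)\<close> (lemma \<open>energy_maximizer\<close>).

  The rest is read off from the representation.  Put \<open>a(s) = \<alpha>\<^sup>m + P(\<xi>\<^sub>s(0)) D\<^sub>s(0) / \<kappa>\<close> and
  \<open>b(s) = \<beta>\<^sup>m - P(\<xi>\<^sub>s(1)) D\<^sub>s(1) / \<kappa>\<close>; then for all \<open>H\<close> the sum of the integrals of \<open>\<xi>\<^sup>m \<partial>\<^sub>uH\<close>, \<open>D H\<close> and
  \<open>a H(0) - b H(1)\<close> vanishes.  Functions \<open>H\<close> of time alone show that \<open>a(s)\<close> plus the integral of \<open>D\<^sub>s\<close>
  over the unit interval is \<open>b(s)\<close>.  Functions \<open>H\<close> with an arbitrary continuous derivative \<open>\<partial>\<^sub>uH = K\<close>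
  show, after an integration by parts, that \<open>\<xi>\<^sub>s(u)\<^sup>m\<close> is \<open>a(s)\<close> plus the integral of \<open>D\<^sub>s\<close> from \<open>0\<close> to
  \<open>u\<close>, for almost every \<open>(s,u)\<close> (lemma \<open>weak_equation_imp_primitive\<close>).  Therefore \<open>D\<^sub>s\<close> is the weak
  derivative of \<open>\<xi>\<^sub>s\<^sup>m\<close>, and the boundary values of \<open>\<xi>\<^sub>s\<^sup>m\<close> are \<open>a(s)\<close> and \<open>b(s)\<close>, which is the pair of
  boundary identities.

  Membership in \<open>L\<^sup>2(0,T;\<H>\<^sup>1)\<close> asks for measurability into a space whose norm is defined through a chosen
  weak derivative.  Uniqueness of weak derivatives (lemma \<open>weak_derivative_unique\<close>) makes this norm
  computable.  Moreover almost every section \<open>D\<^sub>s\<close> lies in the closure of a countable family, made of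
  sections of the maximizing sequence, so that the preimage of an open set is, up to a null set of
  times, a countable union of sublevel sets of measurable functions (lemma \<open>in_L2_H1_primitive\<close>).
\<close>

section \<open>Square integrable functions\<close>

lemma square_add_le: "(x + y)\<^sup>2 \<le> 2 * x\<^sup>2 + 2 * (y\<^sup>2 :: real)"
  using sum_squares_bound[of x y] by (simp add: power2_sum)

lemma sq_integrable_mult:
  assumes "sq_integrable M f" "sq_integrable M g"
  shows "integrable M (\<lambda>x. f x * g x)"
proof (rule Bochner_Integration.integrable_bound)
  show "integrable M (\<lambda>x. (f x)\<^sup>2 + (g x)\<^sup>2)"
    using assms by (auto simp: sq_integrable_def)
  show "(\<lambda>x. f x * g x) \<in> borel_measurable M"
    using assms by (auto simp: sq_integrable_def)
  have "\<bar>a * b\<bar> \<le> a\<^sup>2 + b\<^sup>2" for a b :: real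
  proof -
    have "2 * \<bar>a * b\<bar> \<le> a\<^sup>2 + b\<^sup>2"
      using sum_squares_bound[of "\<bar>a\<bar>" "\<bar>b\<bar>"] by (simp add: abs_mult)
    then show ?thesis using abs_ge_zero[of "a * b"] by linarith
  qed
  then show "AE x in M. norm (f x * g x) \<le> norm ((f x)\<^sup>2 + (g x)\<^sup>2)"
    by (intro AE_I2) auto
qed

lemma sq_integrable_bounded_mult:
  assumes "w \<in> borel_measurable M" "AE x in M. \<bar>w x\<bar> \<le> W" "sq_integrable M f"
  shows "sq_integrable M (\<lambda>x. w x * f x)"
  unfolding sq_integrable_def
proof
  show *: "(\<lambda>x. w x * f x) \<in> borel_measurable M"
    using assms by (auto simp: sq_integrable_def)
  show "integrable M (\<lambda>x. (w x * f x)\<^sup>2)"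
  proof (rule Bochner_Integration.integrable_bound)
    show "integrable M (\<lambda>x. W\<^sup>2 * (f x)\<^sup>2)"
      using assms by (auto simp: sq_integrable_def)
    show "(\<lambda>x. (w x * f x)\<^sup>2) \<in> borel_measurable M"
      using * by measurable
    show "AE x in M. norm ((w x * f x)\<^sup>2) \<le> norm (W\<^sup>2 * (f x)\<^sup>2)"
      using assms(2)
    proof eventually_elim
      case (elim x)
      then have "(w x)\<^sup>2 \<le> W\<^sup>2" by (metis abs_ge_zero abs_le_square_iff abs_of_nonneg order_trans)
      then show ?case by (simp add: power_mult_distrib mult_right_mono)
    qed
  qed
qed

lemma sq_integrable_cmult: "sq_integrable M f \<Longrightarrow> sq_integrable M (\<lambda>x. c * f x)"
  by (rule sq_integrable_bounded_mult[where W="\<bar>c\<bar>"]) auto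

lemma sq_integrable_add:
  assumes "sq_integrable M f" "sq_integrable M g"
  shows "sq_integrable M (\<lambda>x. f x + g x)"
proof -
  have "integrable M (\<lambda>x. (f x)\<^sup>2 + (g x)\<^sup>2 + 2 * (f x * g x))"
    using assms sq_integrable_mult[OF assms] by (auto simp: sq_integrable_def)
  then show ?thesis
    using assms by (auto simp: sq_integrable_def power2_sum algebra_simps)
qed

lemma sq_integrable_diff:
  assumes "sq_integrable M f" "sq_integrable M g"
  shows "sq_integrable M (\<lambda>x. f x - g x)"
  using sq_integrable_add[OF assms(1) sq_integrable_cmult[OF assms(2), of "-1"]] by simp

lemma sq_integrable_bounded:
  assumes "finite_measure M" "f \<in> borel_measurable M" "AE x in M. \<bar>f x\<bar> \<le> B"
  shows "sq_integrable M f"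
  using sq_integrable_bounded_mult[OF assms(2,3), of "\<lambda>_. 1"] assms(1)
  by (simp add: sq_integrable_def finite_measure.integrable_const)

lemma sq_integrable_cong_AE:
  assumes "sq_integrable M f" "g \<in> borel_measurable M" "AE x in M. f x = g x"
  shows "sq_integrable M g"
proof -
  have "integrable M (\<lambda>x. (g x)\<^sup>2)"
    by (rule integrable_cong_AE_imp[of M "\<lambda>x. (f x)\<^sup>2"]) (use assms in \<open>auto simp: sq_integrable_def\<close>)
  then show ?thesis using assms by (simp add: sq_integrable_def)
qed

lemma sq_integrable_imp_integrable:
  "finite_measure M \<Longrightarrow> sq_integrable M f \<Longrightarrow> integrable M f"
  by (simp add: finite_measure.square_integrable_imp_integrable sq_integrable_def)

lemma Cauchy_Schwarz_integral:
  assumes f: "sq_integrable M f" and g: "sq_integrable M g"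
  shows "(LINT x|M. f x * g x)\<^sup>2 \<le> (LINT x|M. (f x)\<^sup>2) * (LINT x|M. (g x)\<^sup>2)"
proof -
  define A B C where "A = (LINT x|M. (f x)\<^sup>2)" "B = (LINT x|M. (g x)\<^sup>2)" "C = (LINT x|M. f x * g x)"
  note ABC = this
  have fi: "integrable M (\<lambda>x. (f x)\<^sup>2)" "integrable M (\<lambda>x. (g x)\<^sup>2)" "integrable M (\<lambda>x. f x * g x)"
    using f g sq_integrable_mult[OF f g] by (auto simp: sq_integrable_def)
  have "0 \<le> A" unfolding ABC by (rule Bochner_Integration.integral_nonneg) auto
  show ?thesis
  proof (cases "A = 0")
    case True
    then have "AE x in M. (f x)\<^sup>2 = 0"
      using integral_nonneg_eq_0_iff_AE[OF fi(1)] ABC by auto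
    then have "AE x in M. f x * g x = 0" by eventually_elim auto
    then have "C = 0" unfolding ABC by (metis integral_eq_zero_AE)
    then show ?thesis using True ABC by simp
  next
    case False
    \<comment> \<open>The discriminant argument at its optimal parameter \<open>C / A\<close>, cleared of denominators.\<close>
    have "0 \<le> (LINT x|M. (A * g x - C * f x)\<^sup>2)"
      by (rule Bochner_Integration.integral_nonneg) auto
    also have "\<dots> = (LINT x|M. A\<^sup>2 * (g x)\<^sup>2 - 2 * A * C * (f x * g x) + C\<^sup>2 * (f x)\<^sup>2)"
      by (intro Bochner_Integration.integral_cong refl) (auto simp: power2_eq_square algebra_simps)
    also have "\<dots> = A\<^sup>2 * B - 2 * A * C * C + C\<^sup>2 * A"
      using fi by (simp add: ABC)
    also have "\<dots> = A * (A * B - C\<^sup>2)" by (simp add: power2_eq_square algebra_simps)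
    finally have "0 \<le> A * B - C\<^sup>2" using False \<open>0 \<le> A\<close> by (simp add: zero_le_mult_iff)
    then show ?thesis using ABC by simp
  qed
qed

text \<open>
  The squared distance is used throughout in place of the distance itself; the factor \<open>2\<close> is the price
  for the triangle inequality.
\<close>

lemma L2_dist_le:
  assumes f: "sq_integrable M f" and g: "sq_integrable M g" and h: "sq_integrable M h"
  shows "(LINT x|M. (f x - h x)\<^sup>2) \<le> 2 * (LINT x|M. (f x - g x)\<^sup>2) + 2 * (LINT x|M. (g x - h x)\<^sup>2)"
proof -
  have i: "integrable M (\<lambda>x. (f x - h x)\<^sup>2)" "integrable M (\<lambda>x. (f x - g x)\<^sup>2)" "integrable M (\<lambda>x. (g x - h x)\<^sup>2)"
    using sq_integrable_diff assms by (auto simp: sq_integrable_def)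
  have "(LINT x|M. (f x - h x)\<^sup>2) \<le> (LINT x|M. 2 * (f x - g x)\<^sup>2 + 2 * (g x - h x)\<^sup>2)"
  proof (rule integral_mono)
    fix x
    from square_add_le[of "f x - g x" "g x - h x"]
    show "(f x - h x)\<^sup>2 \<le> 2 * (f x - g x)\<^sup>2 + 2 * (g x - h x)\<^sup>2" by simp
  qed (use i in auto)
  also have "\<dots> = 2 * (LINT x|M. (f x - g x)\<^sup>2) + 2 * (LINT x|M. (g x - h x)\<^sup>2)"
    using i by simp
  finally show ?thesis .
qed

lemma L1_square_le_L2:
  assumes "finite_measure M" "sq_integrable M f"
  shows "(LINT x|M. \<bar>f x\<bar>)\<^sup>2 \<le> measure M (space M) * (LINT x|M. (f x)\<^sup>2)"
proof -
  have "sq_integrable M (\<lambda>x. \<bar>f x\<bar>)" "sq_integrable M (\<lambda>_. 1)"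
    using assms by (auto simp: sq_integrable_def finite_measure.integrable_const)
  from Cauchy_Schwarz_integral[OF this] show ?thesis
    by (simp add: mult.commute)
qed

text \<open>
  On a finite measure space a Cauchy sequence in \<open>L\<^sup>2\<close> is Cauchy in \<open>L\<^sup>1\<close>, so a subsequence converges almost
  everywhere; Fatou's lemma upgrades this to convergence in \<open>L\<^sup>2\<close>.
\<close>

lemma L2_complete:
  assumes fin: "finite_measure M" and f: "\<And>n. sq_integrable M (f n)"
    and cau: "\<And>e. e > 0 \<Longrightarrow> \<exists>N::nat. \<forall>i\<ge>N. \<forall>j\<ge>N. (LINT x|M. (f i x - f j x)\<^sup>2) < e"
  shows "\<exists>g. sq_integrable M g \<and> (\<lambda>n. LINT x|M. (f n x - g x)\<^sup>2) \<longlonglongrightarrow> 0"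
proof -
  interpret finite_measure M by fact
  define K where "K = measure M (space M) + 1"
  have K: "K > 0" unfolding K_def by (simp add: add_nonneg_pos)
  have dsq: "sq_integrable M (\<lambda>x. f i x - f j x)" for i j
    using f sq_integrable_diff by blast
  have [measurable]: "f n \<in> borel_measurable M" for n using f by (auto simp: sq_integrable_def)
  obtain r where r: "strict_mono r" and ae: "AE x in M. Cauchy (\<lambda>i. f (r i) x)"
  proof (rule cauchy_L1_AE_cauchy_subseq[of M f])
    show "integrable M (f n)" for n
      using f sq_integrable_imp_integrable fin by blast
    fix e :: real assume e: "e > 0"
    then obtain N where N: "\<forall>i\<ge>N. \<forall>j\<ge>N. (LINT x|M. (f i x - f j x)\<^sup>2) < e\<^sup>2 / K"
      using cau[of "e\<^sup>2 / K"] K by auto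
    have "(LINT x|M. norm (f i x - f j x)) < e" if "i \<ge> N" "j \<ge> N" for i j
    proof -
      have "(LINT x|M. \<bar>f i x - f j x\<bar>)\<^sup>2 \<le> measure M (space M) * (LINT x|M. (f i x - f j x)\<^sup>2)"
        using L1_square_le_L2[OF fin dsq] .
      also have "\<dots> \<le> K * (LINT x|M. (f i x - f j x)\<^sup>2)"
        unfolding K_def by (intro mult_right_mono) auto
      also have "\<dots> < e\<^sup>2" using N that K by (simp add: field_simps)
      finally show ?thesis
        using e by (simp add: power2_less_imp_less)
    qed
    then show "\<exists>N. \<forall>i\<ge>N. \<forall>j\<ge>N. LINT x|M. norm (f i x - f j x) < e" by blast
  qed auto
  define g where "g x = lim (\<lambda>i. f (r i) x)" for x
  have [measurable]: "g \<in> borel_measurable M" unfolding g_def by measurable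
  have conv: "AE x in M. (\<lambda>i. f (r i) x) \<longlonglongrightarrow> g x"
    using ae by eventually_elim (metis g_def Cauchy_convergent convergent_LIMSEQ_iff)
  \<comment> \<open>Fatou's lemma along the subsequence bounds the distance of a late term to the limit.\<close>
  have fatou: "(\<integral>\<^sup>+x. ennreal ((f k x - g x)\<^sup>2) \<partial>M) \<le> ennreal e"
    if N: "\<forall>i\<ge>N. \<forall>j\<ge>N. (LINT x|M. (f i x - f j x)\<^sup>2) < e" and k: "k \<ge> N" for k N e
  proof -
    have "(\<integral>\<^sup>+x. ennreal ((f k x - g x)\<^sup>2) \<partial>M)
        = (\<integral>\<^sup>+x. liminf (\<lambda>i. ennreal ((f k x - f (r i) x)\<^sup>2)) \<partial>M)"
    proof (rule nn_integral_cong_AE)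
      show "AE x in M. ennreal ((f k x - g x)\<^sup>2) = liminf (\<lambda>i. ennreal ((f k x - f (r i) x)\<^sup>2))"
        using conv
      proof eventually_elim
        case (elim x)
        then have "(\<lambda>i. ennreal ((f k x - f (r i) x)\<^sup>2)) \<longlonglongrightarrow> ennreal ((f k x - g x)\<^sup>2)"
          by (intro tendsto_intros) auto
        then show ?case by (intro lim_imp_Liminf[symmetric]) simp_all
      qed
    qed
    also have "\<dots> \<le> liminf (\<lambda>i. \<integral>\<^sup>+x. ennreal ((f k x - f (r i) x)\<^sup>2) \<partial>M)"
      by (intro nn_integral_liminf) measurable
    also have "\<dots> \<le> ennreal e"
    proof (rule Liminf_le)
      show "\<forall>\<^sub>F i in sequentially. (\<integral>\<^sup>+x. ennreal ((f k x - f (r i) x)\<^sup>2) \<partial>M) \<le> ennreal e"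
        unfolding eventually_sequentially
      proof (intro exI[of _ N] allI impI)
        fix i assume "N \<le> i"
        then have "r i \<ge> N" using seq_suble[OF r, of i] by simp
        have "(\<integral>\<^sup>+x. ennreal ((f k x - f (r i) x)\<^sup>2) \<partial>M) = ennreal (LINT x|M. (f k x - f (r i) x)\<^sup>2)"
          using dsq[of k "r i"] by (intro nn_integral_eq_integral) (auto simp: sq_integrable_def)
        also have "\<dots> \<le> ennreal e"
          using N k \<open>r i \<ge> N\<close> by (intro ennreal_leI less_imp_le) auto
        finally show "(\<integral>\<^sup>+x. ennreal ((f k x - f (r i) x)\<^sup>2) \<partial>M) \<le> ennreal e" .
      qed
    qed simp
    finally show ?thesis .
  qed
  have dg: "sq_integrable M (\<lambda>x. f k x - g x)"
    if "\<forall>i\<ge>N. \<forall>j\<ge>N. (LINT x|M. (f i x - f j x)\<^sup>2) < e" "k \<ge> N" for k N e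
    unfolding sq_integrable_def
  proof
    show "integrable M (\<lambda>x. (f k x - g x)\<^sup>2)"
      by (rule integrableI_nonneg) (use fatou[OF that] in \<open>auto intro: le_less_trans\<close>)
  qed measurable
  obtain N where "\<forall>i\<ge>N. \<forall>j\<ge>N. (LINT x|M. (f i x - f j x)\<^sup>2) < 1" using cau[of 1] by auto
  from dg[OF this order_refl] have g: "sq_integrable M g"
    using sq_integrable_diff[OF f[of N], of "\<lambda>x. f N x - g x"] by simp
  have "(\<lambda>n. LINT x|M. (f n x - g x)\<^sup>2) \<longlonglongrightarrow> 0"
  proof (rule LIMSEQ_I)
    fix e :: real assume e: "e > 0"
    then obtain N where N: "\<forall>i\<ge>N. \<forall>j\<ge>N. (LINT x|M. (f i x - f j x)\<^sup>2) < e / 2" using cau[of "e/2"] by auto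
    have "norm ((LINT x|M. (f n x - g x)\<^sup>2) - 0) < e" if "n \<ge> N" for n
    proof -
      have "ennreal (LINT x|M. (f n x - g x)\<^sup>2) = (\<integral>\<^sup>+x. ennreal ((f n x - g x)\<^sup>2) \<partial>M)"
        using dg[OF N that] by (intro nn_integral_eq_integral[symmetric]) (auto simp: sq_integrable_def)
      also have "\<dots> \<le> ennreal (e / 2)" using fatou[OF N that] .
      finally have "(LINT x|M. (f n x - g x)\<^sup>2) \<le> e / 2" using e by (simp add: ennreal_le_iff)
      moreover have "0 \<le> (LINT x|M. (f n x - g x)\<^sup>2)" by (rule Bochner_Integration.integral_nonneg) auto
      ultimately show ?thesis using e by simp
    qed
    then show "\<exists>no. \<forall>n\<ge>no. norm ((LINT x|M. (f n x - g x)\<^sup>2) - 0) < e" by blast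
  qed
  with g show ?thesis by blast
qed

lemma L2_tendsto_inner:
  assumes f: "\<And>n. sq_integrable M (f n)" and f': "sq_integrable M f'"
    and lim: "(\<lambda>n. LINT x|M. (f n x - f' x)\<^sup>2) \<longlonglongrightarrow> 0"
    and g: "sq_integrable M g"
  shows "(\<lambda>n. LINT x|M. f n x * g x) \<longlonglongrightarrow> (LINT x|M. f' x * g x)"
proof -
  have "(\<lambda>n. LINT x|M. (f n x - f' x) * g x) \<longlonglongrightarrow> 0"
  proof (rule Lim_null_comparison)
    show "\<forall>\<^sub>F n in sequentially. norm (LINT x|M. (f n x - f' x) * g x)
        \<le> sqrt ((LINT x|M. (f n x - f' x)\<^sup>2) * (LINT x|M. (g x)\<^sup>2))"
      by (intro always_eventually allI real_le_rsqrt)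
        (simp add: Cauchy_Schwarz_integral sq_integrable_diff f f' g)
    have "(\<lambda>n. sqrt ((LINT x|M. (f n x - f' x)\<^sup>2) * (LINT x|M. (g x)\<^sup>2))) \<longlonglongrightarrow> sqrt (0 * (LINT x|M. (g x)\<^sup>2))"
      by (intro tendsto_intros lim)
    then show "(\<lambda>n. sqrt ((LINT x|M. (f n x - f' x)\<^sup>2) * (LINT x|M. (g x)\<^sup>2))) \<longlonglongrightarrow> 0" by simp
  qed
  moreover have "(LINT x|M. (f n x - f' x) * g x) = (LINT x|M. f n x * g x) - (LINT x|M. f' x * g x)" for n
    using sq_integrable_mult[OF f g] sq_integrable_mult[OF f' g] by (simp add: left_diff_distrib)
  ultimately show ?thesis by (simp add: LIM_zero_iff)
qed

text \<open>
  The weight is absorbed in the fixed factor.  For the quadratic expression this is applied after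
  expanding \<open>f\<^sub>n\<^sup>2 = (f\<^sub>n - f)\<^sup>2 + 2 f\<^sub>n f - f\<^sup>2\<close>.
\<close>

lemma L2_tendsto_weighted:
  assumes f: "\<And>n. sq_integrable M (f n)" and f': "sq_integrable M f'"
    and lim: "(\<lambda>n. LINT x|M. (f n x - f' x)\<^sup>2) \<longlonglongrightarrow> 0"
    and w: "w \<in> borel_measurable M" "AE x in M. \<bar>w x\<bar> \<le> W"
  shows "sq_integrable M g \<Longrightarrow> (\<lambda>n. LINT x|M. w x * f n x * g x) \<longlonglongrightarrow> (LINT x|M. w x * f' x * g x)"
    and "(\<lambda>n. LINT x|M. w x * f n x * f n x) \<longlonglongrightarrow> (LINT x|M. w x * f' x * f' x)"
proof -
  have A: "(\<lambda>n. LINT x|M. w x * f n x * g x) \<longlonglongrightarrow> (LINT x|M. w x * f' x * g x)" if "sq_integrable M g" for g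
    using L2_tendsto_inner[OF f f' lim sq_integrable_bounded_mult[OF w that]]
    by (simp add: mult_ac)
  then show "sq_integrable M g \<Longrightarrow> (\<lambda>n. LINT x|M. w x * f n x * g x) \<longlonglongrightarrow> (LINT x|M. w x * f' x * g x)" .
  have d: "sq_integrable M (\<lambda>x. f n x - f' x)" for n using f f' sq_integrable_diff by blast
  note wm = sq_integrable_bounded_mult[OF w]
  have iw: "integrable M (\<lambda>x. w x * h x * k x)" if "sq_integrable M h" "sq_integrable M k" for h k
    using sq_integrable_mult[OF wm[OF that(1)] that(2)] .
  have B: "(\<lambda>n. LINT x|M. w x * (f n x - f' x) * (f n x - f' x)) \<longlonglongrightarrow> 0"
  proof (rule Lim_null_comparison)
    have "norm (LINT x|M. w x * (f n x - f' x) * (f n x - f' x)) \<le> \<bar>W\<bar> * (LINT x|M. (f n x - f' x)\<^sup>2)" for n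
    proof -
      have "norm (LINT x|M. w x * (f n x - f' x) * (f n x - f' x)) \<le> (LINT x|M. \<bar>W\<bar> * (f n x - f' x)\<^sup>2)"
      proof (rule order_trans[OF integral_norm_bound integral_mono_AE])
        show "integrable M (\<lambda>x. \<bar>W\<bar> * (f n x - f' x)\<^sup>2)" using d by (auto simp: sq_integrable_def)
        show "AE x in M. norm (w x * (f n x - f' x) * (f n x - f' x)) \<le> \<bar>W\<bar> * (f n x - f' x)\<^sup>2"
          using w(2)
        proof eventually_elim
          case (elim x)
          then have "\<bar>w x\<bar> * (f n x - f' x)\<^sup>2 \<le> \<bar>W\<bar> * (f n x - f' x)\<^sup>2"
            by (intro mult_right_mono) auto
          then show ?case by (simp add: abs_mult power2_eq_square mult.assoc)
        qed
      qed (use iw[OF d d] in auto)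
      then show ?thesis by simp
    qed
    then show "\<forall>\<^sub>F n in sequentially. norm (LINT x|M. w x * (f n x - f' x) * (f n x - f' x)) \<le> \<bar>W\<bar> * (LINT x|M. (f n x - f' x)\<^sup>2)"
      by (intro always_eventually allI)
    show "(\<lambda>n. \<bar>W\<bar> * (LINT x|M. (f n x - f' x)\<^sup>2)) \<longlonglongrightarrow> 0"
      using tendsto_mult_right_zero[OF lim] by simp
  qed
  have "(LINT x|M. w x * f n x * f n x) = (LINT x|M. w x * (f n x - f' x) * (f n x - f' x))
      + 2 * (LINT x|M. w x * f n x * f' x) - (LINT x|M. w x * f' x * f' x)" for n
  proof -
    have "(LINT x|M. w x * f n x * f n x) = (LINT x|M. w x * (f n x - f' x) * (f n x - f' x)
      + 2 * (w x * f n x * f' x) - w x * f' x * f' x)"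
      by (intro Bochner_Integration.integral_cong refl) (simp add: algebra_simps)
    also have "\<dots> = (LINT x|M. w x * (f n x - f' x) * (f n x - f' x))
      + 2 * (LINT x|M. w x * f n x * f' x) - (LINT x|M. w x * f' x * f' x)"
      using iw d f f' by simp
    finally show ?thesis .
  qed
  moreover have "(\<lambda>n. (LINT x|M. w x * (f n x - f' x) * (f n x - f' x))
      + 2 * (LINT x|M. w x * f n x * f' x) - (LINT x|M. w x * f' x * f' x))
    \<longlonglongrightarrow> 0 + 2 * (LINT x|M. w x * f' x * f' x) - (LINT x|M. w x * f' x * f' x)"
    by (intro tendsto_intros A B f')
  ultimately show "(\<lambda>n. LINT x|M. w x * f n x * f n x) \<longlonglongrightarrow> (LINT x|M. w x * f' x * f' x)" by simp
qed

section \<open>Lebesgue measure on subsets\<close>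

lemma sets_ivl: "{a..b::real} \<in> sets borel"
  by (rule borel_closed[OF closed_atLeastAtMost])

lemma finite_measure_ivl: "finite_measure (lebesgue_on {a..b::real})"
  by (rule finite_measure_lebesgue_on) auto

lemma borel_imp_lebesgue_on:
  "f \<in> borel_measurable borel \<Longrightarrow> f \<in> borel_measurable (lebesgue_on S)"
  by (simp add: measurable_completion measurable_restrict_space1)

text \<open>
  Product measurability and Fubini's theorem concern Borel functions, while the functions of interest
  are Lebesgue measurable.  This lemma is the bridge.
\<close>

lemma borel_representative:
  fixes f :: "'a::euclidean_space \<Rightarrow> real"
  assumes "f \<in> borel_measurable (lebesgue_on S)" "S \<in> sets borel"
  obtains g where "g \<in> borel_measurable borel" "\<And>x. x \<notin> S \<Longrightarrow> g x = 0"
    "AE x in lebesgue_on S. f x = g x"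
proof -
  have S: "S \<in> sets lebesgue" using assms(2) by simp
  have "(\<lambda>x. if x \<in> S then f x else 0) \<in> borel_measurable lebesgue"
    using assms S by (simp add: borel_measurable_if)
  then obtain g where g: "g \<in> borel_measurable lborel"
    and ae: "AE x in lborel. (if x \<in> S then f x else 0) = g x"
    using completion_ex_borel_measurable_real by blast
  show ?thesis
  proof
    show "(\<lambda>x. if x \<in> S then g x else 0) \<in> borel_measurable borel"
      using g assms(2) by (intro measurable_If_set) auto
    show "AE x in lebesgue_on S. f x = (if x \<in> S then g x else 0)"
      proof (subst AE_restrict_space_iff)
      show "AE x in lebesgue. x \<in> S \<longrightarrow> f x = (if x \<in> S then g x else 0)"
        using AE_completion[OF ae] by eventually_elim auto
    qed (use S in simp)
  qed auto
qed

lemma AE_lebesgue_on_iff: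
  "S \<in> sets lebesgue \<Longrightarrow> (AE x in lebesgue_on S. Q x) \<longleftrightarrow> (AE x in lborel. x \<in> S \<longrightarrow> Q x)"
  by (simp add: AE_restrict_space_iff AE_completion_iff)

lemma lebesgue_on_borel:
  fixes f :: "'a::euclidean_space \<Rightarrow> real"
  assumes "f \<in> borel_measurable borel" "S \<in> sets borel" "\<And>x. x \<notin> S \<Longrightarrow> f x = 0"
  shows "integrable (lebesgue_on S) f \<longleftrightarrow> integrable lborel f"
    and "integral\<^sup>L (lebesgue_on S) f = integral\<^sup>L lborel f"
proof -
  have S: "S \<in> sets lebesgue" using assms(2) by simp
  have eq: "(\<lambda>x. if x \<in> S then f x else 0) = f" using assms(3) by auto
  show "integrable (lebesgue_on S) f \<longleftrightarrow> integrable lborel f"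
    using Lebesgue_Measure.integrable_restrict_UNIV[OF S, of f] assms(1) by (simp add: eq integrable_completion)
  show "integral\<^sup>L (lebesgue_on S) f = integral\<^sup>L lborel f"
    using Lebesgue_Measure.integral_restrict_UNIV[OF S, of f] assms(1) by (simp add: eq integral_completion)
qed

text \<open>
  Completeness of Lebesgue measure: modification on a null set preserves measurability.
\<close>

lemma measurable_lebesgue_on_AE:
  fixes f g :: "'a::euclidean_space \<Rightarrow> real"
  assumes f: "f \<in> borel_measurable (lebesgue_on S)" and S: "S \<in> sets lebesgue"
    and ae: "AE x in lebesgue_on S. f x = g x"
  shows "g \<in> borel_measurable (lebesgue_on S)"
proof -
  have "AE x in lborel. x \<in> S \<longrightarrow> f x = g x" using ae S by (simp add: AE_lebesgue_on_iff)
  then have "AE x in lborel. (if x \<in> S then f x else 0) = (if x \<in> S then g x else 0)"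
    by eventually_elim auto
  then have "AE x in lebesgue. (if x \<in> S then f x else 0) = (if x \<in> S then g x else 0)"
    by (rule AE_completion)
  moreover have "(\<lambda>x. if x \<in> S then f x else 0) \<in> borel_measurable lebesgue"
    using f S by (simp add: borel_measurable_if)
  ultimately have "(\<lambda>x. if x \<in> S then g x else 0) \<in> borel_measurable lebesgue"
    by (rule borel_measurable_AE[rotated])
  then show ?thesis using S by (simp add: borel_measurable_if)
qed

lemma integrable_lebesgue_on_AE:
  fixes f g :: "'a::euclidean_space \<Rightarrow> real"
  assumes "integrable (lebesgue_on S) f" "S \<in> sets lebesgue" "AE x in lebesgue_on S. f x = g x"
  shows "integrable (lebesgue_on S) g"
  by (rule integrable_cong_AE_imp[OF assms(1) measurable_lebesgue_on_AE[OF borel_measurable_integrable[OF assms(1)] assms(2,3)] assms(3)])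

lemma integral_lebesgue_on_AE:
  fixes f g :: "'a::euclidean_space \<Rightarrow> real"
  assumes "f \<in> borel_measurable (lebesgue_on S)" "S \<in> sets lebesgue" "AE x in lebesgue_on S. f x = g x"
  shows "integral\<^sup>L (lebesgue_on S) f = integral\<^sup>L (lebesgue_on S) g"
  by (rule integral_cong_AE[OF assms(1) measurable_lebesgue_on_AE[OF assms] assms(3)])

lemma sets_lebesgue_on_AE:
  fixes A B :: "'a::euclidean_space set"
  assumes A: "A \<in> sets (lebesgue_on S)" and S: "S \<in> sets lebesgue" and B: "B \<subseteq> S"
    and ae: "AE x in lebesgue_on S. x \<in> A \<longleftrightarrow> x \<in> B"
  shows "B \<in> sets (lebesgue_on S)"
proof -
  have "AE x in lebesgue_on S. indicat_real A x = indicat_real B x"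
    using ae by eventually_elim (auto simp: indicator_def)
  then have "indicat_real B \<in> borel_measurable (lebesgue_on S)"
    by (rule measurable_lebesgue_on_AE[OF borel_measurable_indicator[OF A] S])
  then have "B \<inter> S \<in> sets (lebesgue_on S)" by (simp add: borel_measurable_indicator_iff)
  then show ?thesis using B by (simp add: Int_absorb2)
qed

lemma integrable_lebesgue_on_subset:
  fixes f :: "'a::euclidean_space \<Rightarrow> real"
  assumes "integrable (lebesgue_on S) f" "A \<subseteq> S" "S \<in> sets lebesgue" "A \<in> sets lebesgue"
  shows "integrable (lebesgue_on A) f"
proof -
  have "integrable lebesgue (\<lambda>x. indicator A x *\<^sub>R (if x \<in> S then f x else 0))"
    using assms by (intro integrable_mult_indicator) (auto simp: Lebesgue_Measure.integrable_restrict_UNIV)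
  also have "(\<lambda>x. indicator A x *\<^sub>R (if x \<in> S then f x else 0)) = (\<lambda>x. if x \<in> A then f x else 0)"
    using assms(2) by (intro ext) (auto simp: indicator_def)
  finally show ?thesis using assms(4) by (simp add: Lebesgue_Measure.integrable_restrict_UNIV)
qed

lemma AE_lebesgue_on_subset:
  assumes "AE x in lebesgue_on S. Q x" "A \<subseteq> S" "S \<in> sets lebesgue" "A \<in> sets lebesgue"
  shows "AE x in lebesgue_on A. Q x"
proof (subst AE_lebesgue_on_iff)
  have "AE x in lborel. x \<in> S \<longrightarrow> Q x" using assms by (simp add: AE_lebesgue_on_iff)
  then show "AE x in lborel. x \<in> A \<longrightarrow> Q x" by eventually_elim (use assms(2) in auto)
qed (use assms in simp)

lemma AE_interior_interval:
  fixes a b :: real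
  shows "AE x in lebesgue_on {a..b}. x \<in> {a<..<b}"
proof (subst AE_lebesgue_on_iff)
  have "AE x in lborel. x \<notin> {a, b}"
    by (rule AE_not_in) (simp add: finite_imp_null_set_lborel)
  then show "AE x in lborel. x \<in> {a..b} \<longrightarrow> x \<in> {a<..<b}"
    by eventually_elim auto
qed simp

lemma AE_open_interval_iff:
  fixes a b :: real
  shows "(AE x in lebesgue_on {a<..<b}. Q x) \<longleftrightarrow> (AE x in lebesgue_on {a..b}. Q x)"
proof
  assume "AE x in lebesgue_on {a<..<b}. Q x"
  then have 1: "AE x in lborel. x \<in> {a<..<b} \<longrightarrow> Q x" by (simp add: AE_lebesgue_on_iff)
  have 2: "AE x in lborel. x \<in> {a..b} \<longrightarrow> x \<in> {a<..<b}"
    using AE_interior_interval[of a b] by (subst (asm) AE_lebesgue_on_iff) auto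
  have "AE x in lborel. x \<in> {a..b} \<longrightarrow> Q x" using 1 2 by eventually_elim auto
  then show "AE x in lebesgue_on {a..b}. Q x" by (simp add: AE_lebesgue_on_iff)
next
  assume "AE x in lebesgue_on {a..b}. Q x"
  then show "AE x in lebesgue_on {a<..<b}. Q x"
    by (rule AE_lebesgue_on_subset) auto
qed

lemma measurable_open_interval:
  fixes a b :: real and f :: "real \<Rightarrow> real"
  assumes "f \<in> borel_measurable (lebesgue_on {a..b})"
  shows "f \<in> borel_measurable (lebesgue_on {a<..<b})"
  by (rule measurable_restrict_mono[OF assms]) auto

lemma integral_open_interval:
  fixes a b :: real and f :: "real \<Rightarrow> real"
  assumes "f \<in> borel_measurable (lebesgue_on {a..b})"
  shows "(LINT x|lebesgue_on {a<..<b}. f x) = (LINT x|lebesgue_on {a..b}. f x)"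
proof -
  have "(LINT x|lebesgue_on {a<..<b}. f x) = (LINT x|lebesgue_on {a..b}. (if x \<in> {a<..<b} then f x else 0))"
    by (rule integral_restrict[symmetric]) auto
  also have "\<dots> = (LINT x|lebesgue_on {a..b}. f x)"
  proof (rule integral_cong_AE)
    show *: "AE x in lebesgue_on {a..b}. (if x \<in> {a<..<b} then f x else 0) = f x"
      using AE_interior_interval by eventually_elim auto
    show "(\<lambda>x. if x \<in> {a<..<b} then f x else 0) \<in> borel_measurable (lebesgue_on {a..b})"
      using measurable_lebesgue_on_AE[OF assms _ AE_symmetric[OF *]] by simp
  qed fact
  finally show ?thesis .
qed

lemma bounded_continuous_compact:
  fixes f :: "'a::euclidean_space \<Rightarrow> real"
  assumes "continuous_on S f" "compact S"
  obtains C where "\<And>x. x \<in> S \<Longrightarrow> \<bar>f x\<bar> \<le> C" "C \<ge> 0"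
proof -
  have "bounded (f ` S)" using assms by (intro compact_imp_bounded compact_continuous_image)
  then obtain C where "\<forall>y\<in>f ` S. norm y \<le> C" unfolding bounded_iff by blast
  then show ?thesis by (intro that[of "max C 0"]) (auto simp: max.coboundedI1)
qed

lemma continuous_imp_lebesgue_measurable:
  fixes f :: "'a::euclidean_space \<Rightarrow> real"
  shows "continuous_on S f \<Longrightarrow> compact S \<Longrightarrow> f \<in> borel_measurable (lebesgue_on S)"
  by (intro continuous_imp_measurable_on_sets_lebesgue lmeasurable_compact fmeasurableD)

lemma integrable_mult_continuous:
  fixes f g :: "'a::euclidean_space \<Rightarrow> real"
  assumes f: "integrable (lebesgue_on S) f" and g: "continuous_on S g" and S: "compact S"
  shows "integrable (lebesgue_on S) (\<lambda>x. f x * g x)"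
proof -
  obtain C where C: "\<And>x. x \<in> S \<Longrightarrow> \<bar>g x\<bar> \<le> C" "C \<ge> 0"
    using bounded_continuous_compact[OF g S] by blast
  show ?thesis
  proof (rule Bochner_Integration.integrable_bound)
    show "integrable (lebesgue_on S) (\<lambda>x. C * f x)" using f by simp
    show "AE x in lebesgue_on S. norm (f x * g x) \<le> norm (C * f x)"
    proof (rule AE_I2)
      fix x assume "x \<in> space (lebesgue_on S)"
      then have "\<bar>f x\<bar> * \<bar>g x\<bar> \<le> \<bar>f x\<bar> * C" using C by (intro mult_left_mono) auto
      then show "norm (f x * g x) \<le> norm (C * f x)" using C(2) by (simp add: abs_mult mult.commute)
    qed
    show "(\<lambda>x. f x * g x) \<in> borel_measurable (lebesgue_on S)"
      using f continuous_imp_lebesgue_measurable[OF g S] by (intro borel_measurable_times) auto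
  qed
qed

lemma sq_integrable_continuous:
  fixes f :: "'a::euclidean_space \<Rightarrow> real"
  assumes "continuous_on S f" "compact S"
  shows "sq_integrable (lebesgue_on S) f"
proof -
  obtain C where C: "\<And>x. x \<in> S \<Longrightarrow> \<bar>f x\<bar> \<le> C" using bounded_continuous_compact[OF assms] by blast
  show ?thesis
  proof (rule sq_integrable_bounded)
    show "finite_measure (lebesgue_on S)"
      using assms by (intro finite_measure_lebesgue_on lmeasurable_compact)
    show "f \<in> borel_measurable (lebesgue_on S)"
      using assms by (rule continuous_imp_lebesgue_measurable)
    show "AE x in lebesgue_on S. \<bar>f x\<bar> \<le> C" using C by (intro AE_I2) auto
  qed
qed

text \<open>
  The fundamental lemma of the calculus of variations.  The sign of \<open>f\<close> is an almost everywhere limit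
  of continuous functions, which may be truncated to \<open>[-1,1]\<close>; dominated convergence then gives that the
  integral of \<open>\<bar>f\<bar>\<close> vanishes.
\<close>

lemma integral_zero_all_continuous_imp_AE_zero:
  fixes f :: "'a::euclidean_space \<Rightarrow> real"
  assumes S: "S \<in> sets lebesgue" and f: "integrable (lebesgue_on S) f"
    and zero: "\<And>k. continuous_on UNIV k \<Longrightarrow> (\<And>x. \<bar>k x\<bar> \<le> 1) \<Longrightarrow> (LINT x|lebesgue_on S. f x * k x) = 0"
  shows "AE x in lebesgue_on S. f x = 0"
proof -
  have fm: "f \<in> borel_measurable (lebesgue_on S)" using f by simp
  have "(\<lambda>x. sgn (f x)) \<in> borel_measurable (lebesgue_on S)"
    using fm by measurable
  then have "(\<lambda>x. sgn (f x)) measurable_on S"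
    using S by (simp add: measurable_on_iff_borel_measurable)
  then obtain N g where N: "negligible N" and g: "\<And>n. continuous_on UNIV (g n)"
    and lim: "\<And>x. x \<notin> N \<Longrightarrow> (\<lambda>n. g n x) \<longlonglongrightarrow> (if x \<in> S then sgn (f x) else 0)"
    unfolding measurable_on_def by metis
  define k where "k n x = max (-1) (min 1 (g n x))" for n x
  have k: "continuous_on UNIV (k n)" for n
    unfolding k_def by (intro continuous_intros g)
  have k1: "\<bar>k n x\<bar> \<le> 1" for n x unfolding k_def by auto
  have km: "k n \<in> borel_measurable (lebesgue_on S)" for n
    using k by (intro borel_imp_lebesgue_on borel_measurable_continuous_onI) 
  have "(\<lambda>n. LINT x|lebesgue_on S. f x * k n x) \<longlonglongrightarrow> (LINT x|lebesgue_on S. \<bar>f x\<bar>)"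
  proof (rule integral_dominated_convergence[where w="\<lambda>x. \<bar>f x\<bar>"])
    show "AE x in lebesgue_on S. (\<lambda>n. f x * k n x) \<longlonglongrightarrow> \<bar>f x\<bar>"
    proof -
      have "AE x in lebesgue_on S. x \<notin> N"
        using AE_not_in[of N lebesgue] N S by (subst AE_restrict_space_iff) (auto simp: negligible_iff_null_sets elim: eventually_mono)
      then have "AE x in lebesgue_on S. x \<notin> N \<and> x \<in> S"
        using AE_space[of "lebesgue_on S"] by eventually_elim auto
      then show ?thesis
      proof eventually_elim
        case (elim x)
        have "(\<lambda>n. f x * k n x) \<longlonglongrightarrow> f x * max (-1) (min 1 (if x \<in> S then sgn (f x) else 0))"
          unfolding k_def using elim by (intro tendsto_intros lim) auto
        moreover have "f x * max (-1) (min 1 (if x \<in> S then sgn (f x) else 0)) = \<bar>f x\<bar>"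
          using elim by (auto simp: sgn_if)
        ultimately show ?case by simp
      qed
    qed
    show "AE x in lebesgue_on S. norm (f x * k n x) \<le> \<bar>f x\<bar>" for n
      using k1[of n] by (auto simp: abs_mult mult_left_le)
  qed (use f fm km in auto)
  moreover have "(LINT x|lebesgue_on S. f x * k n x) = 0" for n
    using zero[OF k k1] .
  ultimately have "(\<lambda>n. 0) \<longlonglongrightarrow> (LINT x|lebesgue_on S. \<bar>f x\<bar>)" by simp
  then have "(LINT x|lebesgue_on S. \<bar>f x\<bar>) = 0" by (simp add: LIMSEQ_const_iff)
  then have "AE x in lebesgue_on S. \<bar>f x\<bar> = 0"
    using integral_nonneg_eq_0_iff_AE[of "lebesgue_on S" "\<lambda>x. \<bar>f x\<bar>"] f by simp
  then show ?thesis by eventually_elim auto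
qed

section \<open>Fubini's theorem on products and on the cylinder\<close>

lemma AE_section:
  fixes Q :: "'a::euclidean_space \<times> 'b::euclidean_space \<Rightarrow> bool"
  assumes S: "S \<in> sets lebesgue" and S': "S' \<in> sets lebesgue" and SS: "S \<times> S' \<in> sets lebesgue"
    and ae: "AE z in lebesgue_on (S \<times> S'). Q z"
  shows "AE x in lebesgue_on S. AE y in lebesgue_on S'. Q (x, y)"
proof -
  have "AE z in (lborel :: 'a measure) \<Otimes>\<^sub>M (lborel :: 'b measure). z \<in> S \<times> S' \<longrightarrow> Q z"
    using ae SS by (subst lborel_prod) (simp add: AE_lebesgue_on_iff)
  from lborel_pair.AE_pair[OF this]
  have "AE x in lborel. x \<in> S \<longrightarrow> (AE y in lborel. y \<in> S' \<longrightarrow> Q (x, y))"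
  proof eventually_elim
    case (elim x)
    show ?case
    proof
      assume "x \<in> S"
      with elim show "AE y in lborel. y \<in> S' \<longrightarrow> Q (x, y)" by simp
    qed
  qed
  then show ?thesis using S S' by (simp add: AE_lebesgue_on_iff)
qed

text \<open>
  Lebesgue measure on a product is only the completion of the product of the Lebesgue measures.  The
  statement is therefore proved for a Borel representative and carried over, section by section, along
  almost everywhere equalities.
\<close>

lemma Fubini_lebesgue_on:
  fixes f :: "'a::euclidean_space \<times> 'b::euclidean_space \<Rightarrow> real"
  assumes S: "S \<in> sets borel" and S': "S' \<in> sets borel"
    and f: "integrable (lebesgue_on (S \<times> S')) f"
  shows "AE x in lebesgue_on S. integrable (lebesgue_on S') (\<lambda>y. f (x, y))" (is ?sec)
    and "integrable (lebesgue_on S) (\<lambda>x. LINT y|lebesgue_on S'. f (x, y))" (is ?int)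
    and "(LINT x|lebesgue_on S. LINT y|lebesgue_on S'. f (x, y)) = (LINT z|lebesgue_on (S \<times> S'). f z)" (is ?eq)
proof -
  have SS: "S \<times> S' \<in> sets borel" using S S' by (rule borel_Times)
  note L = S S' SS
  have fm: "f \<in> borel_measurable (lebesgue_on (S \<times> S'))" using f by simp
  then obtain g where g: "g \<in> borel_measurable borel" and g0: "\<And>z. z \<notin> S \<times> S' \<Longrightarrow> g z = 0"
    and ae: "AE z in lebesgue_on (S \<times> S'). f z = g z"
    using SS borel_representative[OF fm SS] by blast
  have gl: "g \<in> borel_measurable (lebesgue_on (S \<times> S'))" using g by (rule borel_imp_lebesgue_on)
  have "integrable (lebesgue_on (S \<times> S')) g"
    using integrable_cong_AE_imp[OF f gl ae] .
  then have "integrable lborel g" using lebesgue_on_borel(1)[OF g SS g0] by simp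
  then have gp: "integrable (lborel \<Otimes>\<^sub>M lborel) (\<lambda>(x, y). g (x, y))" by (simp add: lborel_prod)
  have gs: "(\<lambda>y. g (x, y)) \<in> borel_measurable borel" for x using g by measurable
  have gs0: "y \<notin> S' \<Longrightarrow> g (x, y) = 0" for x y using g0 by auto
  have inner: "(LINT y|lebesgue_on S'. g (x, y)) = (LINT y|lborel. g (x, y))" for x
    using lebesgue_on_borel(2)[OF gs S' gs0] .
  have outer: "(LINT y|lborel. g (x, y)) = 0" if "x \<notin> S" for x
    using that g0 by simp
  have om: "(\<lambda>x. LINT y|lborel. g (x, y)) \<in> borel_measurable borel"
    using borel_measurable_integrable[OF lborel_pair.integrable_fst[OF gp]] by simp
  have sec: "AE x in lebesgue_on S. AE y in lebesgue_on S'. f (x, y) = g (x, y)"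
    by (rule AE_section) (use L ae in auto)
  have "AE x in lborel. integrable lborel (\<lambda>y. g (x, y))"
    using lborel_pair.AE_integrable_fst[OF gp] .
  then have "AE x in lborel. integrable (lebesgue_on S') (\<lambda>y. g (x, y))"
    using lebesgue_on_borel(1)[OF gs S' gs0] by simp
  then have isec: "AE x in lebesgue_on S. integrable (lebesgue_on S') (\<lambda>y. g (x, y))"
  proof (subst AE_lebesgue_on_iff)
    assume "AE x in lborel. integrable (lebesgue_on S') (\<lambda>y. g (x, y))"
    then show "AE x in lborel. x \<in> S \<longrightarrow> integrable (lebesgue_on S') (\<lambda>y. g (x, y))"
      by eventually_elim auto
  qed (use L in simp)
  have fg: "AE x in lebesgue_on S. (\<lambda>y. f (x, y)) \<in> borel_measurable (lebesgue_on S') \<and> (AE y in lebesgue_on S'. f (x, y) = g (x, y))"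
    using sec
  proof eventually_elim
    case (elim x)
    have "AE y in lebesgue_on S'. g (x, y) = f (x, y)" using elim by (rule AE_symmetric)
    then have "(\<lambda>y. f (x, y)) \<in> borel_measurable (lebesgue_on S')"
      using L(2) by (intro measurable_lebesgue_on_AE[OF borel_imp_lebesgue_on[OF gs]]) simp_all
    then show ?case using elim by simp
  qed
  show ?sec
    using fg isec
  proof eventually_elim
    case (elim x)
    have "AE y in lebesgue_on S'. g (x, y) = f (x, y)" using conjunct2[OF elim(1)] by eventually_elim simp
    from integrable_cong_AE_imp[OF elim(2) conjunct1[OF elim(1)] this] show ?case .
  qed
  have eq: "AE x in lebesgue_on S. (LINT y|lborel. g (x, y)) = (LINT y|lebesgue_on S'. f (x, y))"
    using fg
  proof eventually_elim
    case (elim x)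
    have "(LINT y|lebesgue_on S'. f (x, y)) = (LINT y|lebesgue_on S'. g (x, y))"
      using elim gs[of x] by (intro integral_cong_AE) (auto intro: borel_imp_lebesgue_on)
    then show ?case using inner by simp
  qed
  have oi: "integrable (lebesgue_on S) (\<lambda>x. LINT y|lborel. g (x, y))"
    using lebesgue_on_borel(1)[OF om S outer] lborel_pair.integrable_fst[OF gp] by simp
  have fom: "(\<lambda>x. LINT y|lebesgue_on S'. f (x, y)) \<in> borel_measurable (lebesgue_on S)"
    using L(1) by (intro measurable_lebesgue_on_AE[OF borel_imp_lebesgue_on[OF om] _ eq]) simp
  show ?int
    using integrable_cong_AE_imp[OF oi fom eq] .
  have "(LINT x|lebesgue_on S. LINT y|lebesgue_on S'. f (x, y)) = (LINT x|lebesgue_on S. LINT y|lborel. g (x, y))"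
    using AE_symmetric[OF eq] fom oi by (intro integral_cong_AE) auto
  also have "\<dots> = (LINT x|lborel. LINT y|lborel. g (x, y))"
    using lebesgue_on_borel(2)[OF om S outer] .
  also have "\<dots> = (LINT z|lborel. g z)"
    using lborel_pair.integral_fst[OF gp] by (simp add: lborel_prod)
  also have "\<dots> = (LINT z|lebesgue_on (S \<times> S'). g z)"
    using lebesgue_on_borel(2)[OF g SS g0] by simp
  also have "\<dots> = (LINT z|lebesgue_on (S \<times> S'). f z)"
    using AE_symmetric[OF ae] fm gl by (intro integral_cong_AE) auto
  finally show ?eq .
qed

lemma compact_cylinder: "compact (cylinder T)"
  by (intro compact_Times compact_Icc)

lemma finite_measure_cylinder: "finite_measure (lebesgue_on (cylinder T))"
  by (intro finite_measure_lebesgue_on lmeasurable_compact compact_cylinder)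

lemma sets_cylinder: "cylinder T \<in> sets borel" "cylinder T \<in> sets lebesgue"
  using borel_compact[OF compact_cylinder[of T]] by simp_all

lemma Fubini_cylinder:
  fixes f :: "real \<times> real \<Rightarrow> real"
  assumes "integrable (lebesgue_on (cylinder T)) f"
  shows "AE s in lebesgue_on {0..T}. integrable (lebesgue_on {0..1}) (\<lambda>u. f (s, u))"
    and "integrable (lebesgue_on {0..T}) (\<lambda>s. LINT u|lebesgue_on {0..1}. f (s, u))"
    and "(LINT z|lebesgue_on (cylinder T). f z) = (LINT s|lebesgue_on {0..T}. LINT u|lebesgue_on {0..1}. f (s, u))"
  using Fubini_lebesgue_on[OF sets_ivl sets_ivl assms] by simp_all

lemma sq_integrable_sections:
  assumes "sq_integrable (lebesgue_on (cylinder T)) (case_prod G)"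
  shows "AE s in lebesgue_on {0..T}. sq_integrable (lebesgue_on {0..1}) (G s)"
proof -
  have "AE s in lebesgue_on {0..T}. integrable (lebesgue_on {0..1}) (\<lambda>u. (case_prod G (s, u))\<^sup>2)"
    using assms by (intro Fubini_cylinder(1)) (simp add: sq_integrable_def)
  moreover have "AE s in lebesgue_on {0..T}. integrable (lebesgue_on {0..1}) (\<lambda>u. case_prod G (s, u))"
    by (intro Fubini_cylinder(1) sq_integrable_imp_integrable[OF finite_measure_cylinder assms])
  ultimately show ?thesis
    by eventually_elim (simp add: sq_integrable_def borel_measurable_integrable)
qed

text \<open>
  The lines \<open>u = 0\<close> and \<open>u = 1\<close> carry the boundary values.  As they are null sets for planar measure,
  boundary values can be prescribed there freely.
\<close>

lemma AE_cylinder_not_on_line: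
  "AE z in lebesgue_on (cylinder T). snd z \<noteq> x"
proof -
  have "negligible {z :: real \<times> real. (0, 1) \<bullet> z = x}"
    by (rule negligible_hyperplane) (simp add: zero_prod_def)
  then have "AE z in lebesgue. z \<notin> {z :: real \<times> real. (0, 1) \<bullet> z = x}"
    by (intro AE_not_in) (simp add: negligible_iff_null_sets)
  then have "AE z in lebesgue. z \<in> cylinder T \<longrightarrow> snd z \<noteq> x"
    by eventually_elim (auto simp: inner_prod_def)
  then show ?thesis by (subst AE_restrict_space_iff) (use sets_cylinder in auto)
qed

lemma AE_cylinder_fst:
  assumes "AE s in lebesgue_on {0..T}. Q s"
  shows "AE z in lebesgue_on (cylinder T). Q (fst z)"
proof -
  have "AE s in lborel. s \<in> {0..T} \<longrightarrow> Q s" using assms by (subst (asm) AE_lebesgue_on_iff) auto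
  then obtain N where N: "N \<in> null_sets lborel" and sub: "{s \<in> space lborel. \<not> (s \<in> {0..T} \<longrightarrow> Q s)} \<subseteq> N"
    unfolding eventually_ae_filter by blast
  have Nb: "N \<in> sets borel" using N by (auto simp: null_sets_def)
  have "AE z in lborel \<Otimes>\<^sub>M (lborel :: real measure). fst z \<notin> N"
  proof (rule lborel_pair.AE_pair_measure)
    show "{x \<in> space (lborel \<Otimes>\<^sub>M (lborel :: real measure)). fst x \<notin> N} \<in> sets (lborel \<Otimes>\<^sub>M lborel)"
      using Nb by measurable
    show "AE x in lborel. AE y in (lborel :: real measure). fst (x, y) \<notin> N"
      using AE_not_in[OF N] by eventually_elim simp
  qed
  then have "AE z in (lborel :: (real \<times> real) measure). fst z \<notin> N" unfolding lborel_prod .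
  then have "AE z in (lborel :: (real \<times> real) measure). z \<in> cylinder T \<longrightarrow> Q (fst z)"
    by eventually_elim (use sub in auto)
  then show ?thesis by (subst AE_lebesgue_on_iff) (use sets_cylinder in auto)
qed

lemma integrable_cylinder_fst:
  fixes f :: "real \<Rightarrow> real"
  assumes "integrable (lebesgue_on {0..T}) f"
  shows "integrable (lebesgue_on (cylinder T)) (\<lambda>z. f (fst z))"
proof -
  obtain g where g: "g \<in> borel_measurable borel" and g0: "\<And>s. s \<notin> {0..T} \<Longrightarrow> g s = 0"
    and fg: "AE s in lebesgue_on {0..T}. f s = g s"
    using borel_representative[OF borel_measurable_integrable[OF assms] borel_closed[OF closed_atLeastAtMost]] by metis
  note [measurable] = g
  have "integrable (lebesgue_on {0..T}) g"
    by (rule integrable_lebesgue_on_AE[OF assms _ fg]) simp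
  then have gi: "integrable lborel g"
    using lebesgue_on_borel(1)[OF g, of "{0..T}"] g0 by simp
  have "integrable (lborel \<Otimes>\<^sub>M lborel) (\<lambda>z. g (fst z) * indicator {0..1::real} (snd z))"
  proof (rule lborel_pair.Fubini_integrable)
    show "(\<lambda>z. g (fst z) * indicator {0..1::real} (snd z)) \<in> borel_measurable (lborel \<Otimes>\<^sub>M lborel)" by measurable
    show "integrable lborel (\<lambda>x. LINT y|lborel. norm (g (fst (x, y)) * indicator {0..1::real} (snd (x, y))))"
      using gi by (simp add: abs_mult)
    show "AE x in lborel. integrable lborel (\<lambda>y. g (fst (x, y)) * indicator {0..1::real} (snd (x, y)))"
      by simp
  qed
  then have "integrable lborel (\<lambda>z :: real \<times> real. g (fst z) * indicator {0..1} (snd z))" by (simp add: lborel_prod)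
  moreover have "(\<lambda>z :: real \<times> real. g (fst z) * indicator {0..1} (snd z)) \<in> borel_measurable borel"
    unfolding borel_prod[symmetric] by measurable
  moreover have "g (fst z) * indicator {0..1} (snd z) = 0" if "z \<notin> cylinder T" for z
    using that g0[of "fst z"] by (cases z) (auto simp: indicator_def)
  ultimately have "integrable (lebesgue_on (cylinder T)) (\<lambda>z. g (fst z) * indicator {0..1} (snd z))"
    using lebesgue_on_borel(1)[OF _ sets_cylinder(1)] by blast
  moreover have "AE z in lebesgue_on (cylinder T). g (fst z) * indicator {0..1} (snd z) = f (fst z)"
    using AE_cylinder_fst[OF fg] AE_space by eventually_elim (auto simp: indicator_def)
  ultimately show ?thesis
    by (rule integrable_lebesgue_on_AE[OF _ sets_cylinder(2)])
qed

section \<open>Smooth bump functions\<close>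

text \<open>
  Counting the derivatives, rather than asking for all of them at once, allows the closure properties to
  be proved by induction on their number.
\<close>

definition diff_upto :: "nat \<Rightarrow> (real \<Rightarrow> real) \<Rightarrow> bool" where
  "diff_upto k f \<longleftrightarrow> (\<forall>j\<le>k. (deriv ^^ j) f differentiable_on UNIV)"

lemma diff_upto_0: "diff_upto 0 f \<longleftrightarrow> f differentiable_on UNIV"
  by (simp add: diff_upto_def)

lemma diff_upto_Suc: "diff_upto (Suc k) f \<longleftrightarrow> f differentiable_on UNIV \<and> diff_upto k (deriv f)"
proof -
  have "(\<forall>j\<le>Suc k. Q j) \<longleftrightarrow> Q 0 \<and> (\<forall>j\<le>k. Q (Suc j))" for Q
    by (metis Suc_le_mono le0 not0_implies_Suc)
  from this[of "\<lambda>j. (deriv ^^ j) f differentiable_on UNIV"] show ?thesis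
    by (simp add: diff_upto_def funpow_Suc_right del: funpow.simps(2))
qed

lemma diff_upto_imp_differentiable: "diff_upto k f \<Longrightarrow> f differentiable_on UNIV"
  by (cases k) (simp_all add: diff_upto_0 diff_upto_Suc)

lemma diff_upto_DERIV: "diff_upto k f \<Longrightarrow> (f has_field_derivative deriv f x) (at x)"
  by (metis DERIV_deriv_iff_real_differentiable UNIV_I diff_upto_imp_differentiable differentiable_on_def)

lemma diff_uptoI:
  assumes "\<And>x. (f has_field_derivative f' x) (at x)" "diff_upto k f'"
  shows "diff_upto (Suc k) f"
proof -
  have "deriv f = f'" using assms(1) by (intro ext DERIV_imp_deriv)
  moreover have "f differentiable_on UNIV"
    using assms(1) by (auto simp: differentiable_on_def real_differentiable_def)
  ultimately show ?thesis using assms(2) by (simp add: diff_upto_Suc)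
qed

lemma diff_uptoI_0:
  "(\<And>x. (f has_field_derivative f' x) (at x)) \<Longrightarrow> diff_upto 0 f"
  by (auto simp: diff_upto_0 differentiable_on_def real_differentiable_def)

lemma diff_upto_SucD: "diff_upto (Suc k) f \<Longrightarrow> diff_upto k f"
  by (auto simp: diff_upto_def)

lemma diff_upto_const: "diff_upto k (\<lambda>_. c)"
proof (induction k arbitrary: c)
  case 0 then show ?case by (rule diff_uptoI_0[where f'="\<lambda>_. 0"]) auto
next
  case (Suc k) show ?case by (rule diff_uptoI[where f'="\<lambda>_. 0"]) (auto intro: Suc)
qed

lemma diff_upto_add: "diff_upto k f \<Longrightarrow> diff_upto k g \<Longrightarrow> diff_upto k (\<lambda>x. f x + g x)"
proof (induction k arbitrary: f g)
  case 0
  then show ?case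
    by (intro diff_uptoI_0[where f'="\<lambda>x. deriv f x + deriv g x"] DERIV_add diff_upto_DERIV)
next
  case (Suc k)
  have "diff_upto k (\<lambda>x. deriv f x + deriv g x)"
    using Suc.prems by (intro Suc.IH) (auto simp: diff_upto_Suc)
  then show ?case
    using Suc.prems by (intro diff_uptoI[where f'="\<lambda>x. deriv f x + deriv g x"] DERIV_add diff_upto_DERIV)
qed

lemma diff_upto_mult: "diff_upto k f \<Longrightarrow> diff_upto k g \<Longrightarrow> diff_upto k (\<lambda>x. f x * g x)"
proof (induction k arbitrary: f g)
  case 0
  then show ?case
    by (intro diff_uptoI_0[where f'="\<lambda>x. deriv f x * g x + deriv g x * f x"] DERIV_mult diff_upto_DERIV)
next
  case (Suc k)
  have "diff_upto k (\<lambda>x. deriv f x * g x + deriv g x * f x)"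
    using Suc.prems by (intro diff_upto_add Suc.IH) (auto simp: diff_upto_Suc diff_upto_SucD)
  then show ?case
    using Suc.prems
    by (intro diff_uptoI[where f'="\<lambda>x. deriv f x * g x + deriv g x * f x"] DERIV_mult diff_upto_DERIV)
qed

lemma diff_upto_affine: "diff_upto k f \<Longrightarrow> diff_upto k (\<lambda>x. f (a * x + b))"
proof (induction k arbitrary: f)
  case 0
  have "((\<lambda>x. f (a * x + b)) has_field_derivative deriv f (a * x + b) * a) (at x)" for x
    by (rule DERIV_chain2[OF diff_upto_DERIV[OF 0]]) (auto intro!: derivative_eq_intros)
  then show ?case by (rule diff_uptoI_0)
next
  case (Suc k)
  have "((\<lambda>x. f (a * x + b)) has_field_derivative deriv f (a * x + b) * a) (at x)" for x
    by (rule DERIV_chain2[OF diff_upto_DERIV[OF Suc.prems]]) (auto intro!: derivative_eq_intros)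
  moreover have "diff_upto k (\<lambda>x. deriv f (a * x + b) * a)"
    using Suc.prems by (intro diff_upto_mult diff_upto_const Suc.IH) (auto simp: diff_upto_Suc)
  ultimately show ?case by (rule diff_uptoI)
qed

lemma diff_upto_id: "diff_upto k (\<lambda>x. x)"
proof (cases k)
  case 0 then show ?thesis using diff_uptoI_0[of "\<lambda>x. x" "\<lambda>_. 1"] by simp
next
  case (Suc j)
  show ?thesis unfolding Suc by (rule diff_uptoI[where f'="\<lambda>_. 1"]) (auto intro: diff_upto_const)
qed

lemma diff_upto_real_polynomial_function:
  fixes p :: "real \<Rightarrow> real"
  shows "real_polynomial_function p \<Longrightarrow> diff_upto k p"
proof (induction rule: real_polynomial_function.induct)
  case (linear f)
  then obtain c where "f = (\<lambda>x. x * c)" using real_bounded_linear by metis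
  then show ?case using diff_upto_mult[OF diff_upto_id diff_upto_const] by simp
qed (auto intro: diff_upto_const diff_upto_add diff_upto_mult)

text \<open>
  The family \<open>x\<^sup>-\<^sup>n exp (-c/x)\<close>, extended by \<open>0\<close> to the left of the origin.  For fixed \<open>c\<close>, derivatives
  of its members are linear combinations of its members.
\<close>

definition flat_exp :: "real \<Rightarrow> nat \<Rightarrow> real \<Rightarrow> real" where
  "flat_exp c n x = (if x > 0 then (1 / x) ^ n * exp (- c / x) else 0)"

lemma flat_exp_tendsto_0:
  assumes "c > 0"
  shows "((\<lambda>x. (1 / x) ^ n * exp (- c / x)) \<longlongrightarrow> 0) (at_right (0::real))"
proof -
  have "((\<lambda>y. (1 / c) ^ n * ((c * y) ^ n / exp (c * y))) \<longlongrightarrow> (1 / c) ^ n * 0) at_top"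
    by (intro tendsto_mult tendsto_const filterlim_compose[OF tendsto_power_div_exp_0]
        filterlim_tendsto_pos_mult_at_top[OF tendsto_const assms filterlim_ident])
  also have "(\<lambda>y. (1 / c) ^ n * ((c * y) ^ n / exp (c * y))) = (\<lambda>y. y ^ n * exp (- c * y))"
    using assms by (auto simp: power_mult_distrib exp_minus field_simps)
  finally have "((\<lambda>y. y ^ n * exp (- c * y)) \<longlongrightarrow> 0) at_top" by simp
  then have "((\<lambda>x. inverse x ^ n * exp (- c * inverse x)) \<longlongrightarrow> 0) (at_right 0)"
    by (rule filterlim_compose[OF _ filterlim_inverse_at_top_right])
  then show ?thesis by (simp add: field_simps)
qed

lemma flat_exp_DERIV:
  assumes "c > 0"
  shows "(flat_exp c n has_field_derivative
    c * flat_exp c (n + 2) x + (- real n) * flat_exp c (n + 1) x) (at x)"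
proof -
  consider "x > 0" | "x = 0" | "x < 0" by linarith
  then show ?thesis
  proof cases
    case 1
    have "((\<lambda>x. (1 / x) ^ n * exp (- c / x)) has_field_derivative
       c * flat_exp c (n + 2) x + (- real n) * flat_exp c (n + 1) x) (at x)"
      using 1
      apply (auto intro!: derivative_eq_intros simp: flat_exp_def)
      apply (cases n) apply (auto simp: field_simps power2_eq_square power_add)
      done
    moreover have "\<forall>\<^sub>F y in nhds x. flat_exp c n y = (1 / y) ^ n * exp (- c / y)"
      using eventually_nhds_in_open[of "{0<..}" x] 1 by (auto simp: flat_exp_def elim!: eventually_mono)
    ultimately show ?thesis
      by (subst DERIV_cong_ev[OF refl _ refl]) auto
  next
    case 2
    \<comment> \<open>To the right of the origin the difference quotient is the member of the family with exponent \<open>n + 1\<close>.\<close>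
    have "((\<lambda>h. flat_exp c n h / h) \<longlongrightarrow> 0) (at 0)"
      unfolding filterlim_at_split
    proof
      show "((\<lambda>h. flat_exp c n h / h) \<longlongrightarrow> 0) (at_left 0)"
        by (rule tendsto_eventually) (auto simp: flat_exp_def eventually_at_filter)
      show "((\<lambda>h. flat_exp c n h / h) \<longlongrightarrow> 0) (at_right 0)"
        by (rule Lim_transform_eventually[OF flat_exp_tendsto_0[OF assms, of "Suc n"]])
          (auto simp: flat_exp_def eventually_at_filter)
    qed
    then show ?thesis using 2 by (simp add: has_field_derivative_iff flat_exp_def)
  next
    case 3
    have "((\<lambda>_. 0) has_field_derivative 0) (at x)" by simp
    moreover have "\<forall>\<^sub>F y in nhds x. flat_exp c n y = 0"
      using eventually_nhds_in_open[of "{..<0}" x] 3 by (auto simp: flat_exp_def elim!: eventually_mono)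
    ultimately have "(flat_exp c n has_field_derivative 0) (at x)"
      by (subst DERIV_cong_ev[OF refl _ refl]) auto
    then show ?thesis using 3 by (simp add: flat_exp_def)
  qed
qed

lemma diff_upto_flat_exp: "c > 0 \<Longrightarrow> diff_upto k (flat_exp c n)"
proof (induction k arbitrary: n)
  case 0 then show ?case using diff_uptoI_0[OF flat_exp_DERIV] by blast
next
  case (Suc k)
  show ?case
    by (rule diff_uptoI[OF flat_exp_DERIV[OF Suc.prems]])
      (intro diff_upto_add diff_upto_mult diff_upto_const Suc)
qed

text \<open>
  The rate \<open>c\<close> is kept as a parameter because the functions increase to the indicator of the open interval
  as \<open>c\<close> tends to \<open>0\<close>.
\<close>

definition bump :: "real \<Rightarrow> real \<Rightarrow> real \<Rightarrow> real \<Rightarrow> real" where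
  "bump c a b x = flat_exp c 0 (x - a) * flat_exp c 0 (b - x)"

lemma bump_outside: "x \<notin> {a<..<b} \<Longrightarrow> bump c a b x = 0"
  by (auto simp: bump_def flat_exp_def)

lemma abs_bump_le_1: "c \<ge> 0 \<Longrightarrow> \<bar>bump c a b x\<bar> \<le> 1"
proof -
  assume "c \<ge> 0"
  then have "\<bar>flat_exp c 0 y\<bar> \<le> 1" for y by (auto simp: flat_exp_def)
  then show ?thesis unfolding bump_def abs_mult by (meson abs_ge_zero mult_le_one)
qed

lemma bump_tendsto:
  assumes "x \<in> {a<..<b}"
  shows "(\<lambda>n. bump (1 / real (Suc n)) a b x) \<longlonglongrightarrow> 1"
proof -
  have "(\<lambda>n. exp (- (1 / real (Suc n)) / y)) \<longlonglongrightarrow> exp (- 0 / y)" if "y > 0" for y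
    by (intro tendsto_intros lim_inverse_n'[THEN LIMSEQ_Suc]) (use that in auto)
  from tendsto_mult[OF this[of "x - a"] this[of "b - x"]] show ?thesis
    using assms by (simp add: bump_def flat_exp_def)
qed

lemma diff_upto_bump:
  assumes "c > 0" shows "diff_upto k (bump c a b)"
  unfolding bump_def
  using diff_upto_affine[OF diff_upto_flat_exp[OF assms], of k 0 1 "-a"]
    diff_upto_affine[OF diff_upto_flat_exp[OF assms], of k 0 "-1" b]
  by (intro diff_upto_mult) (auto simp: algebra_simps)

lemma test_function_bump_mult:
  assumes "c > 0" "0 < a" "b < 1" "\<And>k. diff_upto k p"
  shows "test_function (\<lambda>x. bump c a b x * p x)"
proof -
  have "diff_upto k (\<lambda>x. bump c a b x * p x)" for k
    using assms by (intro diff_upto_mult diff_upto_bump)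
  moreover have "closure {x. bump c a b x * p x \<noteq> 0} \<subseteq> {a..b}"
  proof (rule closure_minimal)
    show "{x. bump c a b x * p x \<noteq> 0} \<subseteq> {a..b}"
    proof
      fix x assume "x \<in> {x. bump c a b x * p x \<noteq> 0}"
      then have "bump c a b x \<noteq> 0" by auto
      then have "x \<in> {a<..<b}" using bump_outside[of x a b c] by blast
      then show "x \<in> {a..b}" by simp
    qed
  qed simp
  ultimately show ?thesis using assms by (auto simp: test_function_def diff_upto_def)
qed

section \<open>Uniqueness of weak derivatives\<close>

text \<open>
  Test with bumps times polynomials.  As the bumps tend to the indicator of the interval, \<open>h\<close> is seen to
  be orthogonal to all polynomials, by Weierstrass' theorem to all continuous functions, and the
  fundamental lemma applies.
\<close>

lemma vanishing_on_bumps: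
  assumes ab: "0 < a" "a < b" "b < 1"
    and h: "integrable (lebesgue_on {a..b}) h"
    and zero: "\<And>\<eta>. test_function \<eta> \<Longrightarrow> (\<And>x. x \<notin> {a..b} \<Longrightarrow> \<eta> x = 0) \<Longrightarrow> (LINT x|lebesgue_on {a..b}. h x * \<eta> x) = 0"
  shows "AE x in lebesgue_on {a..b}. h x = 0"
proof (rule integral_zero_all_continuous_imp_AE_zero[OF _ h])
  have hm: "h \<in> borel_measurable (lebesgue_on {a..b})" using h by simp
  have polm: "p \<in> borel_measurable (lebesgue_on {a..b})"
    and inthp: "integrable (lebesgue_on {a..b}) (\<lambda>x. h x * p x)"
    if "continuous_on UNIV p" for p :: "real \<Rightarrow> real"
    using continuous_imp_lebesgue_measurable[of "{a..b}" p] integrable_mult_continuous[OF h, of p]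
      continuous_on_subset[OF that] by auto
  have polc: "continuous_on UNIV p" if "real_polynomial_function p" for p :: "real \<Rightarrow> real"
    using diff_upto_imp_differentiable[OF diff_upto_real_polynomial_function[OF that, of 0]]
    by (rule differentiable_imp_continuous_on)
  have poly: "(LINT x|lebesgue_on {a..b}. h x * p x) = 0" if p: "real_polynomial_function p" for p
  proof -
    note pc = polc[OF p]
    let ?\<eta> = "\<lambda>n x. bump (1 / real (Suc n)) a b x * p x"
    have tf: "test_function (?\<eta> n)" for n
      using ab p by (intro test_function_bump_mult diff_upto_real_polynomial_function) auto
    have bm: "bump (1 / real (Suc n)) a b \<in> borel_measurable (lebesgue_on {a..b})" for n
      using diff_upto_imp_differentiable[OF diff_upto_bump[of "1 / real (Suc n)" 0 a b]]
      by (intro polm differentiable_imp_continuous_on) simp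
    have "(\<lambda>n. LINT x|lebesgue_on {a..b}. h x * ?\<eta> n x) \<longlonglongrightarrow> (LINT x|lebesgue_on {a..b}. h x * p x)"
    proof (rule integral_dominated_convergence[where w="\<lambda>x. \<bar>h x * p x\<bar>"])
      show "AE x in lebesgue_on {a..b}. (\<lambda>n. h x * ?\<eta> n x) \<longlonglongrightarrow> h x * p x"
        using AE_interior_interval
      proof eventually_elim
        case (elim x)
        have "(\<lambda>n. h x * ?\<eta> n x) \<longlonglongrightarrow> h x * (1 * p x)"
          by (intro tendsto_intros bump_tendsto elim)
        then show ?case by simp
      qed
      show "AE x in lebesgue_on {a..b}. norm (h x * ?\<eta> n x) \<le> \<bar>h x * p x\<bar>" for n
      proof (rule AE_I2)
        fix x
        have "\<bar>h x * p x\<bar> * \<bar>bump (1 / real (Suc n)) a b x\<bar> \<le> \<bar>h x * p x\<bar> * 1"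
          by (intro mult_left_mono abs_bump_le_1) auto
        then show "norm (h x * ?\<eta> n x) \<le> \<bar>h x * p x\<bar>" by (simp add: abs_mult mult_ac)
      qed
    qed (use hm polm[OF pc] bm inthp[OF pc] in \<open>auto simp del: of_nat_Suc\<close>)
    moreover have "(LINT x|lebesgue_on {a..b}. h x * ?\<eta> n x) = 0" for n
    proof (rule zero[OF tf])
      fix x assume "x \<notin> {a..b}"
      then have "x \<notin> {a<..<b}" by auto
      then show "?\<eta> n x = 0" unfolding bump_outside[OF \<open>x \<notin> {a<..<b}\<close>] by simp
    qed
    ultimately show ?thesis by (simp add: LIMSEQ_const_iff)
  qed
  fix k :: "real \<Rightarrow> real" assume k: "continuous_on UNIV k"
  define I where "I = (LINT x|lebesgue_on {a..b}. \<bar>h x\<bar>)"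
  \<comment> \<open>Weierstrass: replace \<open>k\<close> by a polynomial at uniform distance less than \<open>e\<close>.\<close>
  have "\<bar>LINT x|lebesgue_on {a..b}. h x * k x\<bar> \<le> e * I" if "e > 0" for e
  proof -
    have kc: "continuous_on {a..b} k" by (rule continuous_on_subset[OF k]) simp
    obtain p where p: "real_polynomial_function p" and pe: "\<And>x. x \<in> {a..b} \<Longrightarrow> \<bar>k x - p x\<bar> < e"
      using Stone_Weierstrass_real_polynomial_function[OF compact_Icc kc \<open>e > 0\<close>] by blast
    note pc = polc[OF p]
    have "(LINT x|lebesgue_on {a..b}. h x * k x) = (LINT x|lebesgue_on {a..b}. h x * k x - h x * p x)"
      using inthp[OF k] inthp[OF pc] poly[OF p] by simp
    also have "\<bar>\<dots>\<bar> \<le> (LINT x|lebesgue_on {a..b}. e * \<bar>h x\<bar>)"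
    proof (rule order_trans[OF integral_abs_bound integral_mono_AE])
      show "AE x in lebesgue_on {a..b}. \<bar>h x * k x - h x * p x\<bar> \<le> e * \<bar>h x\<bar>"
      proof (rule AE_I2)
        fix x assume "x \<in> space (lebesgue_on {a..b})"
        then have "\<bar>h x\<bar> * \<bar>k x - p x\<bar> \<le> \<bar>h x\<bar> * e" using less_imp_le[OF pe[of x]] by (intro mult_left_mono) auto
        then show "\<bar>h x * k x - h x * p x\<bar> \<le> e * \<bar>h x\<bar>"
          by (metis abs_mult mult.commute right_diff_distrib)
      qed
    qed (use inthp[OF k] inthp[OF pc] h in auto)
    finally show ?thesis by (simp add: I_def)
  qed
  then have "\<bar>LINT x|lebesgue_on {a..b}. h x * k x\<bar> \<le> 0"
  proof -
    assume *: "\<And>e. e > 0 \<Longrightarrow> \<bar>LINT x|lebesgue_on {a..b}. h x * k x\<bar> \<le> e * I"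
    have I: "I \<ge> 0" unfolding I_def by (rule Bochner_Integration.integral_nonneg) auto
    show ?thesis
    proof (rule field_le_epsilon)
      fix e :: real assume "e > 0"
      have "\<bar>LINT x|lebesgue_on {a..b}. h x * k x\<bar> \<le> e / (I + 1) * I"
        using I \<open>e > 0\<close> by (intro *) simp
      also have "\<dots> \<le> e" using I \<open>e > 0\<close> by (simp add: field_simps)
      finally show "\<bar>LINT x|lebesgue_on {a..b}. h x * k x\<bar> \<le> 0 + e" by simp
    qed
  qed
  then show "(LINT x|lebesgue_on {a..b}. h x * k x) = 0" by simp
qed simp

text \<open>
  The difference of two weak derivatives is orthogonal to all test functions, so it vanishes on every
  compact subinterval of \<open>(0,1)\<close>; countably many of these cover \<open>(0,1)\<close>.
\<close>

lemma weak_derivative_unique: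
  assumes "is_weak_derivative \<phi> \<psi>1" "is_weak_derivative \<phi> \<psi>2"
  shows "AE x in lebesgue_on {0<..<1}. \<psi>1 x = \<psi>2 x"
proof -
  have part: "AE x in lebesgue_on {a..b}. \<psi>1 x - \<psi>2 x = 0" if ab: "0 < a" "a < b" "b < 1" for a b
  proof (rule vanishing_on_bumps[OF ab])
    have i: "integrable (lebesgue_on {a..b}) \<psi>" if "is_weak_derivative \<phi> \<psi>" for \<psi>
    proof -
      have "compact {a..b}" "{a..b} \<subseteq> {0<..<1}" using ab by auto
      then show ?thesis using that unfolding is_weak_derivative_def locally_summable_def by blast
    qed
    note i12 = i[OF assms(1)] i[OF assms(2)]
    then show "integrable (lebesgue_on {a..b}) (\<lambda>x. \<psi>1 x - \<psi>2 x)" by simp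
    fix \<eta> assume \<eta>: "test_function \<eta>" and \<eta>0: "\<And>x. x \<notin> {a..b} \<Longrightarrow> \<eta> x = 0"
    have "(deriv ^^ 0) \<eta> differentiable_on UNIV" using \<eta> unfolding test_function_def by blast
    then have c: "continuous_on UNIV \<eta>" by (simp add: differentiable_imp_continuous_on)
    have ii: "integrable (lebesgue_on {a..b}) (\<lambda>x. \<psi> x * \<eta> x)" if "integrable (lebesgue_on {a..b}) \<psi>" for \<psi>
      using integrable_mult_continuous[OF that] continuous_on_subset[OF c] by auto
    have e: "(LINT x|lebesgue_on {a..b}. \<psi> x * \<eta> x) = (LINT x|lebesgue_on {0<..<1}. \<psi> x * \<eta> x)" for \<psi>
    proof -
      have "(LINT x|lebesgue_on {0<..<1}. (if x \<in> {a..b} then \<psi> x * \<eta> x else 0)) = (LINT x|lebesgue_on {a..b}. \<psi> x * \<eta> x)"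
        using ab by (intro integral_restrict) auto
      moreover have "(\<lambda>x. if x \<in> {a..b} then \<psi> x * \<eta> x else 0) = (\<lambda>x. \<psi> x * \<eta> x)"
        using \<eta>0 by auto
      ultimately show ?thesis by simp
    qed
    have "(LINT x|lebesgue_on {0<..<1}. \<psi>1 x * \<eta> x) = (LINT x|lebesgue_on {0<..<1}. \<psi>2 x * \<eta> x)"
    proof -
      have "(LINT u|lebesgue_on {0<..<1}. \<phi> u * deriv \<eta> u) = - (LINT u|lebesgue_on {0<..<1}. \<psi> u * \<eta> u)"
        if "is_weak_derivative \<phi> \<psi>" for \<psi>
        using that \<eta> unfolding is_weak_derivative_def by blast
      from this[OF assms(1)] this[OF assms(2)] show ?thesis by linarith
    qed
    then show "(LINT x|lebesgue_on {a..b}. (\<psi>1 x - \<psi>2 x) * \<eta> x) = 0"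
      using ii i12 e by (simp add: left_diff_distrib)
  qed
  let ?a = "\<lambda>n. 1 / real (n + 3)"
  have "AE x in lborel. \<forall>n. x \<in> {?a n..1 - ?a n} \<longrightarrow> \<psi>1 x - \<psi>2 x = 0"
    unfolding AE_all_countable
  proof
    fix n
    have "?a n \<le> 1/3" by (simp add: field_simps)
    then have "AE x in lebesgue_on {?a n..1 - ?a n}. \<psi>1 x - \<psi>2 x = 0"
      by (intro part) (auto simp: field_simps)
    then show "AE x in lborel. x \<in> {?a n..1 - ?a n} \<longrightarrow> \<psi>1 x - \<psi>2 x = 0"
      by (subst (asm) AE_lebesgue_on_iff) auto
  qed
  then have "AE x in lborel. x \<in> {0<..<1} \<longrightarrow> \<psi>1 x = \<psi>2 x"
  proof eventually_elim
    case (elim x)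
    show ?case
    proof
      assume "x \<in> {0<..<1}"
      then have "min x (1 - x) > 0" by auto
      then obtain n where "1 / real (Suc n) < min x (1 - x)" using nat_approx_posE by blast
      moreover have "?a n \<le> 1 / real (Suc n)" by (simp add: frac_le)
      ultimately have "x \<in> {?a n..1 - ?a n}" by auto
      then show "\<psi>1 x = \<psi>2 x" using elim by auto
    qed
  qed
  then show ?thesis by (simp add: AE_lebesgue_on_iff)
qed

section \<open>Primitives of integrable functions\<close>

text \<open>
  The cut-off is placed inside an integral over the fixed interval so that joint measurability in
  additional parameters is immediate.
\<close>

definition primitive :: "(real \<Rightarrow> real) \<Rightarrow> real \<Rightarrow> real" where
  "primitive D u = (LINT v|lebesgue_on {0..1}. (if v \<le> u then D v else 0))"

lemma integrable_if_le:
  fixes D :: "real \<Rightarrow> real"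
  assumes "integrable (lebesgue_on {0..1}) D"
  shows "integrable (lebesgue_on {0..1}) (\<lambda>v. if v \<le> u then D v else (0::real))"
proof (rule Bochner_Integration.integrable_bound[OF assms])
  have "D \<in> borel_measurable (lebesgue_on {0..1})" using assms by simp
  moreover have "indicat_real {..u} \<in> borel_measurable (lebesgue_on {0..1})"
    by (intro borel_imp_lebesgue_on borel_measurable_indicator borel_closed closed_atMost)
  ultimately have "(\<lambda>v. indicat_real {..u} v * D v) \<in> borel_measurable (lebesgue_on {0..1})"
    by (intro borel_measurable_times)
  also have "(\<lambda>v. indicat_real {..u} v * D v) = (\<lambda>v. if v \<le> u then D v else 0)"
    by (auto simp: indicator_def)
  finally show "(\<lambda>v. if v \<le> u then D v else 0) \<in> borel_measurable (lebesgue_on {0..1})" .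
qed auto

lemma primitive_eq_integral:
  assumes D: "integrable (lebesgue_on {0..1}) D" and u: "u \<in> {0..1}"
  shows "primitive D u = integral {0..u} D"
proof -
  have "primitive D u = (LINT v|lebesgue_on {0..1}. (if v \<in> {..u} then D v else 0))"
    by (simp add: primitive_def)
  also have "\<dots> = (LINT v|lebesgue_on ({..u} \<inter> {0..1}). D v)"
    by (rule Lebesgue_Measure.integral_restrict_Int) auto
  also have "{..u} \<inter> {0..1} = {0..u}" using u by auto
  also have "(LINT v|lebesgue_on {0..u}. D v) = integral {0..u} D"
    using integrable_lebesgue_on_subset[OF D, of "{0..u}"] u
    by (intro lebesgue_integral_eq_integral) auto
  finally show ?thesis .
qed

lemma continuous_on_primitive:
  assumes "integrable (lebesgue_on {0..1}) D"
  shows "continuous_on {0..1} (primitive D)"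
proof -
  have "continuous_on {0..1} (\<lambda>u. integral {0..u} D)"
    by (intro indefinite_integral_continuous_1 integrable_on_lebesgue_on assms) auto
  then show ?thesis
    using primitive_eq_integral[OF assms] by (subst continuous_on_cong[OF refl]) auto
qed

lemma primitive_0: "integrable (lebesgue_on {0..1}) D \<Longrightarrow> primitive D 0 = 0"
  by (simp add: primitive_eq_integral)

lemma primitive_1: "primitive D 1 = (LINT v|lebesgue_on {0..1}. D v)"
  unfolding primitive_def by (intro Bochner_Integration.integral_cong) auto

lemma primitive_diff:
  assumes "integrable (lebesgue_on {0..1}) D" "integrable (lebesgue_on {0..1}) E"
  shows "primitive (\<lambda>v. D v - E v) u = primitive D u - primitive E u"
proof -
  have "primitive (\<lambda>v. D v - E v) u = (LINT v|lebesgue_on {0..1}. (if v \<le> u then D v else 0) - (if v \<le> u then E v else 0))"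
    unfolding primitive_def by (intro Bochner_Integration.integral_cong) auto
  then show ?thesis
    using integrable_if_le[OF assms(1), of u] integrable_if_le[OF assms(2), of u]
    by (simp add: primitive_def)
qed

lemma primitive_cong_AE:
  assumes "integrable (lebesgue_on {0..1}) D" "AE v in lebesgue_on {0..1}. D v = E v"
  shows "primitive D u = primitive E u"
  unfolding primitive_def
proof (rule integral_cong_AE)
  have E: "integrable (lebesgue_on {0..1}) E"
  proof (rule integrable_cong_AE_imp[OF assms(1) _ assms(2)])
    show "E \<in> borel_measurable (lebesgue_on {0..1})"
      by (rule measurable_lebesgue_on_AE[OF borel_measurable_integrable[OF assms(1)] _ assms(2)]) simp
  qed
  show "(\<lambda>v. if v \<le> u then D v else 0) \<in> borel_measurable (lebesgue_on {0..1})"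
    "(\<lambda>v. if v \<le> u then E v else 0) \<in> borel_measurable (lebesgue_on {0..1})"
    using integrable_if_le[OF assms(1)] integrable_if_le[OF E] by auto
  show "AE v in lebesgue_on {0..1}. (if v \<le> u then D v else 0) = (if v \<le> u then E v else 0)"
    using assms(2) by eventually_elim auto
qed

lemma primitive_square_le:
  assumes "sq_integrable (lebesgue_on {0..1}) D"
  shows "(primitive D u)\<^sup>2 \<le> (LINT v|lebesgue_on {0..1}. (D v)\<^sup>2)"
proof -
  have D: "integrable (lebesgue_on {0..1}) D"
    using sq_integrable_imp_integrable[OF finite_measure_ivl assms] .
  have "\<bar>primitive D u\<bar> \<le> (LINT v|lebesgue_on {0..1}. \<bar>D v\<bar>)"
    unfolding primitive_def
    by (rule order_trans[OF integral_abs_bound integral_mono_AE])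
      (use D integrable_if_le[OF D] in auto)
  then have "(primitive D u)\<^sup>2 \<le> (LINT v|lebesgue_on {0..1}. \<bar>D v\<bar>)\<^sup>2"
    using power_mono[of "\<bar>primitive D u\<bar>" _ 2] by simp
  also have "\<dots> \<le> measure (lebesgue_on {0..1}) {0..1::real} * (LINT v|lebesgue_on {0..1}. (D v)\<^sup>2)"
    using L1_square_le_L2[OF finite_measure_ivl assms] by simp
  also have "measure (lebesgue_on {0..1}) {0..1::real} = 1"
    by (subst measure_restrict_space) auto
  finally show ?thesis by simp
qed

text \<open>
  Integration by parts for an absolutely continuous function against a continuously differentiable one:
  exchange the order of integration over the triangle \<open>v \<le> u\<close> and integrate \<open>k\<close> over \<open>[v,1]\<close>.
\<close>

lemma Fubini_primitive:
  assumes D: "integrable (lebesgue_on {0..1}) D"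
    and k: "continuous_on {0..1} k" and F: "\<And>u. u \<in> {0..1} \<Longrightarrow> (F has_vector_derivative k u) (at u within {0..1})"
  shows "(LINT u|lebesgue_on {0..1}. primitive D u * k u)
       = primitive D 1 * F 1 - (LINT v|lebesgue_on {0..1}. D v * F v)"
proof -
  obtain d where d: "d \<in> borel_measurable borel" and d0: "\<And>x. x \<notin> {0..1} \<Longrightarrow> d x = 0"
    and dD: "AE x in lebesgue_on {0..1}. D x = d x"
    using borel_representative[OF borel_measurable_integrable[OF D]] by auto
  note [measurable] = d
  define q where "q u = (if u \<in> {0..1} then k u else 0)" for u
  have qm[measurable]: "q \<in> borel_measurable borel"
    using borel_measurable_continuous_on_if[of "{0..1}" k "\<lambda>_. 0"] k unfolding q_def by simp
  have q0: "x \<notin> {0..1} \<Longrightarrow> q x = 0" for x by (auto simp: q_def)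
  have di: "integrable (lebesgue_on {0..1}) d"
    using integrable_cong_AE_imp[OF D borel_imp_lebesgue_on[OF d] dD] .
  then have dl: "integrable lborel d" using lebesgue_on_borel(1)[OF d, of "{0..1}"] d0 by simp
  have "integrable (lebesgue_on {0..1}) (\<lambda>u. 1 * k u)"
    by (rule integrable_mult_continuous[OF _ k]) auto
  then have "integrable (lebesgue_on {0..1}) q"
    by (subst Bochner_Integration.integrable_cong[OF refl, of _ _ k]) (auto simp: q_def)
  then have ql: "integrable lborel q" using lebesgue_on_borel(1)[OF qm, of "{0..1}"] q0 by simp
  define f where "f u v = (if v \<le> u then d v * q u else 0)" for u v :: real
  have G: "integrable (lborel \<Otimes>\<^sub>M lborel) (\<lambda>(u, v). d v * q u)"
  proof (rule lborel_pair.Fubini_integrable)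
    show "(\<lambda>(u, v). d v * q u) \<in> borel_measurable (lborel \<Otimes>\<^sub>M lborel)" by measurable
    show "integrable lborel (\<lambda>u. LINT v|lborel. norm (case (u, v) of (u, v) \<Rightarrow> d v * q u))"
      using ql by (simp add: abs_mult)
    show "AE u in lborel. integrable lborel (\<lambda>v. case (u, v) of (u, v) \<Rightarrow> d v * q u)"
      using dl by simp
  qed
  have fi: "integrable (lborel \<Otimes>\<^sub>M lborel) (case_prod f)"
  proof (rule Bochner_Integration.integrable_bound[OF G])
    show "case_prod f \<in> borel_measurable (lborel \<Otimes>\<^sub>M lborel)" unfolding f_def by measurable
  qed (auto simp: f_def)
  have in1: "(LINT v|lborel. f u v) = primitive D u * q u" for u
  proof -
    have "(LINT v|lborel. f u v) = (LINT v|lborel. (if v \<le> u then d v else 0) * q u)"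
      unfolding f_def by (intro Bochner_Integration.integral_cong) auto
    also have "\<dots> = (LINT v|lborel. (if v \<le> u then d v else 0)) * q u" by simp
    also have "(LINT v|lborel. (if v \<le> u then d v else 0)) = primitive d u"
      unfolding primitive_def by (rule lebesgue_on_borel(2)[symmetric]) (auto simp: d0)
    also have "\<dots> = primitive D u" using primitive_cong_AE[OF D dD] by simp
    finally show ?thesis .
  qed
  have in2: "(LINT u|lborel. f u v) = d v * (F 1 - F v)" for v
  proof (cases "v \<in> {0..1}")
    case True
    have "(LINT u|lborel. f u v) = (LINT u|lborel. d v * (indicator {v..1} u *\<^sub>R k u))"
      unfolding f_def using True
      by (intro Bochner_Integration.integral_cong) (auto simp: q_def indicator_def)
    also have "\<dots> = d v * (LINT u|lborel. indicator {v..1} u *\<^sub>R k u)"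
      by (rule integral_mult_right_zero)
    also have "(LINT u|lborel. indicator {v..1} u *\<^sub>R k u) = F 1 - F v"
      using True
      by (intro integral_FTC_atLeastAtMost continuous_on_subset[OF k] has_vector_derivative_within_subset[OF F]) auto
    finally show ?thesis .
  next
    case False
    then have "d v = 0" by (rule d0)
    then show ?thesis by (simp add: f_def cong: if_cong)
  qed
  have Fc: "continuous_on {0..1} F"
    using F by (meson continuous_on_eq_continuous_within has_vector_derivative_continuous)
  have "(LINT u|lebesgue_on {0..1}. primitive D u * k u) = (LINT u|lebesgue_on {0..1}. primitive D u * q u)"
    by (intro Bochner_Integration.integral_cong) (auto simp: q_def)
  also have "\<dots> = (LINT u|lborel. primitive D u * q u)"
  proof (rule lebesgue_on_borel(2))
    show "(\<lambda>u. primitive D u * q u) \<in> borel_measurable borel"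
      using borel_measurable_integrable[OF lborel_pair.integrable_fst[OF fi]] by (simp add: in1)
  qed (auto simp: q0)
  also have "\<dots> = (LINT v|lborel. d v * (F 1 - F v))"
    using lborel_pair.Fubini_integral[OF fi] by (simp add: in1 in2)
  also have "\<dots> = (LINT v|lebesgue_on {0..1}. d v * (F 1 - F v))"
  proof (rule lebesgue_on_borel(2)[symmetric])
    show "(\<lambda>v. d v * (F 1 - F v)) \<in> borel_measurable borel"
      using borel_measurable_integrable[OF lborel_pair.integrable_snd[OF fi]] by (simp add: in2)
  qed (auto simp: d0)
  also have "\<dots> = (LINT v|lebesgue_on {0..1}. D v * (F 1 - F v))"
  proof (rule integral_cong_AE)
    show "AE v in lebesgue_on {0..1}. d v * (F 1 - F v) = D v * (F 1 - F v)"
      using dD by eventually_elim auto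
    have c: "continuous_on {0..1} (\<lambda>v. F 1 - F v)" by (intro continuous_intros Fc)
    show "(\<lambda>v. d v * (F 1 - F v)) \<in> borel_measurable (lebesgue_on {0..1})"
      "(\<lambda>v. D v * (F 1 - F v)) \<in> borel_measurable (lebesgue_on {0..1})"
      using integrable_mult_continuous[OF di c] integrable_mult_continuous[OF D c] by auto
  qed
  also have "\<dots> = (LINT v|lebesgue_on {0..1}. F 1 * D v - D v * F v)"
    by (intro Bochner_Integration.integral_cong) (auto simp: algebra_simps)
  also have "\<dots> = F 1 * primitive D 1 - (LINT v|lebesgue_on {0..1}. D v * F v)"
    using D integrable_mult_continuous[OF D Fc] by (simp add: primitive_1)
  finally show ?thesis by (simp add: mult.commute)
qed

text \<open>
  The previous formula with a test function \<open>\<eta>\<close> in the place of \<open>F\<close>; the boundary terms vanish.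
\<close>

lemma is_weak_derivative_primitive:
  assumes D: "integrable (lebesgue_on {0..1}) D"
    and \<phi>: "AE u in lebesgue_on {0..1}. \<phi> u = a + primitive D u"
  shows "is_weak_derivative \<phi> D"
proof -
  have pc: "continuous_on {0..1} (\<lambda>u. a + primitive D u)"
    by (intro continuous_intros continuous_on_primitive D)
  have pm: "(\<lambda>u. a + primitive D u) \<in> borel_measurable (lebesgue_on {0..1})"
    using continuous_imp_lebesgue_measurable[OF pc] by simp
  have "integrable (lebesgue_on {0..1}) (\<lambda>u. 1 * (a + primitive D u))"
    by (rule integrable_mult_continuous[OF _ pc]) auto
  then have "integrable (lebesgue_on {0..1}) (\<lambda>u. a + primitive D u)" by simp
  moreover have \<phi>m: "\<phi> \<in> borel_measurable (lebesgue_on {0..1})"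
    using measurable_lebesgue_on_AE[OF pm _ AE_symmetric[OF \<phi>]] by simp
  ultimately have \<phi>i: "integrable (lebesgue_on {0..1}) \<phi>"
    using integrable_cong_AE_imp AE_symmetric[OF \<phi>] by blast
  have ls: "locally_summable f" if "integrable (lebesgue_on {0..1}) f" for f
    unfolding locally_summable_def
  proof (intro allI impI)
    fix K :: "real set" assume "compact K \<and> K \<subseteq> {0<..<1}"
    then show "integrable (lebesgue_on K) f"
      by (intro integrable_lebesgue_on_subset[OF that]) (auto intro: lmeasurable_compact fmeasurableD)
  qed
  have "(LINT u|lebesgue_on {0<..<1}. \<phi> u * deriv \<eta> u) = - (LINT u|lebesgue_on {0<..<1}. D u * \<eta> u)"
    if \<eta>: "test_function \<eta>" for \<eta>
  proof -
    have "(deriv ^^ 0) \<eta> differentiable_on UNIV" "(deriv ^^ 1) \<eta> differentiable_on UNIV"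
      using \<eta> unfolding test_function_def by blast+
    then have d: "\<eta> differentiable_on UNIV" "deriv \<eta> differentiable_on UNIV" by simp_all
    then have c: "continuous_on {0..1} \<eta>" "continuous_on {0..1} (deriv \<eta>)"
      using differentiable_imp_continuous_on continuous_on_subset by blast+
    have der: "(\<eta> has_vector_derivative deriv \<eta> u) (at u within A)" for u A
      using d(1) by (metis DERIV_deriv_iff_real_differentiable UNIV_I differentiable_on_def
          has_real_derivative_iff_has_vector_derivative has_vector_derivative_at_within)
    have "x \<notin> {0<..<1} \<Longrightarrow> \<eta> x = 0" for x
      using \<eta> closure_subset[of "{x. \<eta> x \<noteq> 0}"] unfolding test_function_def by blast
    then have \<eta>01: "\<eta> 0 = 0" "\<eta> 1 = 0" by auto
    have "(LINT u|lebesgue_on {0<..<1}. \<phi> u * deriv \<eta> u) = (LINT u|lebesgue_on {0..1}. \<phi> u * deriv \<eta> u)"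
      using integrable_mult_continuous[OF \<phi>i c(2)] by (intro integral_open_interval) auto
    also have "\<dots> = (LINT u|lebesgue_on {0..1}. a * deriv \<eta> u + primitive D u * deriv \<eta> u)"
    proof (rule integral_cong_AE)
      show "AE u in lebesgue_on {0..1}. \<phi> u * deriv \<eta> u = a * deriv \<eta> u + primitive D u * deriv \<eta> u"
        using \<phi> by eventually_elim (simp add: algebra_simps)
      show "(\<lambda>u. \<phi> u * deriv \<eta> u) \<in> borel_measurable (lebesgue_on {0..1})"
        using integrable_mult_continuous[OF \<phi>i c(2)] by auto
      show "(\<lambda>u. a * deriv \<eta> u + primitive D u * deriv \<eta> u) \<in> borel_measurable (lebesgue_on {0..1})"
        by (intro continuous_imp_lebesgue_measurable continuous_intros c continuous_on_primitive D) auto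
    qed
    also have "\<dots> = (LINT u|lebesgue_on {0..1}. a * deriv \<eta> u) + (LINT u|lebesgue_on {0..1}. primitive D u * deriv \<eta> u)"
    proof (rule Bochner_Integration.integral_add)
      show "integrable (lebesgue_on {0..1}) (\<lambda>u. a * deriv \<eta> u)"
        by (rule integrable_mult_continuous[OF _ c(2)]) auto
      have "integrable (lebesgue_on {0..1}) (\<lambda>u. 1 * (primitive D u * deriv \<eta> u))"
        by (rule integrable_mult_continuous) (auto intro!: continuous_intros continuous_on_primitive D c)
      then show "integrable (lebesgue_on {0..1}) (\<lambda>u. primitive D u * deriv \<eta> u)" by simp
    qed
    also have "(LINT u|lebesgue_on {0..1}. a * deriv \<eta> u) = 0"
    proof -
      have "(deriv \<eta> has_integral (\<eta> 1 - \<eta> 0)) {0..1}"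
        by (rule fundamental_theorem_of_calculus) (auto intro: der)
      then have "integral {0..1} (deriv \<eta>) = 0" using \<eta>01 by (simp add: integral_unique)
      moreover have "integrable (lebesgue_on {0..1}) (\<lambda>u. 1 * deriv \<eta> u)"
        by (rule integrable_mult_continuous[OF _ c(2)]) auto
      ultimately show ?thesis by (simp add: lebesgue_integral_eq_integral)
    qed
    also have "0 + (LINT u|lebesgue_on {0..1}. primitive D u * deriv \<eta> u)
      = - (LINT u|lebesgue_on {0..1}. D u * \<eta> u)"
      using Fubini_primitive[OF D c(2) der] \<eta>01 by simp
    also have "(LINT u|lebesgue_on {0..1}. D u * \<eta> u) = (LINT u|lebesgue_on {0<..<1}. D u * \<eta> u)"
      using integrable_mult_continuous[OF D c(1)] by (intro integral_open_interval[symmetric]) auto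
    finally show ?thesis .
  qed
  then show ?thesis
    using ls[OF \<phi>i] ls[OF D] by (auto simp: is_weak_derivative_def)
qed

text \<open>
  Two continuous functions that agree almost everywhere on an open interval agree everywhere on it, so
  the continuous representative, and with it its one-sided limits, is unique.
\<close>

lemma traces_primitive:
  assumes D: "integrable (lebesgue_on {0..1}) D"
    and \<phi>: "AE u in lebesgue_on {0..1}. \<phi> u = a + primitive D u"
  shows "H1_at_0 \<phi> = a" and "H1_at_1 \<phi> = a + primitive D 1"
proof -
  let ?g = "\<lambda>u. a + primitive D u"
  have gc: "continuous_on {0..1} ?g"
    by (intro continuous_intros continuous_on_primitive D)
  have g01: "continuous_on {0<..<1} ?g" by (rule continuous_on_subset[OF gc]) auto
  have gae: "AE u in lebesgue_on {0<..<1}. ?g u = \<phi> u"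
    using AE_symmetric[OF \<phi>] by (simp add: AE_open_interval_iff)
  have l0: "(?g \<longlongrightarrow> ?g 0) (at_right 0)"
    by (rule continuous_on_Icc_at_rightD[OF gc]) simp
  have l1: "(?g \<longlongrightarrow> ?g 1) (at_left 1)"
    by (rule continuous_on_Icc_at_leftD[OF gc]) simp
  have eq: "f u = ?g u" if f: "continuous_on {0<..<1} f" "AE u in lebesgue_on {0<..<1}. f u = \<phi> u"
    and u: "u \<in> {0<..<1}" for f u
  proof -
    have "AE u in lebesgue_on {0<..<1}. f u - ?g u = 0" using f(2) gae by eventually_elim simp
    then have "AE u in lborel. u \<in> {0<..<1} \<longrightarrow> f u - ?g u = 0" by (simp add: AE_lebesgue_on_iff)
    \<comment> \<open>The set of disagreement is open and null, hence empty.\<close>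
    moreover define W where "W = {u \<in> {0<..<1}. f u - ?g u \<noteq> 0}"
    ultimately have "AE u in lebesgue. u \<notin> W" by (intro AE_completion) (auto elim: eventually_mono)
    then have "negligible W"
      by (simp add: completion.AE_iff_null_sets negligible_iff_null_sets)
    moreover have "open W"
    proof -
      have "open ({0<..<1} \<inter> (\<lambda>u. f u - ?g u) -` (- {0}))"
        by (rule continuous_open_preimage) (auto intro!: continuous_intros f(1) continuous_on_subset[OF continuous_on_primitive[OF D]])
      also have "({0<..<1} \<inter> (\<lambda>u. f u - ?g u) -` (- {0})) = W" by (auto simp: W_def)
      finally show ?thesis .
    qed
    ultimately have "W = {}" using open_not_negligible by blast
    then show ?thesis using u by (auto simp: W_def)
  qed
  have p0: "primitive D 0 = 0" by (rule primitive_0[OF D])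
  show "H1_at_0 \<phi> = a"
    unfolding H1_at_0_def
  proof (rule the_equality)
    show "\<exists>f. continuous_on {0<..<1} f \<and> (AE u in lebesgue_on {0<..<1}. f u = \<phi> u) \<and> (f \<longlongrightarrow> a) (at_right 0)"
      using g01 gae l0 p0 by (intro exI[of _ ?g]) auto
    fix l assume "\<exists>f. continuous_on {0<..<1} f \<and> (AE u in lebesgue_on {0<..<1}. f u = \<phi> u) \<and> (f \<longlongrightarrow> l) (at_right 0)"
    then obtain f where f: "continuous_on {0<..<1} f" "AE u in lebesgue_on {0<..<1}. f u = \<phi> u" "(f \<longlongrightarrow> l) (at_right 0)" by blast
    have "\<forall>\<^sub>F u in at_right 0. f u = ?g u"
      using eventually_at_right_real[of 0 1] eq[OF f(1,2)] by (auto elim!: eventually_mono)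
    then have "(?g \<longlongrightarrow> l) (at_right 0)" using f(3) by (rule Lim_transform_eventually[rotated])
    then show "l = a" using l0 p0 tendsto_unique[of "at_right (0::real)"] by fastforce
  qed
  show "H1_at_1 \<phi> = ?g 1"
    unfolding H1_at_1_def
  proof (rule the_equality)
    show "\<exists>f. continuous_on {0<..<1} f \<and> (AE u in lebesgue_on {0<..<1}. f u = \<phi> u) \<and> (f \<longlongrightarrow> ?g 1) (at_left 1)"
      using g01 gae l1 by (intro exI[of _ ?g]) auto
    fix l assume "\<exists>f. continuous_on {0<..<1} f \<and> (AE u in lebesgue_on {0<..<1}. f u = \<phi> u) \<and> (f \<longlongrightarrow> l) (at_left 1)"
    then obtain f where f: "continuous_on {0<..<1} f" "AE u in lebesgue_on {0<..<1}. f u = \<phi> u" "(f \<longlongrightarrow> l) (at_left 1)" by blast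
    have "\<forall>\<^sub>F u in at_left 1. f u = ?g u"
      using eventually_at_left_real[of 0 1] eq[OF f(1,2)] by (auto elim!: eventually_mono)
    then have "(?g \<longlongrightarrow> l) (at_left 1)" using f(3) by (rule Lim_transform_eventually[rotated])
    then show "l = ?g 1" using l1 tendsto_unique[of "at_left (1::real)"] by fastforce
  qed
qed

text \<open>
  Pointwise in time, the primitive is dominated by the integral of \<open>\<bar>D\<^sub>s\<bar>\<close>, which is integrable in \<open>s\<close>.
\<close>

lemma integrable_primitive_cylinder:
  fixes D :: "real \<Rightarrow> real \<Rightarrow> real"
  assumes B: "case_prod D \<in> borel_measurable borel" and D: "sq_integrable (lebesgue_on (cylinder T)) (case_prod D)"
  shows "integrable (lebesgue_on (cylinder T)) (\<lambda>(s, u). primitive (D s) u)"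
proof -
  have Di: "integrable (lebesgue_on (cylinder T)) (case_prod D)"
    by (rule sq_integrable_imp_integrable[OF finite_measure_cylinder D])
  have sec: "AE s in lebesgue_on {0..T}. integrable (lebesgue_on {0..1}) (D s)"
    using Fubini_cylinder(1)[OF Di] by simp
  have "integrable (lebesgue_on (cylinder T)) (\<lambda>z. \<bar>case_prod D z\<bar>)" using Di by simp
  from Fubini_cylinder(2)[OF this]
  have "integrable (lebesgue_on {0..T}) (\<lambda>s. LINT u|lebesgue_on {0..1}. \<bar>D s u\<bar>)" by simp
  then have dom: "integrable (lebesgue_on (cylinder T)) (\<lambda>z. LINT u|lebesgue_on {0..1}. \<bar>D (fst z) u\<bar>)"
    by (rule integrable_cylinder_fst)
  show ?thesis
  proof (rule Bochner_Integration.integrable_bound[OF dom])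
    have "(\<lambda>z. LINT v|lborel. (if v \<in> {0..1} \<and> v \<le> snd z then case_prod D (fst z, v) else 0))
        \<in> borel_measurable (borel :: (real \<times> real) measure)"
    proof -
      have DB: "case_prod D \<in> borel_measurable (borel \<Otimes>\<^sub>M borel)" unfolding borel_prod by (rule B)
      note [measurable] = DB
      have "(\<lambda>z. LINT v|lborel. (if v \<in> {0..1} \<and> v \<le> snd z then case_prod D (fst z, v) else 0))
        \<in> borel_measurable (borel \<Otimes>\<^sub>M (borel :: real measure))"
        by measurable
      then show ?thesis unfolding borel_prod .
    qed
    moreover have "(LINT v|lborel. (if v \<in> {0..1} \<and> v \<le> snd z then case_prod D (fst z, v) else 0))
        = primitive (D (fst z)) (snd z)" for z
    proof -
      have Dm: "D s \<in> borel_measurable borel" for s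
        using measurable_compose[OF _ B, of "\<lambda>u. (s, u)" borel] by simp
      have "(LINT v|lebesgue_on {0..1}. (if v \<in> {0..1} \<and> v \<le> snd z then D (fst z) v else 0))
        = (LINT v|lborel. (if v \<in> {0..1} \<and> v \<le> snd z then D (fst z) v else 0))"
        using Dm by (intro lebesgue_on_borel(2)) auto
      moreover have "(LINT v|lebesgue_on {0..1}. (if v \<in> {0..1} \<and> v \<le> snd z then D (fst z) v else 0)) = primitive (D (fst z)) (snd z)"
        unfolding primitive_def by (intro Bochner_Integration.integral_cong) auto
      ultimately show ?thesis by (simp cong: if_cong)
    qed
    ultimately show "(\<lambda>(s, u). primitive (D s) u) \<in> borel_measurable (lebesgue_on (cylinder T))"
      by (intro borel_imp_lebesgue_on) (simp add: case_prod_unfold)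
    show "AE z in lebesgue_on (cylinder T). norm (case z of (s, u) \<Rightarrow> primitive (D s) u)
        \<le> norm (LINT u|lebesgue_on {0..1}. \<bar>D (fst z) u\<bar>)"
      using AE_cylinder_fst[OF sec]
    proof eventually_elim
      case (elim z)
      have "\<bar>primitive (D (fst z)) (snd z)\<bar> \<le> (LINT u|lebesgue_on {0..1}. \<bar>D (fst z) u\<bar>)"
        unfolding primitive_def
        by (rule order_trans[OF integral_abs_bound integral_mono_AE])
          (use elim integrable_if_le[OF elim] in auto)
      then show ?case by (simp add: case_prod_unfold)
    qed
  qed
qed

section \<open>The norm of \<open>\<H>\<^sup>1\<close> and measurability into \<open>\<H>\<^sup>1\<close>\<close>

lemma sq_integrable_affine_primitive:
  assumes "sq_integrable (lebesgue_on {0..1}) D"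
  shows "sq_integrable (lebesgue_on {0..1}) (\<lambda>u. a + primitive D u)"
  by (intro sq_integrable_continuous continuous_intros continuous_on_primitive
      sq_integrable_imp_integrable[OF finite_measure_ivl] assms) auto

lemma affine_primitive_in_H1:
  assumes "sq_integrable (lebesgue_on {0..1}) D"
  shows "(\<lambda>u. a + primitive D u) \<in> H1"
proof -
  have D: "integrable (lebesgue_on {0..1}) D"
    using sq_integrable_imp_integrable[OF finite_measure_ivl assms] .
  have "is_weak_derivative (\<lambda>u. a + primitive D u) D"
    by (rule is_weak_derivative_primitive[OF D]) auto
  moreover have "sq_integrable (lebesgue_on {0<..<1}) D"
    unfolding sq_integrable_def
  proof
    show "D \<in> borel_measurable (lebesgue_on {0<..<1})"
      using assms by (intro measurable_open_interval) (simp add: sq_integrable_def)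
    show "integrable (lebesgue_on {0<..<1}) (\<lambda>x. (D x)\<^sup>2)"
      by (rule integrable_lebesgue_on_subset[of "{0..1}"]) (use assms in \<open>auto simp: sq_integrable_def\<close>)
  qed
  ultimately show ?thesis by (auto simp: H1_def is_weak_derivative_def)
qed

text \<open>
  The norm is defined through a chosen weak derivative; by uniqueness the choice agrees with \<open>D\<close> almost
  everywhere.
\<close>

lemma H1_norm_affine_primitive:
  assumes "sq_integrable (lebesgue_on {0..1}) D"
  shows "(H1_norm (\<lambda>u. a + primitive D u))\<^sup>2
    = (LINT u|lebesgue_on {0..1}. (a + primitive D u)\<^sup>2) + (LINT u|lebesgue_on {0..1}. (D u)\<^sup>2)"
proof -
  let ?\<phi> = "\<lambda>u. a + primitive D u"
  have D: "integrable (lebesgue_on {0..1}) D"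
    using sq_integrable_imp_integrable[OF finite_measure_ivl assms] .
  have w: "is_weak_derivative ?\<phi> D"
    by (rule is_weak_derivative_primitive[OF D]) auto
  then have "is_weak_derivative ?\<phi> (weak_derivative ?\<phi>)"
    unfolding weak_derivative_def by (rule someI[of "is_weak_derivative ?\<phi>"])
  from weak_derivative_unique[OF w this]
  have "AE u in lebesgue_on {0<..<1}. (D u)\<^sup>2 = (weak_derivative ?\<phi> u)\<^sup>2"
    by eventually_elim simp
  moreover have D2: "(\<lambda>u. (D u)\<^sup>2) \<in> borel_measurable (lebesgue_on {0..1})"
    using assms by (auto simp: sq_integrable_def)
  ultimately have "(LINT u|lebesgue_on {0<..<1}. (weak_derivative ?\<phi> u)\<^sup>2) = (LINT u|lebesgue_on {0..1}. (D u)\<^sup>2)"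
    using integral_lebesgue_on_AE[OF measurable_open_interval[OF D2]] integral_open_interval[OF D2] by simp
  moreover have "(LINT u|lebesgue_on {0<..<1}. (?\<phi> u)\<^sup>2) = (LINT u|lebesgue_on {0..1}. (?\<phi> u)\<^sup>2)"
    using sq_integrable_affine_primitive[OF assms] by (intro integral_open_interval) (auto simp: sq_integrable_def)
  moreover have "0 \<le> (LINT u|lebesgue_on {0..1}. (?\<phi> u)\<^sup>2)" "0 \<le> (LINT u|lebesgue_on {0..1}. (D u)\<^sup>2)"
    by (rule Bochner_Integration.integral_nonneg; simp)+
  ultimately show ?thesis by (simp add: H1_norm_def)
qed

text \<open>
  The map \<open>(a, D) \<mapsto> a + \<integral> D\<close> from \<open>\<real> \<times> L\<^sup>2\<close> to \<open>\<H>\<^sup>1\<close> is Lipschitz.  This moves questions about open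
  subsets of \<open>\<H>\<^sup>1\<close> to \<open>\<real> \<times> L\<^sup>2\<close>, where distances are integrals that depend measurably on time.
\<close>

lemma H1_norm_diff_le:
  assumes D: "sq_integrable (lebesgue_on {0..1}) D" and E: "sq_integrable (lebesgue_on {0..1}) E"
  shows "(H1_norm (\<lambda>u. (a + primitive D u) - (b + primitive E u)))\<^sup>2
    \<le> 3 * ((a - b)\<^sup>2 + (LINT u|lebesgue_on {0..1}. (D u - E u)\<^sup>2))"
proof -
  let ?I = "LINT u|lebesgue_on {0..1}. (D u - E u)\<^sup>2"
  have d: "sq_integrable (lebesgue_on {0..1}) (\<lambda>u. D u - E u)" by (rule sq_integrable_diff[OF D E])
  have eq: "(\<lambda>u. (a + primitive D u) - (b + primitive E u)) = (\<lambda>u. (a - b) + primitive (\<lambda>u. D u - E u) u)"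
    by (subst primitive_diff) (auto intro!: sq_integrable_imp_integrable[OF finite_measure_ivl] D E)
  have "(LINT u|lebesgue_on {0..1}. ((a - b) + primitive (\<lambda>u. D u - E u) u)\<^sup>2)
      \<le> (LINT u|lebesgue_on {0..1::real}. 2 * (a - b)\<^sup>2 + 2 * ?I)"
  proof (rule integral_mono_AE)
    show "AE u in lebesgue_on {0..1}. ((a - b) + primitive (\<lambda>u. D u - E u) u)\<^sup>2 \<le> 2 * (a - b)\<^sup>2 + 2 * ?I"
    proof (rule AE_I2)
      fix u
      from square_add_le[of "a - b" "primitive (\<lambda>u. D u - E u) u"] primitive_square_le[OF d, of u]
      show "((a - b) + primitive (\<lambda>u. D u - E u) u)\<^sup>2 \<le> 2 * (a - b)\<^sup>2 + 2 * ?I" by linarith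
    qed
  qed (use sq_integrable_affine_primitive[OF d] in \<open>auto simp: sq_integrable_def\<close>)
  also have "\<dots> = 2 * (a - b)\<^sup>2 + 2 * ?I"
    by (simp add: measure_restrict_space)
  finally have *: "(LINT u|lebesgue_on {0..1}. ((a - b) + primitive (\<lambda>u. D u - E u) u)\<^sup>2) \<le> 2 * (a - b)\<^sup>2 + 2 * ?I" .
  have "L + I \<le> 3 * (x + I)" if "L \<le> 2 * x + 2 * I" "0 \<le> x" for L x I :: real using that by argo
  from this[OF * zero_le_power2] show ?thesis
    unfolding eq H1_norm_affine_primitive[OF d] .
qed

text \<open>
  The functions \<open>E n\<close> provide a countable family in whose closure almost every section \<open>D\<^sub>s\<close> lies.
  Together with rational constants \<open>q\<close> they are the centres of countably many balls in \<open>\<real> \<times> L\<^sup>2\<close>.  An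
  open set of \<open>\<H>\<^sup>1\<close> pulls back, up to a null set of times, to the union of the sublevel sets
  \<open>{s. \<rho> n q s < r}\<close> over those balls that are mapped into it.
\<close>

lemma in_L2_H1_primitive:
  fixes D F :: "real \<Rightarrow> real \<Rightarrow> real" and E :: "nat \<Rightarrow> real \<Rightarrow> real"
  assumes a: "a \<in> borel_measurable (lebesgue_on {0..T})"
    and D: "sq_integrable (lebesgue_on (cylinder T)) (\<lambda>(s, u). D s u)"
    and F: "sq_integrable (lebesgue_on (cylinder T)) (\<lambda>(s, u). F s u)"
    and FD: "AE s in lebesgue_on {0..T}. AE u in lebesgue_on {0..1}. F s u = a s + primitive (D s) u"
    and E: "\<And>n. continuous_on {0..1} (E n)"
    and dense: "AE s in lebesgue_on {0..T}. \<forall>e>0. \<exists>n. (LINT u|lebesgue_on {0..1}. (D s u - E n u)\<^sup>2) < e"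
  shows "in_L2_H1 T F"
proof -
  define good where "good s \<longleftrightarrow> sq_integrable (lebesgue_on {0..1}) (D s) \<and>
     (\<forall>e>0. \<exists>n. (LINT u|lebesgue_on {0..1}. (D s u - E n u)\<^sup>2) < e)" for s
  have good: "AE s in lebesgue_on {0..T}. good s"
    using sq_integrable_sections[OF D] dense by eventually_elim (simp add: good_def)
  \<comment> \<open>The exceptional times receive the zero function, which lies in \<open>\<H>\<^sup>1\<close>.\<close>
  define \<zeta> where "\<zeta> s = (if good s then (\<lambda>u. a s + primitive (D s) u) else (\<lambda>u. 0 + primitive (\<lambda>_. 0) u))" for s
  have sq0: "sq_integrable (lebesgue_on {0..1}) (\<lambda>_. 0)" by (simp add: sq_integrable_def)
  have Esq: "sq_integrable (lebesgue_on {0..1}) (E n)" for n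
    by (rule sq_integrable_continuous[OF E]) simp
  have ECsq: "sq_integrable (lebesgue_on (cylinder T)) (\<lambda>(s, u). E n u)" for n
  proof (rule sq_integrable_continuous)
    have "continuous_on (cylinder T) (\<lambda>z. E n (snd z))"
      by (rule continuous_on_compose2[OF E]) (auto intro!: continuous_intros)
    then show "continuous_on (cylinder T) (\<lambda>(s, u). E n u)" by (simp add: case_prod_unfold)
  qed (intro compact_Times compact_Icc)
  have \<zeta>H1: "\<zeta> s \<in> H1" for s
  proof (cases "good s")
    case True
    then show ?thesis using affine_primitive_in_H1[of "D s"] by (simp add: \<zeta>_def good_def)
  next
    case False
    then show ?thesis using affine_primitive_in_H1[OF sq0, of 0] by (simp only: \<zeta>_def if_False)
  qed
  have meas: "\<zeta> \<in> measurable (lebesgue_on {0..T}) H1_borel"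
    unfolding H1_borel_def
  proof (rule measurable_measure_of)
    show "{U. H1_open U} \<subseteq> Pow H1" by (auto simp: H1_open_def)
    show "\<zeta> \<in> space (lebesgue_on {0..T}) \<rightarrow> H1" using \<zeta>H1 by auto
    fix U assume "U \<in> {U. H1_open U}"
    then have U: "H1_open U" by simp
    define \<rho> where "\<rho> n q s = (a s - q)\<^sup>2 + (LINT u|lebesgue_on {0..1}. (D s u - E n u)\<^sup>2)" for n q s
    \<comment> \<open>The balls of rational radius \<open>r\<close> around \<open>(q, E n)\<close> that are mapped into \<open>U\<close>.\<close>
    define J where "J = {(n, q, r). q \<in> \<rat> \<and> r \<in> \<rat> \<and> (\<forall>b D'. sq_integrable (lebesgue_on {0..1}) D' \<longrightarrow>
       (b - q)\<^sup>2 + (LINT u|lebesgue_on {0..1}. (D' u - E n u)\<^sup>2) < r \<longrightarrow> (\<lambda>u. b + primitive D' u) \<in> U)}"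
    define Y where "Y = (\<Union>(n, q, r)\<in>J. {s \<in> {0..T}. \<rho> n q s < r})"
    have "countable J"
    proof (rule countable_subset)
      show "J \<subseteq> UNIV \<times> \<rat> \<times> \<rat>" by (auto simp: J_def)
    qed (intro countable_SIGMA countable_rat countableI_type)
    have \<rho>m: "\<rho> n q \<in> borel_measurable (lebesgue_on {0..T})" for n q
    proof -
      have "sq_integrable (lebesgue_on (cylinder T)) (\<lambda>z. (\<lambda>(s, u). D s u) z - (\<lambda>(s, u). E n u) z)"
        by (rule sq_integrable_diff[OF D ECsq])
      then have "integrable (lebesgue_on (cylinder T)) (\<lambda>(s, u). (D s u - E n u)\<^sup>2)"
        by (simp add: sq_integrable_def case_prod_unfold)
      from Fubini_cylinder(2)[OF this]
      have "(\<lambda>s. LINT u|lebesgue_on {0..1}. (D s u - E n u)\<^sup>2) \<in> borel_measurable (lebesgue_on {0..T})" by auto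
      then show ?thesis unfolding \<rho>_def using a by measurable
    qed
    have "Y \<in> sets (lebesgue_on {0..T})"
      unfolding Y_def
    proof (rule sets.countable_UN''[OF \<open>countable J\<close>])
      fix i assume "i \<in> J"
      obtain n q r where i: "i = (n, q, r)" by (cases i)
      have "{s \<in> space (lebesgue_on {0..T}). \<rho> n q s < r} \<in> sets (lebesgue_on {0..T})"
        using \<rho>m[of n q] by measurable
      then show "(case i of (n, q, r) \<Rightarrow> {s \<in> {0..T}. \<rho> n q s < r}) \<in> sets (lebesgue_on {0..T})"
        by (simp add: i)
    qed
    moreover have "AE s in lebesgue_on {0..T}. s \<in> Y \<longleftrightarrow> s \<in> \<zeta> -` U \<inter> {0..T}"
      using good AE_space
    proof eventually_elim
      case (elim s)
      then have gs: "sq_integrable (lebesgue_on {0..1}) (D s)" "\<And>e. e > 0 \<Longrightarrow> \<exists>n. (LINT u|lebesgue_on {0..1}. (D s u - E n u)\<^sup>2) < e"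
        and \<zeta>s: "\<zeta> s = (\<lambda>u. a s + primitive (D s) u)" and s: "s \<in> {0..T}"
        by (auto simp: good_def \<zeta>_def)
      show ?case
      proof
        assume "s \<in> Y"
        then obtain n q r where "(n, q, r) \<in> J" "\<rho> n q s < r" by (auto simp: Y_def)
        then have "\<zeta> s \<in> U" using gs(1) by (auto simp: J_def \<rho>_def \<zeta>s)
        then show "s \<in> \<zeta> -` U \<inter> {0..T}" using s by simp
      next
        assume "s \<in> \<zeta> -` U \<inter> {0..T}"
        then have "\<zeta> s \<in> U" by simp
        then obtain e where e: "e > 0" and eU: "\<And>\<psi>. \<psi> \<in> H1 \<Longrightarrow> H1_norm (\<lambda>u. \<psi> u - \<zeta> s u) < e \<Longrightarrow> \<psi> \<in> U"
          using U unfolding H1_open_def by blast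
        \<comment> \<open>The factor \<open>12\<close> is \<open>3\<close> from the Lipschitz bound times \<open>2 r + 2 r\<close> from two steps of the relaxed triangle inequality.\<close>
        obtain r where r: "r \<in> \<rat>" "0 < r" "r < e\<^sup>2 / 12"
          using Rats_dense_in_real[of 0 "e\<^sup>2 / 12"] e by auto
        obtain q where q: "q \<in> \<rat>" "a s < q" "q < a s + sqrt (r / 2)"
          using Rats_dense_in_real[of "a s" "a s + sqrt (r / 2)"] r by auto
        obtain n where n: "(LINT u|lebesgue_on {0..1}. (D s u - E n u)\<^sup>2) < r / 2"
          using gs(2)[of "r / 2"] r by auto
        have "(q - a s)\<^sup>2 < (sqrt (r / 2))\<^sup>2"
          using q by (intro power_strict_mono) auto
        then have "(a s - q)\<^sup>2 < r / 2" using r by (simp add: power2_commute)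
        then have \<rho>r: "\<rho> n q s < r" using n by (simp add: \<rho>_def)
        have "(\<lambda>u. b + primitive D' u) \<in> U"
          if D': "sq_integrable (lebesgue_on {0..1}) D'"
            and lt: "(b - q)\<^sup>2 + (LINT u|lebesgue_on {0..1}. (D' u - E n u)\<^sup>2) < r" for b D'
        proof (rule eU)
          show "(\<lambda>u. b + primitive D' u) \<in> H1" by (rule affine_primitive_in_H1[OF D'])
          have "(LINT u|lebesgue_on {0..1}. (D' u - D s u)\<^sup>2)
             \<le> 2 * (LINT u|lebesgue_on {0..1}. (D' u - E n u)\<^sup>2) + 2 * (LINT u|lebesgue_on {0..1}. (E n u - D s u)\<^sup>2)"
            by (rule L2_dist_le[OF D' Esq gs(1)])
          moreover have "(b - a s)\<^sup>2 \<le> 2 * (b - q)\<^sup>2 + 2 * (a s - q)\<^sup>2"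
          proof -
            from square_add_le[of "b - q" "q - a s"] show ?thesis by (simp add: power2_commute)
          qed
          moreover have "(H1_norm (\<lambda>u. (b + primitive D' u) - \<zeta> s u))\<^sup>2
             \<le> 3 * ((b - a s)\<^sup>2 + (LINT u|lebesgue_on {0..1}. (D' u - D s u)\<^sup>2))"
            unfolding \<zeta>s by (rule H1_norm_diff_le[OF D' gs(1)])
          moreover have "(LINT u|lebesgue_on {0..1}. (E n u - D s u)\<^sup>2) = (LINT u|lebesgue_on {0..1}. (D s u - E n u)\<^sup>2)"
            by (simp add: power2_commute)
          ultimately have "(H1_norm (\<lambda>u. (b + primitive D' u) - \<zeta> s u))\<^sup>2 \<le> 12 * r"
            using lt \<rho>r unfolding \<rho>_def by argo
          also have "\<dots> < e\<^sup>2" using r by simp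
          finally show "H1_norm (\<lambda>u. (b + primitive D' u) - \<zeta> s u) < e"
            using e by (simp add: power2_less_imp_less)
        qed
        then have "(n, q, r) \<in> J" using q r by (simp add: J_def)
        then show "s \<in> Y" using \<rho>r s by (auto simp: Y_def)
      qed
    qed
    ultimately have "\<zeta> -` U \<inter> {0..T} \<in> sets (lebesgue_on {0..T})"
      by (intro sets_lebesgue_on_AE[of Y "{0..T}" "\<zeta> -` U \<inter> {0..T}"]) simp_all
    then show "\<zeta> -` U \<inter> space (lebesgue_on {0..T}) \<in> sets (lebesgue_on {0..T})" by simp
  qed
  have "integrable (lebesgue_on {0..T}) (\<lambda>t. (H1_norm (\<zeta> t))\<^sup>2)"
  proof (rule integrable_lebesgue_on_AE)
    have "integrable (lebesgue_on {0..T}) (\<lambda>t. LINT u|lebesgue_on {0..1}. (G t u)\<^sup>2)"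
      if "sq_integrable (lebesgue_on (cylinder T)) (\<lambda>(s, u). G s u)" for G :: "real \<Rightarrow> real \<Rightarrow> real"
      using Fubini_cylinder(2)[of T "\<lambda>(s, u). (G s u)\<^sup>2"] that
      by (simp add: sq_integrable_def case_prod_unfold)
    from this[OF F] this[OF D]
    show "integrable (lebesgue_on {0..T}) (\<lambda>t. (LINT u|lebesgue_on {0..1}. (F t u)\<^sup>2) + (LINT u|lebesgue_on {0..1}. (D t u)\<^sup>2))"
      by simp
    show "AE t in lebesgue_on {0..T}. (LINT u|lebesgue_on {0..1}. (F t u)\<^sup>2) + (LINT u|lebesgue_on {0..1}. (D t u)\<^sup>2) = (H1_norm (\<zeta> t))\<^sup>2"
      using good FD sq_integrable_sections[OF F]
    proof eventually_elim
      case (elim t)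
      have Dt: "sq_integrable (lebesgue_on {0..1}) (D t)" and \<zeta>t: "\<zeta> t = (\<lambda>u. a t + primitive (D t) u)"
        using elim(1) by (auto simp: good_def \<zeta>_def)
      have "AE u in lebesgue_on {0..1}. (F t u)\<^sup>2 = (a t + primitive (D t) u)\<^sup>2"
        using elim(2) by eventually_elim simp
      then have "(LINT u|lebesgue_on {0..1}. (F t u)\<^sup>2) = (LINT u|lebesgue_on {0..1}. (a t + primitive (D t) u)\<^sup>2)"
        using elim(3) by (intro integral_lebesgue_on_AE) (auto simp: sq_integrable_def)
      then show ?case by (simp add: \<zeta>t H1_norm_affine_primitive[OF Dt])
    qed
  qed simp
  then have "\<zeta> \<in> L2_H1 T" using meas by (simp add: L2_H1_def)
  moreover have "AE s in lebesgue_on {0..T}. AE u in lebesgue_on {0<..<1}. F s u = \<zeta> s u"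
    using FD good by eventually_elim (simp add: AE_open_interval_iff \<zeta>_def)
  ultimately show ?thesis unfolding in_L2_H1_def by blast
qed

text \<open>
  A subsequence of the approximating functions converges in \<open>L\<^sup>2(0,1)\<close> at almost every fixed time.  Their
  sections at rational times form the countable family: by uniform continuity, the section at any time
  is a uniform limit of sections at rational times.
\<close>

lemma sections_in_closure_of_countable_family:
  fixes D :: "real \<Rightarrow> real \<Rightarrow> real" and h :: "nat \<Rightarrow> real \<Rightarrow> real \<Rightarrow> real"
  assumes T: "T > 0" and D: "sq_integrable (lebesgue_on (cylinder T)) (case_prod D)"
    and h: "\<And>n. continuous_on (cylinder T) (case_prod (h n))"
    and lim: "(\<lambda>n. LINT z|lebesgue_on (cylinder T). (case_prod (h n) z - case_prod D z)\<^sup>2) \<longlonglongrightarrow> 0"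
  shows "\<exists>E :: nat \<Rightarrow> real \<Rightarrow> real. (\<forall>i. continuous_on {0..1} (E i)) \<and>
    (AE s in lebesgue_on {0..T}. \<forall>e>0. \<exists>i. (LINT u|lebesgue_on {0..1}. (D s u - E i u)\<^sup>2) < e)"
proof -
  let ?I = "lebesgue_on {0..T}"
  \<comment> \<open>An enumeration of the rational numbers, projected to the time interval.\<close>
  define t where "t k = max 0 (min T (of_rat (from_nat k)))" for k :: nat
  have t: "t k \<in> {0..T}" for k using T by (auto simp: t_def)
  define E where "E i = h (fst (prod_decode i)) (t (snd (prod_decode i)))" for i
  have hs: "continuous_on {0..1} (h n s)" if "s \<in> {0..T}" for n s
  proof -
    have "continuous_on {0..1} (\<lambda>u. case_prod (h n) (s, u))"
      by (rule continuous_on_compose2[OF h]) (use that in \<open>auto intro!: continuous_intros\<close>)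
    then show ?thesis by simp
  qed
  have hsq: "sq_integrable (lebesgue_on {0..1}) (h n s)" if "s \<in> {0..T}" for n s
    by (rule sq_integrable_continuous[OF hs[OF that]]) simp
  have d: "integrable (lebesgue_on (cylinder T)) (\<lambda>z. (case_prod (h n) z - case_prod D z)\<^sup>2)" for n
    using sq_integrable_diff[OF sq_integrable_continuous[OF h compact_cylinder] D] by (simp add: sq_integrable_def)
  have dn: "norm (LINT u|lebesgue_on {0..1}. (h n s u - D s u)\<^sup>2) = (LINT u|lebesgue_on {0..1}. (h n s u - D s u)\<^sup>2)" for n s
    using Bochner_Integration.integral_nonneg[of "lebesgue_on {0..1}" "\<lambda>u. (h n s u - D s u)\<^sup>2"] by simp
  have "(\<lambda>n. LINT s|?I. norm (LINT u|lebesgue_on {0..1}. (h n s u - D s u)\<^sup>2)) \<longlonglongrightarrow> 0"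
    using lim Fubini_cylinder(3)[OF d] by (simp only: dn prod.case)
  moreover have "integrable ?I (\<lambda>s. LINT u|lebesgue_on {0..1}. (h n s u - D s u)\<^sup>2)" for n
    using Fubini_cylinder(2)[OF d] by simp
  ultimately obtain r :: "nat \<Rightarrow> nat" where r: "AE s in ?I. (\<lambda>n. LINT u|lebesgue_on {0..1}. (h (r n) s u - D s u)\<^sup>2) \<longlonglongrightarrow> 0"
    using tendsto_L1_AE_subseq[of ?I "\<lambda>n s. LINT u|lebesgue_on {0..1}. (h n s u - D s u)\<^sup>2"] by blast
  have Ds: "AE s in ?I. sq_integrable (lebesgue_on {0..1}) (D s)"
    by (rule sq_integrable_sections[OF D])
  have "AE s in ?I. \<forall>e>0. \<exists>i. (LINT u|lebesgue_on {0..1}. (D s u - E i u)\<^sup>2) < e"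
    using r Ds AE_space
  proof eventually_elim
    case (elim s)
    then have s: "s \<in> {0..T}" by simp
    show ?case
    proof (intro allI impI)
      fix e :: real assume e: "e > 0"
      have "\<forall>\<^sub>F n in sequentially. (LINT u|lebesgue_on {0..1}. (h (r n) s u - D s u)\<^sup>2) < e / 4"
        using order_tendstoD(2)[OF elim(1), of "e / 4"] e by simp
      then obtain n where n: "(LINT u|lebesgue_on {0..1}. (h (r n) s u - D s u)\<^sup>2) < e / 4"
        using eventually_happens by fastforce
      have "uniformly_continuous_on (cylinder T) (case_prod (h (r n)))"
        by (rule compact_uniformly_continuous[OF h compact_cylinder])
      then obtain \<delta> where \<delta>: "\<delta> > 0" and uc: "\<And>z z'. z \<in> cylinder T \<Longrightarrow> z' \<in> cylinder T \<Longrightarrow> dist z' z < \<delta>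
          \<Longrightarrow> dist (case_prod (h (r n)) z') (case_prod (h (r n)) z) < sqrt (e / 8)"
        unfolding uniformly_continuous_on_def using e by (metis half_gt_zero_iff real_sqrt_gt_0_iff zero_less_divide_iff zero_less_numeral)
      obtain q :: real where q: "q \<in> \<rat>" "s - \<delta> < q" "q < s + \<delta>"
        using Rats_dense_in_real[of "s - \<delta>" "s + \<delta>"] \<delta> by auto
      then obtain p :: rat where p: "q = of_rat p" by (auto elim: Rats_cases)
      define k where "k = to_nat p"
      have tk: "\<bar>t k - s\<bar> < \<delta>" using q s p by (auto simp: t_def k_def)
      have close: "(h (r n) s u - h (r n) (t k) u)\<^sup>2 \<le> e / 8" if "u \<in> {0..1}" for u
      proof -
        have "dist (t k, u) (s, u) < \<delta>" using tk by (simp add: dist_Pair_Pair dist_real_def)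
        then have "\<bar>h (r n) (t k) u - h (r n) s u\<bar> < sqrt (e / 8)"
          using uc[of "(s, u)" "(t k, u)"] s t[of k] that by (simp add: dist_real_def)
        then have "\<bar>h (r n) (t k) u - h (r n) s u\<bar>\<^sup>2 \<le> (sqrt (e / 8))\<^sup>2"
          by (intro power_mono) auto
        then show ?thesis using e by (simp add: power2_commute)
      qed
      have "(LINT u|lebesgue_on {0..1}. (h (r n) s u - h (r n) (t k) u)\<^sup>2) \<le> (LINT u|lebesgue_on {0..1::real}. e / 8)"
      proof (rule integral_mono_AE)
        show "AE u in lebesgue_on {0..1}. (h (r n) s u - h (r n) (t k) u)\<^sup>2 \<le> e / 8"
          by (intro AE_I2 close) simp
        show "integrable (lebesgue_on {0..1}) (\<lambda>u. (h (r n) s u - h (r n) (t k) u)\<^sup>2)"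
          using sq_integrable_diff[OF hsq[OF s] hsq[OF t]] by (simp add: sq_integrable_def)
      qed simp
      also have "\<dots> = e / 8" by (simp add: measure_restrict_space)
      finally have "(LINT u|lebesgue_on {0..1}. (h (r n) s u - h (r n) (t k) u)\<^sup>2) \<le> e / 8" .
      moreover have "(LINT u|lebesgue_on {0..1}. (D s u - h (r n) (t k) u)\<^sup>2)
          \<le> 2 * (LINT u|lebesgue_on {0..1}. (D s u - h (r n) s u)\<^sup>2) + 2 * (LINT u|lebesgue_on {0..1}. (h (r n) s u - h (r n) (t k) u)\<^sup>2)"
        by (rule L2_dist_le[OF elim(2) hsq[OF s] hsq[OF t]])
      moreover have "(LINT u|lebesgue_on {0..1}. (D s u - h (r n) s u)\<^sup>2) = (LINT u|lebesgue_on {0..1}. (h (r n) s u - D s u)\<^sup>2)"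
        by (simp add: power2_commute)
      ultimately have "(LINT u|lebesgue_on {0..1}. (D s u - h (r n) (t k) u)\<^sup>2) < e"
        using n e by argo
      then have "(LINT u|lebesgue_on {0..1}. (D s u - E (prod_encode (r n, k)) u)\<^sup>2) < e"
        by (simp add: E_def)
      then show "\<exists>i. (LINT u|lebesgue_on {0..1}. (D s u - E i u)\<^sup>2) < e" by blast
    qed
  qed
  moreover have "\<forall>i. continuous_on {0..1} (E i)" using hs[OF t] by (simp add: E_def)
  ultimately show ?thesis by blast
qed

section \<open>Continuously differentiable test functions\<close>

lemma C01_continuous:
  assumes "H \<in> C01 T"
  shows "continuous_on (cylinder T) (case_prod H)" and "continuous_on (cylinder T) (case_prod (space_deriv H))"
  using assms by (simp_all add: C01_def)

lemma C01_has_derivative: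
  assumes "H \<in> C01 T" "s \<in> {0..T}" "u \<in> {0..1}"
  shows "(H s has_vector_derivative space_deriv H s u) (at u within {0..1})"
proof -
  have "H s differentiable (at u within {0..1})"
    using assms unfolding C01_def differentiable_on_def by blast
  then show ?thesis unfolding space_deriv_def by (simp add: vector_derivative_works)
qed

lemma space_deriv_eqI:
  assumes "(H s has_vector_derivative k) (at u within {0..1})" "u \<in> {0..1}"
  shows "space_deriv H s u = k"
  unfolding space_deriv_def
  using vector_derivative_within_cbox[of 0 1 u "H s" k] assms by simp

lemma C01I:
  assumes H: "continuous_on (cylinder T) (case_prod H)" and K: "continuous_on (cylinder T) (case_prod K)"
    and der: "\<And>s u. s \<in> {0..T} \<Longrightarrow> u \<in> {0..1} \<Longrightarrow> (H s has_vector_derivative K s u) (at u within {0..1})"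
  shows "H \<in> C01 T"
proof -
  have "continuous_on (cylinder T) (case_prod (space_deriv H))"
    by (subst continuous_on_cong[OF refl, of _ _ "case_prod K"])
      (use K space_deriv_eqI[OF der] in auto)
  moreover have "\<forall>s\<in>{0..T}. H s differentiable_on {0..1}"
    unfolding differentiable_on_def
    using der differentiableI_vector by blast
  ultimately show ?thesis using H by (simp add: C01_def)
qed

lemma C01_combination:
  assumes "G \<in> C01 T" "H \<in> C01 T"
  shows "(\<lambda>s u. G s u + t * H s u) \<in> C01 T"
    and "s \<in> {0..T} \<Longrightarrow> u \<in> {0..1} \<Longrightarrow>
      space_deriv (\<lambda>s u. G s u + t * H s u) s u = space_deriv G s u + t * space_deriv H s u"
proof -
  have der: "((\<lambda>u. G s u + t * H s u) has_vector_derivative space_deriv G s u + t * space_deriv H s u) (at u within {0..1})"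
    if "s \<in> {0..T}" "u \<in> {0..1}" for s u
    by (intro has_vector_derivative_add has_vector_derivative_mult_right
        C01_has_derivative[OF assms(1) that] C01_has_derivative[OF assms(2) that])
  have c: "continuous_on (cylinder T) (\<lambda>z. case_prod G z + t * case_prod H z)"
    "continuous_on (cylinder T) (\<lambda>z. case_prod (space_deriv G) z + t * case_prod (space_deriv H) z)"
    by (intro continuous_intros C01_continuous assms)+
  show "(\<lambda>s u. G s u + t * H s u) \<in> C01 T"
    by (rule C01I[where K="\<lambda>s u. space_deriv G s u + t * space_deriv H s u"])
      (use c der in \<open>auto simp: case_prod_unfold\<close>)
  show "s \<in> {0..T} \<Longrightarrow> u \<in> {0..1} \<Longrightarrow>
      space_deriv (\<lambda>s u. G s u + t * H s u) s u = space_deriv G s u + t * space_deriv H s u"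
    by (intro space_deriv_eqI der)
qed

lemma C01_const_in_space:
  assumes "continuous_on {0..T} h"
  shows "(\<lambda>s u. h s) \<in> C01 T" and "u \<in> {0..1} \<Longrightarrow> space_deriv (\<lambda>s u. h s) s u = 0"
proof -
  have "continuous_on (cylinder T) (\<lambda>z. h (fst z))"
    by (rule continuous_on_compose2[OF assms]) (auto intro!: continuous_intros)
  then show "(\<lambda>s u. h s) \<in> C01 T"
    by (intro C01I[where K="\<lambda>_ _. 0"]) (auto simp: case_prod_unfold)
  show "u \<in> {0..1} \<Longrightarrow> space_deriv (\<lambda>s u. h s) s u = 0"
    by (rule space_deriv_eqI) auto
qed

text \<open>
  Every continuous function on the cylinder is the space derivative of an admissible test function.
\<close>

lemma C01_antiderivative:
  fixes K :: "real \<Rightarrow> real \<Rightarrow> real"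
  assumes K: "continuous_on UNIV (case_prod K)"
  shows "(\<lambda>s u. integral {0..u} (K s)) \<in> C01 T"
    and "u \<in> {0..1} \<Longrightarrow> space_deriv (\<lambda>s u. integral {0..u} (K s)) s u = K s u"
proof -
  have Ks: "continuous_on A (K s)" for s A
  proof -
    have "continuous_on A (\<lambda>u. case_prod K (s, u))"
      by (rule continuous_on_compose2[OF K]) (auto intro!: continuous_intros)
    then show ?thesis by simp
  qed
  have der: "((\<lambda>u. integral {0..u} (K s)) has_vector_derivative K s u) (at u within {0..1})"
    if "u \<in> {0..1}" for s u
    by (rule integral_has_vector_derivative[OF Ks that])
  \<comment> \<open>Rescaling to a fixed interval makes the joint continuity in both variables visible.\<close>
  have scale: "integral {0..u} (K s) = u * integral {0..1} (\<lambda>t. K s (u * t))" if "u \<in> {0..1}" for s u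
  proof -
    have "((\<lambda>t. u *\<^sub>R K s (u * t)) has_integral (integral {u * 0..u * 1} (K s))) {0..1}"
    proof (rule has_integral_substitution)
      show "(\<lambda>t. u * t) ` {0..1} \<subseteq> {0..1}" using that by (auto simp: mult_le_one)
      show "((\<lambda>t. u * t) has_real_derivative u) (at t within {0..1})" for t
        by (auto intro!: derivative_eq_intros)
    qed (use that in \<open>auto intro: Ks\<close>)
    then have "integral {0..1} (\<lambda>t. u * K s (u * t)) = integral {0..u} (K s)"
      by (intro integral_unique) simp
    then show ?thesis by simp
  qed
  have "continuous_on (cylinder T) (\<lambda>z. integral (cbox 0 1) (\<lambda>t. K (fst z) (snd z * t)))"
  proof (rule integral_continuous_on_param)
    have "continuous_on (cylinder T \<times> cbox 0 1) (\<lambda>y. case_prod K (fst (fst y), snd (fst y) * snd y))"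
      by (rule continuous_on_compose2[OF K]) (auto intro!: continuous_intros)
    then show "continuous_on (cylinder T \<times> cbox 0 1) (\<lambda>(z, t). K (fst z) (snd z * t))"
      by (simp add: case_prod_unfold)
  qed
  then have "continuous_on (cylinder T) (\<lambda>z. snd z * integral {0..1} (\<lambda>t. K (fst z) (snd z * t)))"
    by (intro continuous_intros) auto
  then have "continuous_on (cylinder T) (case_prod (\<lambda>s u. integral {0..u} (K s)))"
    by (subst continuous_on_cong[OF refl]) (auto simp: scale)
  then show "(\<lambda>s u. integral {0..u} (K s)) \<in> C01 T"
    by (rule C01I[where K=K]) (auto intro: continuous_on_subset[OF K] der)
  show "u \<in> {0..1} \<Longrightarrow> space_deriv (\<lambda>s u. integral {0..u} (K s)) s u = K s u"
    by (intro space_deriv_eqI der)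
qed

section \<open>The weighted bilinear form\<close>

definition trace_L2 :: "real \<Rightarrow> (real \<Rightarrow> real \<Rightarrow> real) \<Rightarrow> bool" where
  "trace_L2 T G \<longleftrightarrow> sq_integrable (lebesgue_on (cylinder T)) (case_prod G) \<and>
     sq_integrable (lebesgue_on {0..T}) (\<lambda>s. G s 0) \<and> sq_integrable (lebesgue_on {0..T}) (\<lambda>s. G s 1)"

definition weighted_form ::
  "real \<Rightarrow> (real \<Rightarrow> real) \<Rightarrow> (real \<Rightarrow> real) \<Rightarrow> (real \<Rightarrow> real \<Rightarrow> real) \<Rightarrow> (real \<Rightarrow> real \<Rightarrow> real) \<Rightarrow> real" where
  "weighted_form T w0 w1 G H =
     (LINT z|lebesgue_on (cylinder T). case_prod G z * case_prod H z)
     + (LINT s|lebesgue_on {0..T}. w0 s * G s 0 * H s 0)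
     + (LINT s|lebesgue_on {0..T}. w1 s * G s 1 * H s 1)"

text \<open>
  The upper bound makes the boundary terms continuous on \<open>L\<^sup>2\<close>; the lower bound makes convergence in
  the weighted norm imply convergence of the boundary values in \<open>L\<^sup>2(0,T)\<close>.
\<close>

definition bounded_weight :: "real \<Rightarrow> (real \<Rightarrow> real) \<Rightarrow> bool" where
  "bounded_weight T w \<longleftrightarrow> w \<in> borel_measurable (lebesgue_on {0..T}) \<and>
     (\<exists>W. \<forall>s\<in>{0..T}. w s \<le> W) \<and> (\<exists>\<delta>>0. \<forall>s\<in>{0..T}. \<delta> \<le> w s)"

lemma trace_L2_C01:
  assumes "H \<in> C01 T" shows "trace_L2 T H"
proof -
  have "continuous_on {0..T} (\<lambda>s. H s u)" if "u \<in> {0..1}" for u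
  proof -
    have "continuous_on {0..T} (\<lambda>s. case_prod H (s, u))"
      by (rule continuous_on_compose2[OF C01_continuous(1)[OF assms]])
        (use that in \<open>auto intro!: continuous_intros\<close>)
    then show ?thesis by simp
  qed
  then show ?thesis
    unfolding trace_L2_def
    by (intro conjI sq_integrable_continuous C01_continuous[OF assms] compact_cylinder) auto
qed

lemma trace_L2_scale: "trace_L2 T G \<Longrightarrow> trace_L2 T (\<lambda>s u. k * G s u)"
proof -
  assume "trace_L2 T G"
  moreover have "(\<lambda>z. k * case_prod G z) = (\<lambda>(s, u). k * G s u)" by auto
  ultimately show ?thesis
    using sq_integrable_cmult unfolding trace_L2_def by metis
qed

lemma inner_L2_eq:
  assumes "integrable (lebesgue_on (cylinder T)) (\<lambda>z. case_prod G z * case_prod H z)"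
  shows "inner_L2 T G H = (LINT z|lebesgue_on (cylinder T). case_prod G z * case_prod H z)"
  using Fubini_lebesgue_on(3)[OF borel_closed[OF closed_atLeastAtMost] borel_closed[OF closed_atLeastAtMost] assms]
  by (simp add: inner_L2_def)

lemma bounded_weightD:
  assumes "bounded_weight T w"
  obtains W where "w \<in> borel_measurable (lebesgue_on {0..T})" "AE s in lebesgue_on {0..T}. \<bar>w s\<bar> \<le> W"
proof -
  obtain W \<delta> where "\<forall>s\<in>{0..T}. w s \<le> W" "\<delta> > 0" "\<forall>s\<in>{0..T}. \<delta> \<le> w s"
    using assms by (auto simp: bounded_weight_def)
  then have "\<bar>w s\<bar> \<le> W" if "s \<in> {0..T}" for s
    using that by (metis abs_of_pos less_le_trans)
  then have "AE s in lebesgue_on {0..T}. \<bar>w s\<bar> \<le> W"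
    by (intro AE_I2) simp
  then show ?thesis using assms that by (simp add: bounded_weight_def)
qed

lemma integrable_weighted:
  assumes "bounded_weight T w" "sq_integrable (lebesgue_on {0..T}) f" "sq_integrable (lebesgue_on {0..T}) g"
  shows "integrable (lebesgue_on {0..T}) (\<lambda>s. w s * f s * g s)"
  using bounded_weightD[OF assms(1)] sq_integrable_mult[OF sq_integrable_bounded_mult[OF _ _ assms(2)] assms(3)]
  by metis

lemma weighted_form_combination:
  assumes w: "bounded_weight T w0" "bounded_weight T w1" and G: "trace_L2 T G" and H: "trace_L2 T H"
  shows "weighted_form T w0 w1 (\<lambda>s u. G s u + t * H s u) (\<lambda>s u. G s u + t * H s u)
    = weighted_form T w0 w1 G G + 2 * t * weighted_form T w0 w1 G H + t\<^sup>2 * weighted_form T w0 w1 H H"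
proof -
  have expand: "(LINT x|M. w x * (f x + t * g x) * (f x + t * g x))
      = (LINT x|M. w x * f x * f x) + 2 * t * (LINT x|M. w x * f x * g x) + t\<^sup>2 * (LINT x|M. w x * g x * g x)"
    if "integrable M (\<lambda>x. w x * f x * f x)" "integrable M (\<lambda>x. w x * f x * g x)" "integrable M (\<lambda>x. w x * g x * g x)"
    for M :: "'c measure" and w f g :: "'c \<Rightarrow> real"
  proof -
    have "(LINT x|M. w x * (f x + t * g x) * (f x + t * g x))
      = (LINT x|M. w x * f x * f x + 2 * t * (w x * f x * g x) + t\<^sup>2 * (w x * g x * g x))"
      by (intro Bochner_Integration.integral_cong refl) (simp add: algebra_simps power2_eq_square)
    then show ?thesis using that by simp
  qed
  have sq: "sq_integrable (lebesgue_on (cylinder T)) (case_prod G)" "sq_integrable (lebesgue_on (cylinder T)) (case_prod H)"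
    "sq_integrable (lebesgue_on {0..T}) (\<lambda>s. G s 0)" "sq_integrable (lebesgue_on {0..T}) (\<lambda>s. G s 1)"
    "sq_integrable (lebesgue_on {0..T}) (\<lambda>s. H s 0)" "sq_integrable (lebesgue_on {0..T}) (\<lambda>s. H s 1)"
    using G H by (auto simp: trace_L2_def)
  have "(LINT z|lebesgue_on (cylinder T). (case z of (s, u) \<Rightarrow> G s u + t * H s u) * (case z of (s, u) \<Rightarrow> G s u + t * H s u))
    = (LINT z|lebesgue_on (cylinder T). 1 * (case_prod G z + t * case_prod H z) * (case_prod G z + t * case_prod H z))"
    by (intro Bochner_Integration.integral_cong refl) auto
  also have "\<dots> = (LINT z|lebesgue_on (cylinder T). case_prod G z * case_prod G z)
      + 2 * t * (LINT z|lebesgue_on (cylinder T). case_prod G z * case_prod H z)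
      + t\<^sup>2 * (LINT z|lebesgue_on (cylinder T). case_prod H z * case_prod H z)"
    by (subst expand) (use sq_integrable_mult sq in simp_all)
  finally have 1: "(LINT z|lebesgue_on (cylinder T). (case z of (s, u) \<Rightarrow> G s u + t * H s u) * (case z of (s, u) \<Rightarrow> G s u + t * H s u))
    = (LINT z|lebesgue_on (cylinder T). case_prod G z * case_prod G z)
      + 2 * t * (LINT z|lebesgue_on (cylinder T). case_prod G z * case_prod H z)
      + t\<^sup>2 * (LINT z|lebesgue_on (cylinder T). case_prod H z * case_prod H z)" .
  note 2 = expand[OF integrable_weighted[OF w(1) sq(3) sq(3)] integrable_weighted[OF w(1) sq(3) sq(5)]
      integrable_weighted[OF w(1) sq(5) sq(5)]]
  note 3 = expand[OF integrable_weighted[OF w(2) sq(4) sq(4)] integrable_weighted[OF w(2) sq(4) sq(6)]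
      integrable_weighted[OF w(2) sq(6) sq(6)]]
  show ?thesis unfolding weighted_form_def 1 2 3 by argo
qed

lemma weighted_form_scale_left:
  "weighted_form T w0 w1 (\<lambda>s u. k * G s u) H = k * weighted_form T w0 w1 G H"
proof -
  have "(LINT z|lebesgue_on (cylinder T). (case z of (s, u) \<Rightarrow> k * G s u) * case_prod H z)
    = (LINT z|lebesgue_on (cylinder T). k * (case_prod G z * case_prod H z))"
    by (intro Bochner_Integration.integral_cong refl) auto
  moreover have "(LINT s|lebesgue_on {0..T}. w s * (k * G s x) * H s x) = (LINT s|lebesgue_on {0..T}. k * (w s * G s x * H s x))" for w x
    by (intro Bochner_Integration.integral_cong refl) auto
  ultimately show ?thesis by (simp add: weighted_form_def algebra_simps)
qed

lemma weighted_form_scale_right: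
  "weighted_form T w0 w1 G (\<lambda>s u. k * H s u) = k * weighted_form T w0 w1 G H"
proof -
  have "(LINT z|lebesgue_on (cylinder T). case_prod G z * (case z of (s, u) \<Rightarrow> k * H s u))
    = (LINT z|lebesgue_on (cylinder T). k * (case_prod G z * case_prod H z))"
    by (intro Bochner_Integration.integral_cong refl) auto
  moreover have "(LINT s|lebesgue_on {0..T}. w s * G s x * (k * H s x)) = (LINT s|lebesgue_on {0..T}. k * (w s * G s x * H s x))" for w x
    by (intro Bochner_Integration.integral_cong refl) auto
  ultimately show ?thesis by (simp add: weighted_form_def algebra_simps)
qed

section \<open>Maximizing a concave quadratic functional\<close>

text \<open>
  If \<open>\<Lambda> - c B\<close> is within \<open>\<epsilon>\<close> of its supremum at \<open>f\<close> and at \<open>g\<close>, then comparison with the midpoint of \<open>f\<close>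
  and \<open>g\<close> bounds \<open>c B(f - g, f - g) / 4\<close> by \<open>\<epsilon>\<close>.
\<close>

lemma maximizing_sequence:
  fixes C :: "('a \<Rightarrow> 'b \<Rightarrow> real) set" and \<Lambda> B
  assumes C: "C \<noteq> {}" and comb: "\<And>f g t. f \<in> C \<Longrightarrow> g \<in> C \<Longrightarrow> (\<lambda>x y. f x y + t * g x y) \<in> C"
    and lin: "\<And>f g t. f \<in> C \<Longrightarrow> g \<in> C \<Longrightarrow> \<Lambda> (\<lambda>x y. f x y + t * g x y) = \<Lambda> f + t * \<Lambda> g"
    and quad: "\<And>f g t. f \<in> C \<Longrightarrow> g \<in> C \<Longrightarrow>
      B (\<lambda>x y. f x y + t * g x y) (\<lambda>x y. f x y + t * g x y) = B f f + 2 * t * B f g + t\<^sup>2 * B g g"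
    and c: "c > 0" and bdd: "\<And>f. f \<in> C \<Longrightarrow> \<Lambda> f - c * B f f \<le> (M0::real)"
  obtains S h where "\<And>n. h n \<in> C" "\<And>f. f \<in> C \<Longrightarrow> \<Lambda> f - c * B f f \<le> S"
    "(\<lambda>n. \<Lambda> (h n) - c * B (h n) (h n)) \<longlonglongrightarrow> S"
    "\<And>n k. B (\<lambda>x y. h n x y - h k x y) (\<lambda>x y. h n x y - h k x y) \<le> 2 / c * (1 / real (Suc n) + 1 / real (Suc k))"
proof -
  define J where "J f = \<Lambda> f - c * B f f" for f
  define S where "S = Sup (J ` C)"
  have bd: "bdd_above (J ` C)" using bdd by (auto simp: J_def bdd_above_def)
  have JS: "J f \<le> S" if "f \<in> C" for f unfolding S_def using that bd by (intro cSup_upper) auto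
  have "\<exists>f\<in>C. S - 1 / real (Suc n) < J f" for n
    using less_cSup_iff[of "J ` C" "S - 1 / real (Suc n)"] C bd by (auto simp: S_def)
  then obtain h where h: "\<And>n. h n \<in> C" "\<And>n. S - 1 / real (Suc n) < J (h n)" by metis
  have lim: "(\<lambda>n. J (h n)) \<longlonglongrightarrow> S"
  proof (rule tendsto_sandwich)
    show "(\<lambda>n. S - 1 / real (Suc n)) \<longlonglongrightarrow> S"
      using tendsto_diff[OF tendsto_const LIMSEQ_inverse_real_of_nat, of S] by (simp add: inverse_eq_divide)
    show "(\<lambda>n. S) \<longlonglongrightarrow> S" by simp
    show "\<forall>\<^sub>F n in sequentially. S - 1 / real (Suc n) \<le> J (h n)"
      using h(2) less_imp_le by (intro always_eventually) blast
    show "\<forall>\<^sub>F n in sequentially. J (h n) \<le> S"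
      using JS h(1) by (intro always_eventually) blast
  qed
  have par: "B (\<lambda>x y. h n x y - h k x y) (\<lambda>x y. h n x y - h k x y) \<le> 2 / c * (1 / real (Suc n) + 1 / real (Suc k))" for n k
  proof -
    define d where "d = (\<lambda>x y. h n x y + (-1) * h k x y)"
    have d: "d \<in> C" unfolding d_def by (rule comb[OF h(1) h(1)])
    \<comment> \<open>The midpoint of \<open>h n\<close> and \<open>h k\<close>.\<close>
    define mid where "mid = (\<lambda>x y. h k x y + (1/2) * d x y)"
    have mid: "mid \<in> C" unfolding mid_def by (rule comb[OF h(1) d])
    have hn: "h n = (\<lambda>x y. h k x y + 1 * d x y)" by (auto simp: d_def)
    have 1: "J (h n) = J (h k) + \<Lambda> d - c * (2 * B (h k) d + B d d)"
      using lin[OF h(1)[of k] d, of 1] quad[OF h(1)[of k] d, of 1] hn by (simp add: J_def algebra_simps)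
    have 2: "J mid = J (h k) + \<Lambda> d / 2 - c * (B (h k) d + B d d / 4)"
      using lin[OF h(1)[of k] d, of "1/2"] quad[OF h(1)[of k] d, of "1/2"]
      by (simp add: J_def mid_def algebra_simps power2_eq_square)
    have "c * B d d / 4 = J mid - (J (h n) + J (h k)) / 2"
      unfolding 1 2 by (simp add: field_simps)
    also have "\<dots> \<le> (1 / real (Suc n) + 1 / real (Suc k)) / 2"
      using JS[OF mid] h(2)[of n] h(2)[of k] by argo
    finally have *: "c * B d d / 4 \<le> (1 / real (Suc n) + 1 / real (Suc k)) / 2" .
    have "B d d \<le> 2 / c * X" if "c * B d d / 4 \<le> X / 2" for X
      using c that by (simp add: field_simps)
    from this[OF *] have "B d d \<le> 2 / c * (1 / real (Suc n) + 1 / real (Suc k))" .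
    then show ?thesis by (simp add: d_def)
  qed
  show ?thesis by (rule that[OF h(1) JS[unfolded J_def] lim[unfolded J_def] par])
qed

lemma linear_le_quadratic_imp_zero:
  fixes A Q :: real
  assumes "\<And>t. t * A \<le> t\<^sup>2 * Q"
  shows "A = 0"
proof (rule ccontr)
  assume "A \<noteq> 0"
  define q where "q = \<bar>Q\<bar> + 1"
  have q: "q > 0" "Q < q" by (auto simp: q_def)
  \<comment> \<open>The parameter \<open>t = A / q\<close> makes the linear term dominate.\<close>
  have "A\<^sup>2 / q \<le> (A / q)\<^sup>2 * Q" using assms[of "A / q"] by (simp add: power2_eq_square)
  then have "A\<^sup>2 * q \<le> A\<^sup>2 * Q" using q by (simp add: field_simps power2_eq_square)
  moreover have "A\<^sup>2 > 0" using \<open>A \<noteq> 0\<close> by simp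
  ultimately have "q \<le> Q" by (simp add: mult_le_cancel_left)
  then show False using q by simp
qed

text \<open>
  The limit of the maximizing sequence need not belong to \<open>C\<close>, so the perturbation by \<open>t g\<close> is carried
  out along the sequence, and the resulting inequality is passed to the limit.
\<close>

lemma first_variation:
  fixes C :: "('a \<Rightarrow> 'b \<Rightarrow> real) set" and \<Lambda> B
  assumes comb: "\<And>f g t. f \<in> C \<Longrightarrow> g \<in> C \<Longrightarrow> (\<lambda>x y. f x y + t * g x y) \<in> C"
    and lin: "\<And>f g t. f \<in> C \<Longrightarrow> g \<in> C \<Longrightarrow> \<Lambda> (\<lambda>x y. f x y + t * g x y) = \<Lambda> f + t * \<Lambda> g"
    and quad: "\<And>f g t. f \<in> C \<Longrightarrow> g \<in> C \<Longrightarrow>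
      B (\<lambda>x y. f x y + t * g x y) (\<lambda>x y. f x y + t * g x y) = B f f + 2 * t * B f g + t\<^sup>2 * B g g"
    and h: "\<And>n. h n \<in> C" and S: "\<And>f. f \<in> C \<Longrightarrow> \<Lambda> f - c * B f f \<le> (S::real)"
    and lim: "(\<lambda>n. \<Lambda> (h n) - c * B (h n) (h n)) \<longlonglongrightarrow> S"
    and g: "g \<in> C" and l: "(\<lambda>n. B (h n) g) \<longlonglongrightarrow> l"
  shows "\<Lambda> g = 2 * c * l"
proof -
  have "t * (\<Lambda> g - 2 * c * l) \<le> t\<^sup>2 * (c * B g g)" for t
  proof -
    have "(\<Lambda> (h n) - c * B (h n) (h n)) + t * (\<Lambda> g - 2 * c * B (h n) g) - t\<^sup>2 * (c * B g g) \<le> S" for n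
      using S[OF comb[OF h g, of n t]] lin[OF h g, of n t] quad[OF h g, of n t] by (simp add: algebra_simps)
    moreover have "(\<lambda>n. (\<Lambda> (h n) - c * B (h n) (h n)) + t * (\<Lambda> g - 2 * c * B (h n) g) - t\<^sup>2 * (c * B g g))
       \<longlonglongrightarrow> S + t * (\<Lambda> g - 2 * c * l) - t\<^sup>2 * (c * B g g)"
      by (intro tendsto_intros lim l)
    ultimately have "S + t * (\<Lambda> g - 2 * c * l) - t\<^sup>2 * (c * B g g) \<le> S"
      by (intro LIMSEQ_le_const2) auto
    then show ?thesis by simp
  qed
  from linear_le_quadratic_imp_zero[OF this] show ?thesis by simp
qed

text \<open>
  The interior values and the two boundary values converge separately, each in its own \<open>L\<^sup>2\<close> space, and are
  combined into a single function \<open>G\<close>.  It is chosen Borel measurable so that all its sections and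
  their primitives are measurable.
\<close>

lemma energy_maximizer:
  fixes \<Lambda> :: "(real \<Rightarrow> real \<Rightarrow> real) \<Rightarrow> real"
  assumes w: "bounded_weight T w0" "bounded_weight T w1" and c: "c > 0"
    and lin: "\<And>f g t. f \<in> C01 T \<Longrightarrow> g \<in> C01 T \<Longrightarrow> \<Lambda> (\<lambda>x y. f x y + t * g x y) = \<Lambda> f + t * \<Lambda> g"
    and bdd: "\<And>f. f \<in> C01 T \<Longrightarrow> \<Lambda> f - c * weighted_form T w0 w1 f f \<le> M0"
  obtains S h G where "\<And>n. h n \<in> C01 T" "trace_L2 T G" "case_prod G \<in> borel_measurable borel"
    "(\<lambda>n. LINT z|lebesgue_on (cylinder T). (case_prod (h n) z - case_prod G z)\<^sup>2) \<longlonglongrightarrow> 0"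
    "\<And>H. H \<in> C01 T \<Longrightarrow> \<Lambda> H = 2 * c * weighted_form T w0 w1 G H"
    "\<And>H. H \<in> C01 T \<Longrightarrow> \<Lambda> H - c * weighted_form T w0 w1 H H \<le> S"
    "(\<lambda>n. \<Lambda> (h n) - c * weighted_form T w0 w1 (h n) (h n)) \<longlonglongrightarrow> S"
    "S = c * weighted_form T w0 w1 G G"
proof -
  let ?L = "lebesgue_on (cylinder T)" and ?I = "lebesgue_on {0..T}"
  let ?B = "weighted_form T w0 w1" and ?e = "\<lambda>n k :: nat. 2 / c * (1 / real (Suc n) + 1 / real (Suc k))"
  have ne: "C01 T \<noteq> {}" using C01_const_in_space(1)[of T "\<lambda>_. 0"] by auto
  have comb: "(\<lambda>x y. f x y + t * g x y) \<in> C01 T" if "f \<in> C01 T" "g \<in> C01 T" for f g t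
    by (rule C01_combination(1)[OF that])
  have quad: "?B (\<lambda>x y. f x y + t * g x y) (\<lambda>x y. f x y + t * g x y) = ?B f f + 2 * t * ?B f g + t\<^sup>2 * ?B g g"
    if "f \<in> C01 T" "g \<in> C01 T" for f g t
    by (intro weighted_form_combination w trace_L2_C01 that)
  obtain S h where h: "\<And>n. h n \<in> C01 T" and S: "\<And>f. f \<in> C01 T \<Longrightarrow> \<Lambda> f - c * ?B f f \<le> S"
    and lim: "(\<lambda>n. \<Lambda> (h n) - c * ?B (h n) (h n)) \<longlonglongrightarrow> S"
    and par: "\<And>n k. ?B (\<lambda>x y. h n x y - h k x y) (\<lambda>x y. h n x y - h k x y) \<le> 2 / c * (1 / real (Suc n) + 1 / real (Suc k))"
    by (rule maximizing_sequence[where C="C01 T" and \<Lambda>=\<Lambda> and B="?B" and c=c, OF ne comb lin quad c bdd])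
      (assumption | (rule that; assumption))+
  obtain \<delta>0 \<delta>1 where \<delta>: "\<delta>0 > 0" "\<And>s. s \<in> {0..T} \<Longrightarrow> \<delta>0 \<le> w0 s" "\<delta>1 > 0" "\<And>s. s \<in> {0..T} \<Longrightarrow> \<delta>1 \<le> w1 s"
    using w unfolding bounded_weight_def by metis
  have trh: "trace_L2 T (h n)" for n by (rule trace_L2_C01[OF h])
  have sqh: "sq_integrable ?L (case_prod (h n))" "sq_integrable ?I (\<lambda>s. h n s 0)" "sq_integrable ?I (\<lambda>s. h n s 1)" for n
    using trh by (auto simp: trace_L2_def)
  have nonneg: "0 \<le> (LINT z|M. f z)" if "\<And>z. z \<in> space M \<Longrightarrow> 0 \<le> f z" for M and f :: "'z \<Rightarrow> real"
    using that by (intro Bochner_Integration.integral_nonneg)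
  have wlow: "\<delta> * (LINT s|?I. (f s)\<^sup>2) \<le> (LINT s|?I. w s * f s * f s)"
    if "sq_integrable ?I f" "bounded_weight T w" "\<And>s. s \<in> {0..T} \<Longrightarrow> \<delta> \<le> w s" for \<delta> w f
  proof -
    have "(LINT s|?I. \<delta> * (f s)\<^sup>2) \<le> (LINT s|?I. w s * f s * f s)"
    proof (rule integral_mono_AE)
      show "AE s in ?I. \<delta> * (f s)\<^sup>2 \<le> w s * f s * f s"
      proof (rule AE_I2)
        fix s assume "s \<in> space ?I"
        then have "\<delta> * (f s)\<^sup>2 \<le> w s * (f s)\<^sup>2" using that(3) by (intro mult_right_mono) auto
        then show "\<delta> * (f s)\<^sup>2 \<le> w s * f s * f s" by (simp add: power2_eq_square mult.assoc)
      qed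
    qed (use that integrable_weighted[OF that(2,1,1)] in \<open>auto simp: sq_integrable_def\<close>)
    then show ?thesis by simp
  qed
  have bounds: "(LINT z|?L. (case_prod (h n) z - case_prod (h k) z)\<^sup>2) \<le> ?e n k"
    "\<delta>0 * (LINT s|?I. (h n s 0 - h k s 0)\<^sup>2) \<le> ?e n k"
    "\<delta>1 * (LINT s|?I. (h n s 1 - h k s 1)\<^sup>2) \<le> ?e n k" for n k
  proof -
    let ?d = "\<lambda>x y. h n x y - h k x y"
    have sq: "sq_integrable ?I (\<lambda>s. ?d s 0)" "sq_integrable ?I (\<lambda>s. ?d s 1)"
      by (intro sq_integrable_diff sqh)+
    have "(LINT z|?L. case_prod ?d z * case_prod ?d z) = (LINT z|?L. (case_prod (h n) z - case_prod (h k) z)\<^sup>2)"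
      by (intro Bochner_Integration.integral_cong refl) (auto simp: power2_eq_square)
    then have Bd: "?B ?d ?d = (LINT z|?L. (case_prod (h n) z - case_prod (h k) z)\<^sup>2)
        + (LINT s|?I. w0 s * ?d s 0 * ?d s 0) + (LINT s|?I. w1 s * ?d s 1 * ?d s 1)"
      by (simp add: weighted_form_def)
    have n0: "0 \<le> (LINT z|?L. (case_prod (h n) z - case_prod (h k) z)\<^sup>2)" by (rule nonneg) simp
    have n1: "0 \<le> \<delta>0 * (LINT s|?I. (?d s 0)\<^sup>2)" "0 \<le> \<delta>1 * (LINT s|?I. (?d s 1)\<^sup>2)"
      using \<delta> by (auto intro!: mult_nonneg_nonneg nonneg)
    note l = wlow[OF sq(1) w(1) \<delta>(2)] wlow[OF sq(2) w(2) \<delta>(4)]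
    show "(LINT z|?L. (case_prod (h n) z - case_prod (h k) z)\<^sup>2) \<le> ?e n k"
      "\<delta>0 * (LINT s|?I. (h n s 0 - h k s 0)\<^sup>2) \<le> ?e n k"
      "\<delta>1 * (LINT s|?I. (h n s 1 - h k s 1)\<^sup>2) \<le> ?e n k"
      using par[of n k] n0 n1 l unfolding Bd by linarith+
  qed
  have Cauchy: "\<exists>N::nat. \<forall>i\<ge>N. \<forall>j\<ge>N. x i j < e"
    if x: "\<And>i j. \<delta> * x i j \<le> 2 / c * (1 / real (Suc i) + 1 / real (Suc j))" and "\<delta> > 0" "e > 0"
    for x :: "nat \<Rightarrow> nat \<Rightarrow> real" and \<delta> e
  proof -
    have "c * \<delta> * e / 4 > 0" using c that by simp
    then obtain N where N: "1 / real (Suc N) < c * \<delta> * e / 4" using nat_approx_posE by blast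
    have "x i j < e" if "i \<ge> N" "j \<ge> N" for i j
    proof -
      have "1 / real (Suc i) \<le> 1 / real (Suc N)" "1 / real (Suc j) \<le> 1 / real (Suc N)"
        using that by (auto intro!: divide_left_mono)
      then have "1 / real (Suc i) + 1 / real (Suc j) < c * \<delta> * e / 2" using N by linarith
      then have "2 / c * (1 / real (Suc i) + 1 / real (Suc j)) < 2 / c * (c * \<delta> * e / 2)"
        using c by (intro mult_strict_left_mono) auto
      also have "\<dots> = \<delta> * e" using c by simp
      finally have "\<delta> * x i j < \<delta> * e" using x[of i j] by linarith
      then show ?thesis using \<open>\<delta> > 0\<close> by simp
    qed
    then show ?thesis by blast
  qed
  obtain g where g: "sq_integrable ?L g" and glim: "(\<lambda>n. LINT z|?L. (case_prod (h n) z - g z)\<^sup>2) \<longlonglongrightarrow> 0"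
  proof -
    have "1 * (LINT z|?L. (case_prod (h n) z - case_prod (h k) z)\<^sup>2) \<le> ?e n k" for n k
      unfolding mult_1 by (rule bounds(1))
    from L2_complete[OF finite_measure_cylinder sqh(1) Cauchy[OF this zero_less_one]] that show ?thesis by blast
  qed
  obtain g0 where g0: "sq_integrable ?I g0" and g0lim: "(\<lambda>n. LINT s|?I. (h n s 0 - g0 s)\<^sup>2) \<longlonglongrightarrow> 0"
    using L2_complete[OF finite_measure_ivl sqh(2) Cauchy[OF bounds(2) \<delta>(1)]] by blast
  obtain g1 where g1: "sq_integrable ?I g1" and g1lim: "(\<lambda>n. LINT s|?I. (h n s 1 - g1 s)\<^sup>2) \<longlonglongrightarrow> 0"
    using L2_complete[OF finite_measure_ivl sqh(3) Cauchy[OF bounds(3) \<delta>(3)]] by blast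
  have gm: "g \<in> borel_measurable ?L" "g0 \<in> borel_measurable ?I" "g1 \<in> borel_measurable ?I"
    using g g0 g1 by (auto simp: sq_integrable_def)
  obtain p where p: "p \<in> borel_measurable borel" and gp: "AE z in ?L. g z = p z"
    using borel_representative[OF gm(1) sets_cylinder(1)] by metis
  obtain p0 where p0: "p0 \<in> borel_measurable borel" and gp0: "AE s in ?I. g0 s = p0 s"
    using borel_representative[OF gm(2) borel_closed[OF closed_atLeastAtMost]] by metis
  obtain p1 where p1: "p1 \<in> borel_measurable borel" and gp1: "AE s in ?I. g1 s = p1 s"
    using borel_representative[OF gm(3) borel_closed[OF closed_atLeastAtMost]] by metis
  define G where "G s u = (if u = 0 then p0 s else if u = 1 then p1 s else p (s, u))" for s u
  have GB: "case_prod G \<in> borel_measurable borel"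
  proof -
    note [measurable] = p p0 p1
    have line: "{z :: real \<times> real. snd z = x} \<in> sets (borel \<Otimes>\<^sub>M borel)" for x
      unfolding borel_prod by (intro borel_closed closed_Collect_eq continuous_intros)
    have "(\<lambda>z. if snd z = 0 then p0 (fst z) else if snd z = 1 then p1 (fst z) else p z) \<in> borel_measurable (borel \<Otimes>\<^sub>M borel)"
    proof (intro measurable_If)
      show "p \<in> borel_measurable (borel \<Otimes>\<^sub>M borel)" unfolding borel_prod by (rule p)
    qed (use line in \<open>simp_all add: space_pair_measure\<close>)
    then have "(\<lambda>z. if snd z = 0 then p0 (fst z) else if snd z = 1 then p1 (fst z) else p z) \<in> borel_measurable borel"
      unfolding borel_prod .
    moreover have "case_prod G = (\<lambda>z. if snd z = 0 then p0 (fst z) else if snd z = 1 then p1 (fst z) else p z)"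
      by (auto simp: fun_eq_iff G_def)
    ultimately show ?thesis by simp
  qed
  have gG: "AE z in ?L. g z = case_prod G z"
    using gp AE_cylinder_not_on_line[where T=T and x=0] AE_cylinder_not_on_line[where T=T and x=1]
    by eventually_elim (auto simp: G_def)
  have gG0: "AE s in ?I. g0 s = G s 0" using gp0 by (simp add: G_def)
  have gG1: "AE s in ?I. g1 s = G s 1" using gp1 by (simp add: G_def)
  have sqG: "sq_integrable ?L (case_prod G)" "sq_integrable ?I (\<lambda>s. G s 0)" "sq_integrable ?I (\<lambda>s. G s 1)"
    using sq_integrable_cong_AE[OF g _ gG] sq_integrable_cong_AE[OF g0 _ gG0] sq_integrable_cong_AE[OF g1 _ gG1]
      measurable_lebesgue_on_AE[OF gm(1) sets_cylinder(2) gG] measurable_lebesgue_on_AE[OF gm(2) _ gG0]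
      measurable_lebesgue_on_AE[OF gm(3) _ gG1] by auto
  then have trG: "trace_L2 T G" by (simp add: trace_L2_def)
  \<comment> \<open>Passing to the representatives changes neither the limits nor the distances to them.\<close>
  have dist_eq: "(LINT x|M. (f x - p x)\<^sup>2) = (LINT x|M. (f x - q x)\<^sup>2)"
    if "sq_integrable M f" "sq_integrable M p" "sq_integrable M q" "AE x in M. p x = q x" for M and f p q :: "'z \<Rightarrow> real"
  proof (rule integral_cong_AE)
    show "AE x in M. (f x - p x)\<^sup>2 = (f x - q x)\<^sup>2" using that(4) by eventually_elim simp
  qed (use that in \<open>auto simp: sq_integrable_def\<close>)
  have lims: "(\<lambda>n. LINT z|?L. (case_prod (h n) z - case_prod G z)\<^sup>2) \<longlonglongrightarrow> 0"
    "(\<lambda>n. LINT s|?I. (h n s 0 - G s 0)\<^sup>2) \<longlonglongrightarrow> 0" "(\<lambda>n. LINT s|?I. (h n s 1 - G s 1)\<^sup>2) \<longlonglongrightarrow> 0"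
    using glim g0lim g1lim dist_eq[OF sqh(1) g sqG(1) gG] dist_eq[OF sqh(2) g0 sqG(2) gG0] dist_eq[OF sqh(3) g1 sqG(3) gG1]
    by simp_all
  obtain W0 where W0: "w0 \<in> borel_measurable ?I" "AE s in ?I. \<bar>w0 s\<bar> \<le> W0" using bounded_weightD[OF w(1)] by metis
  obtain W1 where W1: "w1 \<in> borel_measurable ?I" "AE s in ?I. \<bar>w1 s\<bar> \<le> W1" using bounded_weightD[OF w(2)] by metis
  have inner: "(\<lambda>n. ?B (h n) H) \<longlonglongrightarrow> ?B G H" if "trace_L2 T H" for H
    unfolding weighted_form_def using that
    by (intro tendsto_intros L2_tendsto_inner[OF sqh(1) sqG(1) lims(1)]
        L2_tendsto_weighted(1)[OF sqh(2) sqG(2) lims(2) W0] L2_tendsto_weighted(1)[OF sqh(3) sqG(3) lims(3) W1])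
      (auto simp: trace_L2_def)
  have norms: "(\<lambda>n. ?B (h n) (h n)) \<longlonglongrightarrow> ?B G G"
  proof -
    have "(\<lambda>n. LINT z|?L. 1 * case_prod (h n) z * case_prod (h n) z) \<longlonglongrightarrow> (LINT z|?L. 1 * case_prod G z * case_prod G z)"
      by (rule L2_tendsto_weighted(2)[OF sqh(1) sqG(1) lims(1), where W=1]) auto
    then have "(\<lambda>n. LINT z|?L. case_prod (h n) z * case_prod (h n) z) \<longlonglongrightarrow> (LINT z|?L. case_prod G z * case_prod G z)"
      by simp
    then show ?thesis
      unfolding weighted_form_def
      by (intro tendsto_intros L2_tendsto_weighted(2)[OF sqh(2) sqG(2) lims(2) W0]
        L2_tendsto_weighted(2)[OF sqh(3) sqG(3) lims(3) W1])
  qed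
  have Euler: "\<Lambda> H = 2 * c * ?B G H" if "H \<in> C01 T" for H
    by (rule first_variation[where C="C01 T" and B="?B", OF comb lin quad h S lim that inner[OF trace_L2_C01[OF that]]])
  \<comment> \<open>The supremum is evaluated along the sequence, where \<open>\<Lambda>\<close> is already known.\<close>
  have sym: "?B G H = ?B H G" for H by (simp add: weighted_form_def mult_ac)
  have J: "(\<lambda>n. 2 * c * ?B (h n) G - c * ?B (h n) (h n)) \<longlonglongrightarrow> 2 * c * ?B G G - c * ?B G G"
    by (intro tendsto_intros inner[OF trG] norms)
  have "(\<lambda>n. \<Lambda> (h n) - c * ?B (h n) (h n)) \<longlonglongrightarrow> c * ?B G G"
  proof -
    have "\<Lambda> (h n) = 2 * c * ?B (h n) G" for n
      unfolding Euler[OF h] by (simp only: sym[of "h n"])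
    moreover have "2 * c * ?B G G - c * ?B G G = c * ?B G G" by simp
    ultimately show ?thesis using J by (simp only:)
  qed
  then have "S = c * ?B G G" using lim LIMSEQ_unique by blast
  then show ?thesis by (intro that[OF h trG GB lims(1) Euler S lim])
qed

section \<open>The weak equation\<close>

text \<open>
  The first part comes from test functions that depend on time only.  For the second, test with the
  antiderivative in space \<open>H\<close> of an arbitrary continuous \<open>K\<close>: integrating by parts at each fixed time turns
  the equation into the orthogonality of \<open>F - \<integral> D - a\<close> to \<open>K\<close>.
\<close>

lemma weak_equation_imp_primitive:
  fixes F D :: "real \<Rightarrow> real \<Rightarrow> real" and a b :: "real \<Rightarrow> real"
  assumes F: "sq_integrable (lebesgue_on (cylinder T)) (case_prod F)"
    and B: "case_prod D \<in> borel_measurable borel" and D: "sq_integrable (lebesgue_on (cylinder T)) (case_prod D)"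
    and a: "integrable (lebesgue_on {0..T}) a" and b: "integrable (lebesgue_on {0..T}) b"
    and eq: "\<And>H. H \<in> C01 T \<Longrightarrow>
      (LINT z|lebesgue_on (cylinder T). case_prod F z * case_prod (space_deriv H) z)
      + (LINT z|lebesgue_on (cylinder T). case_prod D z * case_prod H z)
      + (LINT s|lebesgue_on {0..T}. a s * H s 0) - (LINT s|lebesgue_on {0..T}. b s * H s 1) = 0"
  shows "AE s in lebesgue_on {0..T}. a s + primitive (D s) 1 = b s"
    and "AE s in lebesgue_on {0..T}. AE u in lebesgue_on {0..1}. F s u = a s + primitive (D s) u"
proof -
  let ?L = "lebesgue_on (cylinder T)" and ?I = "lebesgue_on {0..T}"
  let ?p = "\<lambda>(s, u). primitive (D s) u"
  have Fi: "integrable ?L (case_prod F)" and Di: "integrable ?L (case_prod D)"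
    using sq_integrable_imp_integrable[OF finite_measure_cylinder] F D by auto
  have sec: "AE s in ?I. integrable (lebesgue_on {0..1}) (D s)"
    using Fubini_cylinder(1)[OF Di] by simp
  have p1: "integrable ?I (\<lambda>s. primitive (D s) 1)"
    using Fubini_cylinder(2)[OF Di] by (simp add: primitive_1)
  have "AE s in ?I. a s + primitive (D s) 1 - b s = 0"
  proof (rule integral_zero_all_continuous_imp_AE_zero)
    show "integrable ?I (\<lambda>s. a s + primitive (D s) 1 - b s)" using a b p1 by simp
    fix h :: "real \<Rightarrow> real" assume h: "continuous_on UNIV h"
    have hc: "continuous_on {0..T} h" by (rule continuous_on_subset[OF h]) simp
    have hz: "continuous_on (cylinder T) (\<lambda>z. h (fst z))"
      by (rule continuous_on_compose2[OF h]) (auto intro!: continuous_intros)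
    have 1: "(LINT z|?L. case_prod F z * case_prod (space_deriv (\<lambda>s u. h s)) z) = 0"
    proof -
      have "(LINT z|?L. case_prod F z * case_prod (space_deriv (\<lambda>s u. h s)) z) = (LINT z|?L. 0)"
        by (intro Bochner_Integration.integral_cong) (auto simp: C01_const_in_space(2)[OF hc])
      then show ?thesis by simp
    qed
    have 2: "(LINT z|?L. case_prod D z * case_prod (\<lambda>s u. h s) z) = (LINT s|?I. primitive (D s) 1 * h s)"
    proof -
      have "(LINT z|?L. case_prod D z * case_prod (\<lambda>s u. h s) z) = (LINT z|?L. case_prod D z * h (fst z))"
        by (simp add: case_prod_unfold)
      also have "\<dots> = (LINT s|?I. LINT u|lebesgue_on {0..1}. D s u * h s)"
        using Fubini_cylinder(3)[OF integrable_mult_continuous[OF Di hz compact_cylinder]] by simp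
      finally show ?thesis by (simp add: primitive_1)
    qed
    note i = integrable_mult_continuous[OF a hc compact_Icc] integrable_mult_continuous[OF b hc compact_Icc]
      integrable_mult_continuous[OF p1 hc compact_Icc]
    have "(LINT s|?I. (a s + primitive (D s) 1 - b s) * h s)
       = (LINT s|?I. a s * h s + primitive (D s) 1 * h s - b s * h s)"
      by (intro Bochner_Integration.integral_cong refl) (simp add: algebra_simps)
    also have "\<dots> = (LINT s|?I. a s * h s) + (LINT s|?I. primitive (D s) 1 * h s) - (LINT s|?I. b s * h s)"
      using i by simp
    also have "\<dots> = 0" using eq[OF C01_const_in_space(1)[OF hc]] unfolding 1 2 by simp
    finally show "(LINT s|?I. (a s + primitive (D s) 1 - b s) * h s) = 0" .
  qed simp
  then show ab: "AE s in ?I. a s + primitive (D s) 1 = b s" by eventually_elim simp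
  have ac: "integrable ?L (\<lambda>z. a (fst z))" by (rule integrable_cylinder_fst[OF a])
  have pc: "integrable ?L (\<lambda>(s, u). primitive (D s) u)" by (rule integrable_primitive_cylinder[OF B D])
  have "AE z in ?L. case_prod F z - ?p z - a (fst z) = 0"
  proof (rule integral_zero_all_continuous_imp_AE_zero)
    show "integrable ?L (\<lambda>z. case_prod F z - ?p z - a (fst z))"
      by (intro Bochner_Integration.integrable_diff Fi pc ac)
    fix k :: "real \<times> real \<Rightarrow> real" assume k: "continuous_on UNIV k"
    define K where "K s u = k (s, u)" for s u
    have kK: "k = case_prod K" by (auto simp: K_def)
    have KU: "continuous_on UNIV (case_prod K)" using k kK by simp
    have kc: "continuous_on (cylinder T) k" by (rule continuous_on_subset[OF k]) simp
    define H where "H s u = integral {0..u} (K s)" for s u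
    have HC: "H \<in> C01 T" unfolding H_def by (rule C01_antiderivative(1)[OF KU])
    have sd: "space_deriv H s u = K s u" if "u \<in> {0..1}" for s u
      unfolding H_def by (rule C01_antiderivative(2)[OF KU that])
    have H0: "H s 0 = 0" for s by (simp add: H_def)
    have Ks: "continuous_on {0..1} (K s)" for s
    proof -
      have "continuous_on {0..1} (\<lambda>u. case_prod K (s, u))"
        by (rule continuous_on_compose2[OF KU]) (auto intro!: continuous_intros)
      then show ?thesis by simp
    qed
    have H1: "H s 1 = (LINT u|lebesgue_on {0..1}. K s u)" for s
    proof -
      have "integrable (lebesgue_on {0..1}) (\<lambda>u. 1 * K s u)"
        by (rule integrable_mult_continuous[OF _ Ks]) auto
      then show ?thesis unfolding H_def by (simp add: lebesgue_integral_eq_integral)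
    qed
    have HC1: "continuous_on {0..T} (\<lambda>s. H s 1)"
    proof -
      have "continuous_on {0..T} (\<lambda>s. case_prod H (s, 1))"
        by (rule continuous_on_compose2[OF C01_continuous(1)[OF HC]]) (auto intro!: continuous_intros)
      then show ?thesis by simp
    qed
    note Fk = integrable_mult_continuous[OF Fi kc compact_cylinder]
      and pk = integrable_mult_continuous[OF pc kc compact_cylinder]
      and ak = integrable_mult_continuous[OF ac kc compact_cylinder]
      and DH = integrable_mult_continuous[OF Di C01_continuous(1)[OF HC] compact_cylinder]
    have 1: "(LINT z|?L. case_prod F z * case_prod (space_deriv H) z) = (LINT z|?L. case_prod F z * k z)"
      by (intro Bochner_Integration.integral_cong) (auto simp: sd K_def)
    have 2: "(LINT z|?L. case_prod D z * case_prod H z)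
        = (LINT s|?I. primitive (D s) 1 * H s 1) - (LINT z|?L. ?p z * k z)"
    proof -
      have "(LINT z|?L. case_prod D z * case_prod H z) = (LINT s|?I. LINT u|lebesgue_on {0..1}. D s u * H s u)"
        using Fubini_cylinder(3)[OF DH] by simp
      also have "\<dots> = (LINT s|?I. primitive (D s) 1 * H s 1 - (LINT u|lebesgue_on {0..1}. primitive (D s) u * K s u))"
      proof (rule integral_lebesgue_on_AE)
        show "(\<lambda>s. LINT u|lebesgue_on {0..1}. D s u * H s u) \<in> borel_measurable ?I"
          using Fubini_cylinder(2)[OF DH] by simp
        show "AE s in ?I. (LINT u|lebesgue_on {0..1}. D s u * H s u)
           = primitive (D s) 1 * H s 1 - (LINT u|lebesgue_on {0..1}. primitive (D s) u * K s u)"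
          using sec AE_space
        proof eventually_elim
          case (elim s)
          have "(LINT u|lebesgue_on {0..1}. primitive (D s) u * K s u)
            = primitive (D s) 1 * H s 1 - (LINT u|lebesgue_on {0..1}. D s u * H s u)"
          proof (rule Fubini_primitive[OF elim(1) Ks])
            fix u :: real assume "u \<in> {0..1}"
            then show "(H s has_vector_derivative K s u) (at u within {0..1})"
              using C01_has_derivative[OF HC, of s u] elim(2) sd by simp
          qed
          then show ?case by simp
        qed
      qed simp
      also have "\<dots> = (LINT s|?I. primitive (D s) 1 * H s 1) - (LINT s|?I. LINT u|lebesgue_on {0..1}. primitive (D s) u * K s u)"
        using integrable_mult_continuous[OF p1 HC1 compact_Icc] Fubini_cylinder(2)[OF pk]
        by (simp add: K_def)
      also have "(LINT s|?I. LINT u|lebesgue_on {0..1}. primitive (D s) u * K s u) = (LINT z|?L. ?p z * k z)"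
        using Fubini_cylinder(3)[OF pk] by (simp add: K_def)
      finally show ?thesis .
    qed
    \<comment> \<open>By the first part, the boundary terms at \<open>u = 1\<close> combine to the contribution of \<open>a\<close>.\<close>
    have 3: "(LINT s|?I. primitive (D s) 1 * H s 1) - (LINT s|?I. b s * H s 1) = - (LINT z|?L. a (fst z) * k z)"
    proof -
      have "(LINT s|?I. b s * H s 1) = (LINT s|?I. a s * H s 1 + primitive (D s) 1 * H s 1)"
      proof (rule integral_lebesgue_on_AE)
        show "(\<lambda>s. b s * H s 1) \<in> borel_measurable ?I"
          using integrable_mult_continuous[OF b HC1 compact_Icc] by simp
        show "AE s in ?I. b s * H s 1 = a s * H s 1 + primitive (D s) 1 * H s 1"
          using ab by eventually_elim (simp flip: distrib_right)
      qed simp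
      also have "\<dots> = (LINT s|?I. a s * H s 1) + (LINT s|?I. primitive (D s) 1 * H s 1)"
        using integrable_mult_continuous[OF a HC1 compact_Icc] integrable_mult_continuous[OF p1 HC1 compact_Icc] by simp
      also have "(LINT s|?I. a s * H s 1) = (LINT z|?L. a (fst z) * k z)"
        using Fubini_cylinder(3)[OF ak] by (simp add: H1 K_def)
      finally show ?thesis by simp
    qed
    have "(LINT z|?L. (case_prod F z - ?p z - a (fst z)) * k z)
      = (LINT z|?L. case_prod F z * k z - ?p z * k z - a (fst z) * k z)"
      by (simp only: left_diff_distrib)
    also have "\<dots> = (LINT z|?L. case_prod F z * k z) - (LINT z|?L. ?p z * k z) - (LINT z|?L. a (fst z) * k z)"
      using Fk pk ak by simp
    also have "\<dots> = 0" using eq[OF HC] 3 unfolding 1 2 by (simp add: H0)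
    finally show "(LINT z|?L. (case_prod F z - ?p z - a (fst z)) * k z) = 0" .
  qed (rule sets_cylinder)
  from AE_section[OF _ _ sets_cylinder(2) this]
  have "AE s in ?I. AE u in lebesgue_on {0..1}. F s u - primitive (D s) u - a s = 0" by simp
  then show "AE s in ?I. AE u in lebesgue_on {0..1}. F s u = a s + primitive (D s) u"
  proof eventually_elim
    case (elim s)
    then show ?case by eventually_elim simp
  qed
qed

section \<open>The energy functional\<close>

text \<open>
  The summand with index \<open>0\<close> is already positive.
\<close>

lemma P_lower: "0 < \<gamma> \<Longrightarrow> m \<ge> 1 \<Longrightarrow> 0 \<le> r \<Longrightarrow> \<gamma> ^ (m - 1) \<le> P \<gamma> m r"
proof -
  assume *: "0 < \<gamma>" "m \<ge> 1" "0 \<le> r"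
  have "\<gamma> ^ (m - 1 - 0) * r ^ 0 \<le> (\<Sum>i<m. \<gamma> ^ (m - 1 - i) * r ^ i)"
    by (rule member_le_sum) (use * in auto)
  then show ?thesis by (simp add: P_def)
qed

lemma P_mono: "0 < \<gamma> \<Longrightarrow> 0 \<le> r \<Longrightarrow> r \<le> R \<Longrightarrow> P \<gamma> m r \<le> P \<gamma> m R"
  unfolding P_def by (intro sum_mono mult_left_mono power_mono) auto

lemma bounded_weight_P:
  assumes \<xi>: "\<xi> \<in> \<B> T" and u: "u \<in> {0, 1}" and "0 < \<gamma>" "m \<ge> 1" "\<kappa> > 0"
  shows "bounded_weight T (\<lambda>s. P \<gamma> m (\<xi> s u) / \<kappa>)"
proof -
  have m: "(\<lambda>s. \<xi> s u) \<in> borel_measurable (lebesgue_on {0..T})" and b: "bounded ((\<lambda>s. \<xi> s u) ` {0..T})"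
    and n: "\<And>s. s \<in> {0..T} \<Longrightarrow> 0 \<le> \<xi> s u"
    using \<xi> u by (auto simp: \<B>_def)
  obtain R where bR: "\<forall>x\<in>(\<lambda>s. \<xi> s u) ` {0..T}. norm x \<le> R"
    using b unfolding bounded_iff by blast
  have R: "\<xi> s u \<le> R" if "s \<in> {0..T}" for s
  proof -
    have "norm (\<xi> s u) \<le> R" using bR that by blast
    then show ?thesis by simp
  qed
  have pm: "(\<lambda>s. P \<gamma> m (\<xi> s u) / \<kappa>) \<in> borel_measurable (lebesgue_on {0..T})"
    unfolding P_def using m by measurable
  have "\<forall>s\<in>{0..T}. P \<gamma> m (\<xi> s u) / \<kappa> \<le> P \<gamma> m R / \<kappa>"
    using assms n R by (auto intro!: divide_right_mono P_mono)
  moreover have "\<forall>s\<in>{0..T}. \<gamma> ^ (m - 1) / \<kappa> \<le> P \<gamma> m (\<xi> s u) / \<kappa>"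
    using \<open>\<kappa> > 0\<close> by (intro ballI divide_right_mono P_lower n \<open>0 < \<gamma>\<close> \<open>m \<ge> 1\<close>) auto
  moreover have "\<gamma> ^ (m - 1) / \<kappa> > 0" using assms by simp
  ultimately show ?thesis unfolding bounded_weight_def using pm by blast
qed

lemma inner_L2_bd_eq_weighted_form:
  assumes w: "bounded_weight T (\<lambda>s. P \<alpha> m (\<xi> s 0) / \<kappa>)" "bounded_weight T (\<lambda>s. P \<beta> m (\<xi> s 1) / \<kappa>)"
    and G: "trace_L2 T G" and H: "trace_L2 T H"
  shows "integrable (lebesgue_on {0..T}) (boundary_density \<alpha> \<beta> m \<kappa> \<xi> G H)"
    and "inner_L2_bd \<alpha> \<beta> m \<kappa> T \<xi> G H
      = weighted_form T (\<lambda>s. P \<alpha> m (\<xi> s 0) / \<kappa>) (\<lambda>s. P \<beta> m (\<xi> s 1) / \<kappa>) G H"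
proof -
  note i = integrable_weighted[OF w(1), of "\<lambda>s. G s 0" "\<lambda>s. H s 0"] integrable_weighted[OF w(2), of "\<lambda>s. G s 1" "\<lambda>s. H s 1"]
  have bd: "boundary_density \<alpha> \<beta> m \<kappa> \<xi> G H
    = (\<lambda>s. P \<alpha> m (\<xi> s 0) / \<kappa> * G s 0 * H s 0 + P \<beta> m (\<xi> s 1) / \<kappa> * G s 1 * H s 1)"
    by (auto simp: boundary_density_def)
  show "integrable (lebesgue_on {0..T}) (boundary_density \<alpha> \<beta> m \<kappa> \<xi> G H)"
    unfolding bd using G H by (intro Bochner_Integration.integrable_add i) (auto simp: trace_L2_def)
  have "(LINT s|lebesgue_on {0..T}. boundary_density \<alpha> \<beta> m \<kappa> \<xi> G H s)
    = (LINT s|lebesgue_on {0..T}. P \<alpha> m (\<xi> s 0) / \<kappa> * G s 0 * H s 0)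
    + (LINT s|lebesgue_on {0..T}. P \<beta> m (\<xi> s 1) / \<kappa> * G s 1 * H s 1)"
    unfolding bd using G H by (intro Bochner_Integration.integral_add i) (auto simp: trace_L2_def)
  moreover have "inner_L2 T G H = (LINT z|lebesgue_on (cylinder T). case_prod G z * case_prod H z)"
    using G H by (intro inner_L2_eq sq_integrable_mult) (auto simp: trace_L2_def)
  ultimately show "inner_L2_bd \<alpha> \<beta> m \<kappa> T \<xi> G H
      = weighted_form T (\<lambda>s. P \<alpha> m (\<xi> s 0) / \<kappa>) (\<lambda>s. P \<beta> m (\<xi> s 1) / \<kappa>) G H"
    by (simp add: inner_L2_bd_def weighted_form_def)
qed

lemma \<T>_eq:
  assumes F: "sq_integrable (lebesgue_on (cylinder T)) (\<lambda>(s, u). \<xi> s u ^ m)" and H: "H \<in> C01 T"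
  shows "\<T> \<alpha> \<beta> m T \<xi> H
    = (LINT z|lebesgue_on (cylinder T). (case z of (s, u) \<Rightarrow> \<xi> s u ^ m) * case_prod (space_deriv H) z)
      + (LINT s|lebesgue_on {0..T}. \<alpha> ^ m * H s 0) - (LINT s|lebesgue_on {0..T}. \<beta> ^ m * H s 1)"
proof -
  have fin: "finite_measure (lebesgue_on {0..T})" by (rule finite_measure_ivl)
  have "inner_L2 T (\<lambda>s u. \<xi> s u ^ m) (space_deriv H)
    = (LINT z|lebesgue_on (cylinder T). (case z of (s, u) \<Rightarrow> \<xi> s u ^ m) * case_prod (space_deriv H) z)"
    by (intro inner_L2_eq sq_integrable_mult F sq_integrable_continuous C01_continuous(2)[OF H] compact_cylinder)
  moreover have "integrable (lebesgue_on {0..T}) (\<lambda>s. H s 0)" "integrable (lebesgue_on {0..T}) (\<lambda>s. H s 1)"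
    using trace_L2_C01[OF H] sq_integrable_imp_integrable[OF fin] by (auto simp: trace_L2_def)
  ultimately show ?thesis by (simp add: \<T>_def)
qed

lemma \<T>_linear:
  assumes F: "sq_integrable (lebesgue_on (cylinder T)) (\<lambda>(s, u). \<xi> s u ^ m)" and G: "G \<in> C01 T" and H: "H \<in> C01 T"
  shows "\<T> \<alpha> \<beta> m T \<xi> (\<lambda>s u. G s u + t * H s u) = \<T> \<alpha> \<beta> m T \<xi> G + t * \<T> \<alpha> \<beta> m T \<xi> H"
proof -
  let ?L = "lebesgue_on (cylinder T)" and ?I = "lebesgue_on {0..T}"
  let ?F = "\<lambda>z. case z of (s, u) \<Rightarrow> \<xi> s u ^ m"
  have fin: "finite_measure ?I" by (rule finite_measure_ivl)
  have iF: "integrable ?L (\<lambda>z. ?F z * case_prod (space_deriv H) z)" if "H \<in> C01 T" for H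
    by (intro sq_integrable_mult F sq_integrable_continuous C01_continuous(2)[OF that] compact_cylinder)
  have ib: "integrable ?I (\<lambda>s. H s 0)" "integrable ?I (\<lambda>s. H s 1)" if "H \<in> C01 T" for H
    using trace_L2_C01[OF that] sq_integrable_imp_integrable[OF fin] by (auto simp: trace_L2_def)
  have "(LINT z|?L. ?F z * case_prod (space_deriv (\<lambda>s u. G s u + t * H s u)) z)
     = (LINT z|?L. ?F z * case_prod (space_deriv G) z + t * (?F z * case_prod (space_deriv H) z))"
    by (intro Bochner_Integration.integral_cong) (auto simp: C01_combination(2)[OF G H] algebra_simps)
  also have "\<dots> = (LINT z|?L. ?F z * case_prod (space_deriv G) z) + t * (LINT z|?L. ?F z * case_prod (space_deriv H) z)"
    using iF[OF G] iF[OF H] by simp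
  finally have 1: "(LINT z|?L. ?F z * case_prod (space_deriv (\<lambda>s u. G s u + t * H s u)) z)
     = (LINT z|?L. ?F z * case_prod (space_deriv G) z) + t * (LINT z|?L. ?F z * case_prod (space_deriv H) z)" .
  have 2: "(LINT s|?I. c * (G s x + t * H s x)) = (LINT s|?I. c * G s x) + t * (LINT s|?I. c * H s x)"
    if "x \<in> {0, 1}" for c x
  proof -
    have "(LINT s|?I. c * (G s x + t * H s x)) = (LINT s|?I. c * G s x + t * (c * H s x))"
      by (intro Bochner_Integration.integral_cong refl) (simp add: algebra_simps)
    also have "\<dots> = (LINT s|?I. c * G s x) + (LINT s|?I. t * (c * H s x))"
      using that ib[OF G] ib[OF H] by (intro Bochner_Integration.integral_add) auto
    finally show ?thesis by simp
  qed
  show ?thesis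
    unfolding \<T>_eq[OF F C01_combination(1)[OF G H]] \<T>_eq[OF F G] \<T>_eq[OF F H] 1
    using 2[of 0 "\<alpha> ^ m"] 2[of 1 "\<beta> ^ m"] by (simp add: algebra_simps)
qed

theorem proposition2p2:
  fixes \<alpha> \<beta> T \<kappa> c M0 :: real and m :: nat and \<xi> :: "real \<Rightarrow> real \<Rightarrow> real"
  assumes "0 < \<alpha>" "\<alpha> < 1" "0 < \<beta>" "\<beta> < 1" "m \<ge> 1" "T > 0"
    and "\<xi> \<in> \<B> T"
    and "sq_integrable (lebesgue_on ({0..T} \<times> {0..1})) (\<lambda>(s, u). \<xi> s u ^ m)"
    and "\<kappa> > 0" "c > 0" "M0 > 0"
    and "\<E> \<alpha> \<beta> m \<kappa> c T \<xi> \<le> ereal M0"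
  shows "\<exists>D\<in>L2_bd \<alpha> \<beta> m \<kappa> T \<xi>.
    (\<forall>H\<in>C01 T. \<T> \<alpha> \<beta> m T \<xi> H = - inner_L2_bd \<alpha> \<beta> m \<kappa> T \<xi> D H) \<and>
    in_L2_H1 T (\<lambda>s u. \<xi> s u ^ m) \<and>
    (AE s in lebesgue_on {0..T}. is_weak_derivative (\<lambda>u. \<xi> s u ^ m) (D s)) \<and>
    \<E> \<alpha> \<beta> m \<kappa> c T \<xi> = ereal (1 / (4 * c) * inner_L2_bd \<alpha> \<beta> m \<kappa> T \<xi> D D) \<and>
    (AE s in lebesgue_on {0<..T}.
       D s 0 * P \<alpha> m (\<xi> s 0) = \<kappa> * (H1_at_0 (\<lambda>u. \<xi> s u ^ m) - \<alpha> ^ m) \<and>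
       D s 1 * P \<beta> m (\<xi> s 1) = \<kappa> * (\<beta> ^ m - H1_at_1 (\<lambda>u. \<xi> s u ^ m)))"
proof -
  let ?L = "lebesgue_on (cylinder T)" and ?I = "lebesgue_on {0..T}"
  define F where "F s u = \<xi> s u ^ m" for s u
  define w0 where "w0 s = P \<alpha> m (\<xi> s 0) / \<kappa>" for s
  define w1 where "w1 s = P \<beta> m (\<xi> s 1) / \<kappa>" for s
  let ?B = "weighted_form T w0 w1"
  have w: "bounded_weight T w0" "bounded_weight T w1"
    unfolding w0_def w1_def using assms by (auto intro!: bounded_weight_P)
  have FF: "case_prod F = (\<lambda>(s, u). \<xi> s u ^ m)" by (auto simp: F_def)
  have F: "sq_integrable ?L (case_prod F)" unfolding FF by (rule assms(8))
  note F' = assms(8)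
  note \<kappa> = \<open>\<kappa> > 0\<close> and c = \<open>c > 0\<close>
  have form: "inner_L2_bd \<alpha> \<beta> m \<kappa> T \<xi> G H = ?B G H" if "trace_L2 T G" "trace_L2 T H" for G H
    using inner_L2_bd_eq_weighted_form(2)[OF w[unfolded w0_def w1_def] that] by (simp add: w0_def[abs_def] w1_def[abs_def])
  have J: "\<T> \<alpha> \<beta> m T \<xi> H - c * ?B H H \<le> x \<longleftrightarrow> ereal (\<T> \<alpha> \<beta> m T \<xi> H - c * inner_L2_bd \<alpha> \<beta> m \<kappa> T \<xi> H H) \<le> ereal x"
    if "H \<in> C01 T" for H x
    using form[OF trace_L2_C01[OF that] trace_L2_C01[OF that]] by simp
  have bdd: "\<T> \<alpha> \<beta> m T \<xi> H - c * ?B H H \<le> M0" if "H \<in> C01 T" for H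
    unfolding J[OF that] by (rule order_trans[OF SUP_upper[OF that] assms(12)[unfolded \<E>_def]])
  obtain S h G where h: "\<And>n. h n \<in> C01 T" and G: "trace_L2 T G" and GB: "case_prod G \<in> borel_measurable borel"
    and lim: "(\<lambda>n. LINT z|?L. (case_prod (h n) z - case_prod G z)\<^sup>2) \<longlonglongrightarrow> 0"
    and Euler: "\<And>H. H \<in> C01 T \<Longrightarrow> \<T> \<alpha> \<beta> m T \<xi> H = 2 * c * ?B G H"
    and S: "\<And>H. H \<in> C01 T \<Longrightarrow> \<T> \<alpha> \<beta> m T \<xi> H - c * ?B H H \<le> S"
    and limS: "(\<lambda>n. \<T> \<alpha> \<beta> m T \<xi> (h n) - c * ?B (h n) (h n)) \<longlonglongrightarrow> S" and SG: "S = c * ?B G G"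
    by (rule energy_maximizer[OF w c \<T>_linear[OF F'] bdd]) (assumption | (rule that; assumption))+
  define D where "D s u = - 2 * c * G s u" for s u
  have DG: "D = (\<lambda>s u. (- 2 * c) * G s u)" by (intro ext) (simp add: D_def)
  have D: "trace_L2 T D" unfolding DG by (rule trace_L2_scale[OF G])
  have DB: "case_prod D \<in> borel_measurable borel"
  proof -
    have "(\<lambda>z. (- 2 * c) * case_prod G z) \<in> borel_measurable borel" using GB by measurable
    moreover have "case_prod D = (\<lambda>z. (- 2 * c) * case_prod G z)" by (auto simp: D_def)
    ultimately show ?thesis by simp
  qed
  have BD: "?B D H = - 2 * c * ?B G H" for H unfolding DG by (rule weighted_form_scale_left)
  have BDD: "?B D D = 4 * c\<^sup>2 * ?B G G"
    unfolding DG weighted_form_scale_left weighted_form_scale_right by (simp add: power2_eq_square)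
  have L2D: "D \<in> L2_bd \<alpha> \<beta> m \<kappa> T \<xi>"
    using D inner_L2_bd_eq_weighted_form(1)[OF w[unfolded w0_def w1_def] D D]
    by (auto simp: L2_bd_def trace_L2_def sq_integrable_def)
  have rep: "\<T> \<alpha> \<beta> m T \<xi> H = - inner_L2_bd \<alpha> \<beta> m \<kappa> T \<xi> D H" if "H \<in> C01 T" for H
    using Euler[OF that] form[OF D trace_L2_C01[OF that]] BD by simp
  have energy: "\<E> \<alpha> \<beta> m \<kappa> c T \<xi> = ereal (1 / (4 * c) * inner_L2_bd \<alpha> \<beta> m \<kappa> T \<xi> D D)"
  proof -
    have "\<E> \<alpha> \<beta> m \<kappa> c T \<xi> = ereal S"
    proof (rule antisym)
      show "\<E> \<alpha> \<beta> m \<kappa> c T \<xi> \<le> ereal S"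
        unfolding \<E>_def by (rule SUP_least) (simp only: J[symmetric] S)
      have up: "ereal (\<T> \<alpha> \<beta> m T \<xi> (h n) - c * ?B (h n) (h n)) \<le> \<E> \<alpha> \<beta> m \<kappa> c T \<xi>" for n
        unfolding \<E>_def form[OF trace_L2_C01[OF h] trace_L2_C01[OF h], symmetric] by (rule SUP_upper[OF h])
      have "(\<lambda>n. ereal (\<T> \<alpha> \<beta> m T \<xi> (h n) - c * ?B (h n) (h n))) \<longlonglongrightarrow> ereal S"
        using limS by simp
      then show "ereal S \<le> \<E> \<alpha> \<beta> m \<kappa> c T \<xi>"
        by (rule LIMSEQ_le_const2) (use up in blast)
    qed
    also have "S = 1 / (4 * c) * inner_L2_bd \<alpha> \<beta> m \<kappa> T \<xi> D D"
      unfolding form[OF D D] BDD SG using c by (simp add: power2_eq_square)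
    finally show ?thesis .
  qed
  \<comment> \<open>The boundary terms of \<open>\<T>\<close> and of the weighted product, collected by boundary point.\<close>
  define a where "a s = \<alpha> ^ m + w0 s * D s 0" for s
  define b where "b s = \<beta> ^ m - w1 s * D s 1" for s
  have fin: "finite_measure ?I" by (rule finite_measure_ivl)
  have sq1: "sq_integrable ?I (\<lambda>_. 1)" by (rule sq_integrable_bounded[OF fin]) auto
  have sqD: "sq_integrable ?I (\<lambda>s. D s 0)" "sq_integrable ?I (\<lambda>s. D s 1)" "sq_integrable ?L (case_prod D)"
    using D by (auto simp: trace_L2_def)
  have ai: "integrable ?I a" and bi: "integrable ?I b"
    using integrable_weighted[OF w(1) sqD(1) sq1] integrable_weighted[OF w(2) sqD(2) sq1]
    by (simp_all add: a_def[abs_def] b_def[abs_def])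
  have weak: "(LINT z|?L. case_prod F z * case_prod (space_deriv H) z) + (LINT z|?L. case_prod D z * case_prod H z)
      + (LINT s|?I. a s * H s 0) - (LINT s|?I. b s * H s 1) = 0" if H: "H \<in> C01 T" for H
  proof -
    have sqH: "sq_integrable ?I (\<lambda>s. H s 0)" "sq_integrable ?I (\<lambda>s. H s 1)"
      using trace_L2_C01[OF H] by (auto simp: trace_L2_def)
    have "(LINT s|?I. a s * H s 0) = (LINT s|?I. \<alpha> ^ m * H s 0 + w0 s * D s 0 * H s 0)"
      by (intro Bochner_Integration.integral_cong refl) (simp add: a_def algebra_simps)
    also have "\<dots> = (LINT s|?I. \<alpha> ^ m * H s 0) + (LINT s|?I. w0 s * D s 0 * H s 0)"
      using sq_integrable_imp_integrable[OF fin sqH(1)] integrable_weighted[OF w(1) sqD(1) sqH(1)]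
      by (intro Bochner_Integration.integral_add) auto
    finally have A: "(LINT s|?I. a s * H s 0) = (LINT s|?I. \<alpha> ^ m * H s 0) + (LINT s|?I. w0 s * D s 0 * H s 0)" .
    have "(LINT s|?I. b s * H s 1) = (LINT s|?I. \<beta> ^ m * H s 1 - w1 s * D s 1 * H s 1)"
      by (intro Bochner_Integration.integral_cong refl) (simp add: b_def algebra_simps)
    also have "\<dots> = (LINT s|?I. \<beta> ^ m * H s 1) - (LINT s|?I. w1 s * D s 1 * H s 1)"
      using sq_integrable_imp_integrable[OF fin sqH(2)] integrable_weighted[OF w(2) sqD(2) sqH(2)]
      by (intro Bochner_Integration.integral_diff) auto
    finally have Bb: "(LINT s|?I. b s * H s 1) = (LINT s|?I. \<beta> ^ m * H s 1) - (LINT s|?I. w1 s * D s 1 * H s 1)" .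
    have "\<T> \<alpha> \<beta> m T \<xi> H = - ?B D H"
      using rep[OF H] form[OF D trace_L2_C01[OF H]] by simp
    then show ?thesis
      unfolding \<T>_eq[OF F' H] weighted_form_def A Bb FF by argo
  qed
  have ab: "AE s in ?I. a s + primitive (D s) 1 = b s"
    by (rule weak_equation_imp_primitive(1)[OF F DB sqD(3) ai bi weak])
  have Fa: "AE s in ?I. AE u in lebesgue_on {0..1}. F s u = a s + primitive (D s) u"
    by (rule weak_equation_imp_primitive(2)[OF F DB sqD(3) ai bi weak])
  have Ds: "AE s in ?I. integrable (lebesgue_on {0..1}) (D s)"
    using Fubini_cylinder(1)[OF sq_integrable_imp_integrable[OF finite_measure_cylinder sqD(3)]] by simp
  have wd: "AE s in ?I. is_weak_derivative (\<lambda>u. \<xi> s u ^ m) (D s)"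
    using Fa Ds by eventually_elim (rule is_weak_derivative_primitive, auto simp: F_def)
  have tr: "AE s in ?I. D s 0 * P \<alpha> m (\<xi> s 0) = \<kappa> * (H1_at_0 (\<lambda>u. \<xi> s u ^ m) - \<alpha> ^ m) \<and>
       D s 1 * P \<beta> m (\<xi> s 1) = \<kappa> * (\<beta> ^ m - H1_at_1 (\<lambda>u. \<xi> s u ^ m))"
    using Fa Ds ab
  proof eventually_elim
    case (elim s)
    have "H1_at_0 (\<lambda>u. \<xi> s u ^ m) = a s" "H1_at_1 (\<lambda>u. \<xi> s u ^ m) = b s"
      using traces_primitive[OF elim(2), of "\<lambda>u. \<xi> s u ^ m" "a s"] elim(1,3) by (simp_all add: F_def)
    then show ?case using \<kappa> by (simp add: a_def b_def w0_def w1_def)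
  qed
  have tr': "AE s in lebesgue_on {0<..T}. D s 0 * P \<alpha> m (\<xi> s 0) = \<kappa> * (H1_at_0 (\<lambda>u. \<xi> s u ^ m) - \<alpha> ^ m) \<and>
       D s 1 * P \<beta> m (\<xi> s 1) = \<kappa> * (\<beta> ^ m - H1_at_1 (\<lambda>u. \<xi> s u ^ m))"
    by (rule AE_lebesgue_on_subset[OF tr]) auto
  have H1: "in_L2_H1 T F"
  proof -
    \<comment> \<open>Scaling the maximizing sequence like the maximizer gives continuous approximations of \<open>D\<close>.\<close>
    define h' where "h' n s u = - 2 * c * h n s u" for n s u
    have h'eq: "case_prod (h' n) z = - 2 * c * case_prod (h n) z" for n z by (cases z) (simp add: h'_def)
    have D_eq: "case_prod D z = - 2 * c * case_prod G z" for z by (cases z) (simp add: D_def)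
    have h'c: "continuous_on (cylinder T) (case_prod (h' n))" for n
      unfolding h'eq[abs_def] by (intro continuous_intros C01_continuous(1)[OF h])
    have sq: "(- 2 * c * x - - 2 * c * y)\<^sup>2 = (2 * c)\<^sup>2 * (x - y)\<^sup>2" for x y
    proof -
      have "- 2 * c * x - - 2 * c * y = - (2 * c * (x - y))" by (simp add: right_diff_distrib)
      then show ?thesis by (simp only: power2_minus power_mult_distrib)
    qed
    have "(LINT z|?L. (case_prod (h' n) z - case_prod D z)\<^sup>2)
        = (2 * c)\<^sup>2 * (LINT z|?L. (case_prod (h n) z - case_prod G z)\<^sup>2)" for n
      unfolding h'eq D_eq sq by (rule integral_mult_right_zero)
    moreover have "(\<lambda>n. (2 * c)\<^sup>2 * (LINT z|?L. (case_prod (h n) z - case_prod G z)\<^sup>2)) \<longlonglongrightarrow> 0"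
      by (rule tendsto_mult_right_zero[OF lim])
    ultimately have lim': "(\<lambda>n. LINT z|?L. (case_prod (h' n) z - case_prod D z)\<^sup>2) \<longlonglongrightarrow> 0"
      by (simp only:)
    obtain E :: "nat \<Rightarrow> real \<Rightarrow> real" where E: "\<forall>i. continuous_on {0..1} (E i)"
      "AE s in ?I. \<forall>e>0. \<exists>i. (LINT u|lebesgue_on {0..1}. (D s u - E i u)\<^sup>2) < e"
      using sections_in_closure_of_countable_family[OF \<open>T > 0\<close> sqD(3) h'c lim'] by blast
    show ?thesis
      by (rule in_L2_H1_primitive[OF borel_measurable_integrable[OF ai] _ _ Fa E(1)[rule_format] E(2)]) (use sqD(3) F in simp_all)
  qed
  have "F = (\<lambda>s u. \<xi> s u ^ m)" by (intro ext) (simp add: F_def)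
  with H1 have "in_L2_H1 T (\<lambda>s u. \<xi> s u ^ m)" by simp
  with L2D rep wd energy tr' show ?thesis by blast
qed

end
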